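(* Let $n\ge 2$, let $Q$ be an acyclic quiver of type $\widetilde{\mathbb{A}}_n$ with vertex set $Q_0$, and let $V$ be a nonzero finite-dimensional representation of $Q$ over an algebraically closed field $\mathbb{K}$. Let $V^\bullet$ be the Harder-Narasimhan filtration of $V$ along the Euler stability condition $\epsilon$, and let $S^j:=V^j/V^{j-1}$ be its successive quotients. Let $d^*_{u,v}$ and $d^*_\infty$ be the multiplicities in the decomposition $$\mathcal{L}V\simeq\mathbf{I}[-\infty,\infty]^{d^*_\infty}\oplus\bigoplus_{[u,v]}\Big(\bigoplus_{c\in\mathbb{Z}}\mathbf{I}[u+cn,v+cn]\Big)^{d^*_{u,v}}$$ of the lift $\mathcal{L}V$ of $V$ to the unwinding of $Q$ (the sum being over integer intervals $[u,v]$ with $0\le u\le n-1$). If $\phi_\epsilon(S^j)\ne 0$, then for each vertex $x\in Q_0$ $$\dim (S^j)_x=\sum_{\mathbf{N}[u,v]}d^*_{u,v}\cdot\dim\mathbf{N}[u,v]_x,$$ where the sum is over all $\mathbf{N}[u,v]$ appearing in the decomposition of $V$ into indecomposables which have the same $\epsilon$-slope as $S^j$. If $\phi_\epsilon(S^j)=0$, then for each vertex $x\in Q_0$ $$\dim (S^j)_x=d^*_\infty+\sum_{\mathbf{N}[u,v]}d^*_{u,v}\cdot\dim\mathbf{N}[u,v]_x,$$ where the sum is over the indecomposable summands $\mathbf{N}[u,v]$ of $V$ (each isomorphism class counted once) that satisfy $\phi_\epsilon(\mathbf{N}[u,v])=0$.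
   Context: A quiver of type $\widetilde{\mathbb{A}}_n$ ($n>1$) has vertices $x_0,\dots,x_{n-1}$ and edges $e_0,\dots,e_{n-1}$, where $e_j$ joins $x_{j-1}$ and $x_j$ in either direction (indices modulo $n$, so $e_0$ joins $x_{n-1}$ and $x_0$); acyclic means there is no directed cycle. The representation $\mathbf{N}[u,v]$, for integers $u\le v$: it has a basis $(b_m)_{m\in\mathbb{Z}, u\le m\le v}$ with $b_m$ lying in the space at $x_{m \bmod n}$ (so $\dim\mathbf{N}[u,v]_{x_j}=\#([u,v]\cap(j+n\mathbb{Z}))$). If $e_j$ is directed from $x_{j-1}$ to $x_j$, its map sends $b_m$ (with $m\equiv j-1$ mod $n$) to $b_{m+1}$ if $m+1\le v$ and to $0$ otherwise; if $e_j$ is directed from $x_j$ to $x_{j-1}$, its map sends $b_m$ (with $m\equiv j$ mod $n$) to $b_{m-1}$ if $m-1\ge u$ and to $0$ otherwise. Since $\mathbf{N}[u,v]\simeq\mathbf{N}[u+n,v+n]$, one takes $u\in\{0,\dots,n-1\}$. The representation $\mathbf{T}[\lambda;w]$, for $0\ne\lambda\in\mathbb{K}$ and $w\ge1$, has $\mathbb{K}^w$ at each vertex, the identity on each $e_j$ with $j\ne0$, and the $w\times w$ Jordan block with diagonal $\lambda$ on $e_0$. Over algebraically closed $\mathbb{K}$ the indecomposable finite-dimensional representations of $Q$ are, up to isomorphism, exactly the $\mathbf{N}[u,v]$ and $\mathbf{T}[\lambda;w]$. The unwinding $\mathbf{U}Q$ of $Q$ is the infinite quiver with vertex set $Q_0\times\mathbb{Z}$,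 identified with $\mathbb{Z}$ by $(x_i,c)\mapsto i+cn$, and edges $(e_j,c)$, $c\in\mathbb{Z}$: the edge $(e_j,c)$ joins the vertices $j-1+cn$ and $j+cn$, with direction that of $e_j$. The lift $\mathcal{L}V$ is the representation of $\mathbf{U}Q$ assigning $V_{x_j}$ to each $(x_j,c)$ and $V_{e_j}$ to each $(e_j,c)$. For an integer interval $[u,v]$ with $u,v\in\mathbb{Z}\cup\{\pm\infty\}$, $\mathbf{I}[u,v]$ is the representation of $\mathbf{U}Q$ with $\mathbb{K}$ at the integers in $[u,v]$, $0$ elsewhere, and identity edge maps whenever source and target are both nonzero. The lift $\mathcal{L}V$ has a decomposition of the displayed form with uniquely determined multiplicities (with value $0$ for summands that do not occur). For a finite acyclic quiver and $\alpha:Q_0\to\mathbb{R}$, the $\alpha$-slope of a nonzero finite-dimensional representation is $\phi_\alpha(V)=\frac{\sum_{x}\alpha_x\dim V_x}{\sum_{x}\dim V_x}$; $V\neq0$ is $\alpha$-semistable if $\phi_\alpha(U)\le\phi_\alpha(V)$ for every nonzero subrepresentation $U\subset V$. The Harder-Narasimhan filtration of $V\ne0$ along $\alpha$ is the unique filtration $0=V^0\subsetneq V^1\subsetneq\dots\subsetneq V^m=V$ by subrepresentations whose successive quotients are $\alpha$-semistable with strictly decreasing $\alpha$-slopes. The Euler stability condition is $\epsilon(x):=1-\deg_{\mathrm{in}}(x)$, where $\deg_{\mathrm{in}}(x)$ is the number of edges with target $x$. *)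

theory Defs
  imports
    "HOL-Library.Function_Algebras"
    "HOL-Library.FuncSet"
    "HOL-Library.Extended"
    "HOL-Computational_Algebra.Polynomial"
    "Graph_Theory.Graph_Theory"
begin

section \<open>Representations of quivers\<close>

text \<open>
  A quiver is a directed multigraph, i.e. a \<^typ>\<open>('v, 'e) pre_digraph\<close>. All vector spaces of a
  representation are subspaces of one ambient vector space, given by a type \<open>'b\<close> together with a
  scalar multiplication. Only the values of \<open>rmap V e\<close> on \<open>rspace V (tail Q e)\<close> are meaningful.
\<close>

record ('v, 'e, 'k, 'b) qrep =
  rscale :: "'k \<Rightarrow> 'b \<Rightarrow> 'b"
  rspace :: "'v \<Rightarrow> 'b set"
  rmap :: "'e \<Rightarrow> 'b \<Rightarrow> 'b"

definition linear_between ::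
    "('k \<Rightarrow> 'b \<Rightarrow> 'b) \<Rightarrow> ('k \<Rightarrow> 'c \<Rightarrow> 'c) \<Rightarrow> 'b::ab_group_add set \<Rightarrow> 'c::ab_group_add set
      \<Rightarrow> ('b \<Rightarrow> 'c) \<Rightarrow> bool" where
  "linear_between s1 s2 A B f \<longleftrightarrow>
     f \<in> A \<rightarrow> B \<and>
     (\<forall>a\<in>A. \<forall>b\<in>A. f (a + b) = f a + f b) \<and>
     (\<forall>k. \<forall>a\<in>A. f (s1 k a) = s2 k (f a))"

definition quiver_rep ::
    "('v, 'e) pre_digraph \<Rightarrow> ('v, 'e, 'k::field, 'b::ab_group_add) qrep \<Rightarrow> bool" where
  "quiver_rep Q V \<longleftrightarrow>
     vector_space (rscale V) \<and>
     (\<forall>x\<in>verts Q. module.subspace (rscale V) (rspace V x)) \<and>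
     (\<forall>e\<in>arcs Q. linear_between (rscale V) (rscale V)
        (rspace V (tail Q e)) (rspace V (head Q e)) (rmap V e))"

definition finite_dim_rep ::
    "('v, 'e) pre_digraph \<Rightarrow> ('v, 'e, 'k::field, 'b::ab_group_add) qrep \<Rightarrow> bool" where
  "finite_dim_rep Q V \<longleftrightarrow>
     quiver_rep Q V \<and> finite (verts Q) \<and>
     (\<forall>x\<in>verts Q. \<exists>B. finite B \<and> module.span (rscale V) B = rspace V x)"

definition dim_at :: "('v, 'e, 'k::field, 'b::ab_group_add) qrep \<Rightarrow> 'v \<Rightarrow> nat" where
  "dim_at V x = vector_space.dim (rscale V) (rspace V x)"

definition nonzero_rep ::
    "('v, 'e) pre_digraph \<Rightarrow> ('v, 'e, 'k, 'b::zero) qrep \<Rightarrow> bool" where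
  "nonzero_rep Q V \<longleftrightarrow> (\<exists>x\<in>verts Q. rspace V x \<noteq> {0})"

definition rep_hom ::
    "('v, 'e) pre_digraph \<Rightarrow> ('v, 'e, 'k, 'b::ab_group_add) qrep
      \<Rightarrow> ('v, 'e, 'k, 'c::ab_group_add) qrep \<Rightarrow> ('v \<Rightarrow> 'b \<Rightarrow> 'c) \<Rightarrow> bool" where
  "rep_hom Q V W f \<longleftrightarrow>
     (\<forall>x\<in>verts Q. linear_between (rscale V) (rscale W) (rspace V x) (rspace W x) (f x)) \<and>
     (\<forall>e\<in>arcs Q. \<forall>b\<in>rspace V (tail Q e).
        f (head Q e) (rmap V e b) = rmap W e (f (tail Q e) b))"

definition rep_iso ::
    "('v, 'e) pre_digraph \<Rightarrow> ('v, 'e, 'k, 'b::ab_group_add) qrep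
      \<Rightarrow> ('v, 'e, 'k, 'c::ab_group_add) qrep \<Rightarrow> bool" where
  "rep_iso Q V W \<longleftrightarrow>
     (\<exists>f. rep_hom Q V W f \<and> (\<forall>x\<in>verts Q. bij_betw (f x) (rspace V x) (rspace W x)))"

text \<open>A subrepresentation is given by its family of subspaces.\<close>

definition subrep ::
    "('v, 'e) pre_digraph \<Rightarrow> ('v, 'e, 'k::field, 'b::ab_group_add) qrep \<Rightarrow> ('v \<Rightarrow> 'b set) \<Rightarrow> bool"
  where
  "subrep Q V U \<longleftrightarrow>
     (\<forall>x\<in>verts Q. module.subspace (rscale V) (U x) \<and> U x \<subseteq> rspace V x) \<and>
     (\<forall>e\<in>arcs Q. rmap V e ` U (tail Q e) \<subseteq> U (head Q e))"

definition restrict_rep ::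
    "('v, 'e, 'k, 'b) qrep \<Rightarrow> ('v \<Rightarrow> 'b set) \<Rightarrow> ('v, 'e, 'k, 'b) qrep" where
  "restrict_rep V U = V\<lparr>rspace := U\<rparr>"

text \<open>
  \<open>S\<close> is (a model of) the quotient \<open>V / U\<close>: there is a surjective homomorphism from \<open>V\<close> to \<open>S\<close>
  with kernel \<open>U\<close>.
\<close>

definition quotient_rep ::
    "('v, 'e) pre_digraph \<Rightarrow> ('v, 'e, 'k::field, 'b::ab_group_add) qrep \<Rightarrow> ('v \<Rightarrow> 'b set)
      \<Rightarrow> ('v, 'e, 'k, 'c::ab_group_add) qrep \<Rightarrow> bool" where
  "quotient_rep Q V U S \<longleftrightarrow>
     subrep Q V U \<and> quiver_rep Q S \<and>
     (\<exists>p. rep_hom Q V S p \<and>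
        (\<forall>x\<in>verts Q. p x ` rspace V x = rspace S x \<and> {b\<in>rspace V x. p x b = 0} = U x))"

definition rep_sum ::
    "'i set \<Rightarrow> ('i \<Rightarrow> ('v, 'e, 'k, 'b::zero) qrep) \<Rightarrow> ('v, 'e, 'k, 'i \<Rightarrow> 'b) qrep" where
  "rep_sum I M =
     \<lparr>rscale = (\<lambda>k f i. rscale (M i) k (f i)),
      rspace = (\<lambda>x. {f. finite {i. f i \<noteq> 0} \<and> (\<forall>i. if i \<in> I then f i \<in> rspace (M i) x else f i = 0)}),
      rmap = (\<lambda>e f i. if i \<in> I then rmap (M i) e (f i) else 0)\<rparr>"

text \<open>\<open>V\<close> is the internal direct sum of the subrepresentations \<open>M 0, \<dots>, M (r - 1)\<close>.\<close>

definition internal_sum ::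
    "('v, 'e) pre_digraph \<Rightarrow> ('v, 'e, 'k::field, 'b::ab_group_add) qrep \<Rightarrow> nat
      \<Rightarrow> (nat \<Rightarrow> 'v \<Rightarrow> 'b set) \<Rightarrow> bool" where
  "internal_sum Q V r M \<longleftrightarrow>
     (\<forall>i<r. subrep Q V (M i)) \<and>
     (\<forall>x\<in>verts Q. \<forall>b\<in>rspace V x. \<exists>!w. w \<in> (\<Pi>\<^sub>E i\<in>{..<r}. M i x) \<and> (\<Sum>i<r. w i) = b)"

definition indecomposable_rep ::
    "('v, 'e) pre_digraph \<Rightarrow> ('v, 'e, 'k::field, 'b::ab_group_add) qrep \<Rightarrow> bool" where
  "indecomposable_rep Q V \<longleftrightarrow>
     quiver_rep Q V \<and> nonzero_rep Q V \<and>
     (\<forall>U W. subrep Q V U \<and> subrep Q V W \<and>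
        (\<forall>x\<in>verts Q. U x \<inter> W x = {0} \<and> rspace V x = {u + w | u w. u \<in> U x \<and> w \<in> W x})
        \<longrightarrow> \<not> nonzero_rep Q (restrict_rep V U) \<or> \<not> nonzero_rep Q (restrict_rep V W))"

definition indecomposable_decomposition ::
    "('v, 'e) pre_digraph \<Rightarrow> ('v, 'e, 'k::field, 'b::ab_group_add) qrep \<Rightarrow> nat
      \<Rightarrow> (nat \<Rightarrow> 'v \<Rightarrow> 'b set) \<Rightarrow> bool" where
  "indecomposable_decomposition Q V r M \<longleftrightarrow>
     internal_sum Q V r M \<and> (\<forall>i<r. indecomposable_rep Q (restrict_rep V (M i)))"

section \<open>Slopes and Harder-Narasimhan filtrations\<close>

definition slope ::
    "('v, 'e) pre_digraph \<Rightarrow> ('v \<Rightarrow> real) \<Rightarrow> ('v, 'e, 'k::field, 'b::ab_group_add) qrep \<Rightarrow> real"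
  where
  "slope Q \<alpha> V =
     (\<Sum>x\<in>verts Q. \<alpha> x * real (dim_at V x)) / (\<Sum>x\<in>verts Q. real (dim_at V x))"

definition semistable ::
    "('v, 'e) pre_digraph \<Rightarrow> ('v \<Rightarrow> real) \<Rightarrow> ('v, 'e, 'k::field, 'b::ab_group_add) qrep \<Rightarrow> bool"
  where
  "semistable Q \<alpha> V \<longleftrightarrow>
     nonzero_rep Q V \<and>
     (\<forall>U. subrep Q V U \<and> nonzero_rep Q (restrict_rep V U)
        \<longrightarrow> slope Q \<alpha> (restrict_rep V U) \<le> slope Q \<alpha> V)"

text \<open>\<open>F 0, \<dots>, F m\<close> is the filtration and \<open>S 1, \<dots>, S m\<close> are its successive quotients.\<close>

definition HN_filtration ::
    "('v, 'e) pre_digraph \<Rightarrow> ('v \<Rightarrow> real) \<Rightarrow> ('v, 'e, 'k::field, 'b::ab_group_add) qrep \<Rightarrow> nat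
      \<Rightarrow> (nat \<Rightarrow> 'v \<Rightarrow> 'b set) \<Rightarrow> (nat \<Rightarrow> ('v, 'e, 'k, 'c::ab_group_add) qrep) \<Rightarrow> bool" where
  "HN_filtration Q \<alpha> V m F S \<longleftrightarrow>
     (\<forall>x\<in>verts Q. F 0 x = {0} \<and> F m x = rspace V x) \<and>
     (\<forall>j\<le>m. subrep Q V (F j)) \<and>
     (\<forall>j\<in>{1..m}. (\<forall>x\<in>verts Q. F (j - 1) x \<subseteq> F j x) \<and> (\<exists>x\<in>verts Q. F (j - 1) x \<noteq> F j x)) \<and>
     (\<forall>j\<in>{1..m}. quotient_rep Q (restrict_rep V (F j)) (F (j - 1)) (S j) \<and> semistable Q \<alpha> (S j)) \<and>
     (\<forall>j\<in>{1..<m}. slope Q \<alpha> (S (j + 1)) < slope Q \<alpha> (S j))"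

definition euler_stability :: "('v, 'e) pre_digraph \<Rightarrow> 'v \<Rightarrow> real" where
  "euler_stability Q x = 1 - real (in_degree Q x)"

section \<open>Cyclic quivers, their unwindings, and the representations attached to intervals\<close>

text \<open>
  Vertices \<open>x\<^sub>j\<close> and edges \<open>e\<^sub>j\<close> are represented by the integers \<open>j \<in> {0..<n}\<close>; \<open>fwd j\<close> says that
  \<open>e\<^sub>j\<close> is directed from \<open>x\<^sub>j\<^sub>-\<^sub>1\<close> to \<open>x\<^sub>j\<close>.
\<close>

definition cyclic_quiver :: "nat \<Rightarrow> (int \<Rightarrow> bool) \<Rightarrow> (int, int) pre_digraph" where
  "cyclic_quiver n fwd =
     \<lparr>verts = {0..<int n}, arcs = {0..<int n},
      tail = (\<lambda>j. if fwd j then (j - 1) mod int n else j),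
      head = (\<lambda>j. if fwd j then j else (j - 1) mod int n)\<rparr>"

definition acyclic_quiver :: "('v, 'e) pre_digraph \<Rightarrow> bool" where
  "acyclic_quiver Q \<longleftrightarrow> (\<nexists>p. pre_digraph.cycle Q p)"

definition unwinding :: "nat \<Rightarrow> (int \<Rightarrow> bool) \<Rightarrow> (int, int \<times> int) pre_digraph" where
  "unwinding n fwd =
     \<lparr>verts = UNIV, arcs = {0..<int n} \<times> UNIV,
      tail = (\<lambda>(j, c). if fwd j then j - 1 + c * int n else j + c * int n),
      head = (\<lambda>(j, c). if fwd j then j + c * int n else j - 1 + c * int n)\<rparr>"

definition lift_rep :: "nat \<Rightarrow> (int, int, 'k, 'b) qrep \<Rightarrow> (int, int \<times> int, 'k, 'b) qrep" where
  "lift_rep n V =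
     \<lparr>rscale = rscale V, rspace = (\<lambda>m. rspace V (m mod int n)), rmap = (\<lambda>(j, c). rmap V j)\<rparr>"

text \<open>
  The basis vector \<open>b\<^sub>m\<close> of \<open>N[u,v]\<close> is the indicator function of \<open>{m}\<close>, so that moving basis
  vectors up (down) by one becomes a shift of the argument by \<open>-1\<close> (by \<open>1\<close>).
\<close>

definition N_rep ::
    "nat \<Rightarrow> (int \<Rightarrow> bool) \<Rightarrow> int \<Rightarrow> int \<Rightarrow> (int, int, 'k::field, int \<Rightarrow> 'k) qrep" where
  "N_rep n fwd u v =
     \<lparr>rscale = (\<lambda>k f m. k * f m),
      rspace = (\<lambda>j. {f. \<forall>m. f m \<noteq> 0 \<longrightarrow> u \<le> m \<and> m \<le> v \<and> m mod int n = j}),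
      rmap = (\<lambda>j f m. if u \<le> m \<and> m \<le> v then f (if fwd j then m - 1 else m + 1) else 0)\<rparr>"

definition I_rep ::
    "nat \<Rightarrow> (int \<Rightarrow> bool) \<Rightarrow> int extended \<Rightarrow> int extended \<Rightarrow> (int, int \<times> int, 'k::field, 'k) qrep"
  where
  "I_rep n fwd u v =
     \<lparr>rscale = (*),
      rspace = (\<lambda>m. if u \<le> Fin m \<and> Fin m \<le> v then UNIV else {0}),
      rmap = (\<lambda>e b. if u \<le> Fin (tail (unwinding n fwd) e) \<and> Fin (tail (unwinding n fwd) e) \<le> v \<and>
                       u \<le> Fin (head (unwinding n fwd) e) \<and> Fin (head (unwinding n fwd) e) \<le> v
                    then b else 0)\<rparr>"

text \<open>
  The decomposition of the lift with multiplicities \<open>dinf\<close> of \<open>I[-\<infinity>,\<infinity>]\<close> and \<open>d u v\<close> of the sum of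
  all \<open>I[u + c n, v + c n]\<close>, where \<open>0 \<le> u \<le> n - 1\<close> and \<open>v\<close> is an integer or \<open>\<infinity>\<close>. The component
  \<open>k\<close> of an index counts the copies.
\<close>

definition lift_decomposition ::
    "nat \<Rightarrow> (int \<Rightarrow> bool) \<Rightarrow> (int, int, 'k::field, 'b::ab_group_add) qrep
      \<Rightarrow> nat \<Rightarrow> (int \<Rightarrow> int extended \<Rightarrow> nat) \<Rightarrow> bool" where
  "lift_decomposition n fwd V dinf d \<longleftrightarrow>
     rep_iso (unwinding n fwd) (lift_rep n V)
       (rep_sum
         ({..<dinf} <+> {(u, v, c, k). u \<in> {0..<int n} \<and> Fin u \<le> v \<and> k < d u v})
         (case_sum
           (\<lambda>k. I_rep n fwd Minf Pinf)
           (\<lambda>(u, v, c, k). I_rep n fwd (Fin (u + c * int n)) (v + Fin (c * int n)))))"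

text \<open>
  The pairs \<open>(u, v)\<close> with \<open>0 \<le> u \<le> n - 1\<close> such that \<open>N[u,v]\<close> is isomorphic to one of the summands
  \<open>M 0, \<dots>, M (r - 1)\<close> of \<open>V\<close>.
\<close>

definition N_summands ::
    "nat \<Rightarrow> (int \<Rightarrow> bool) \<Rightarrow> (int, int, 'k::field, 'b::ab_group_add) qrep \<Rightarrow> nat
      \<Rightarrow> (nat \<Rightarrow> int \<Rightarrow> 'b set) \<Rightarrow> (int \<times> int) set" where
  "N_summands n fwd V r M =
     {(u, v). u \<in> {0..<int n} \<and> u \<le> v \<and>
        (\<exists>i<r. rep_iso (cyclic_quiver n fwd) (restrict_rep V (M i))
                 (N_rep n fwd u v :: (int, int, 'k, int \<Rightarrow> 'k) qrep))}"

end

theory Submission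
  imports Defs
begin

text \<open>
  The decomposition of the lift yields a basis of \<open>V\<close> at each vertex, and the position of each
  basis vector relative to the Harder-Narasimhan filtration is determined by the slope of its interval.

  Let \<open>i\<close> be a summand of the lift, with interval \<open>J\<close>. Its basis vectors form a \<open>J\<close>-indexed
  family of vectors of \<open>V\<close> compatible with the edges (a chain), and its coordinate functionals form
  a compatible family of functionals (a cochain). If \<open>J = [u,v]\<close> is finite, a chain is the same as
  a homomorphism \<open>N[u,v] \<rightarrow> V\<close> and a cochain the same as a homomorphism \<open>V \<rightarrow> N[u,v]\<close>. Now
  \<open>N[u,v]\<close> is semistable: twice the Euler degree of a dimension vector is the sum over the edges of
  the dimension at the tail minus the dimension at the head, and the maps of \<open>N[u,v]\<close> have a total
  kernel of dimension at most two (\<open>N_semistable\<close>). Since there are no nonzero homomorphisms from a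
  semistable representation to a representation all of whose Harder-Narasimhan slopes are smaller,
  the basis vectors of \<open>i\<close> lie in a filtration step as soon as all slopes of the quotient of \<open>V\<close> by
  this step are smaller than that of \<open>N[u,v]\<close>, and dually the coordinate functionals of \<open>i\<close> vanish
  on a step all of whose slopes are larger. Bi-infinite chains and cochains behave like homomorphisms
  from and to a semistable representation of slope 0: the values of all chains form a subrepresentation
  with surjective maps, the common zeros of all cochains one with injective maps on the quotient, and
  this fixes the sign of the degree (\<open>infinite_chain_in_F\<close>, \<open>infinite_cochain_vanishes\<close>).

  Assign slope 0 to the summands \<open>I[-\<infinity>,\<infinity>]\<close>. At a vertex \<open>x\<close> the basis vectors of the summands
  with slope at least that of \<open>S\<^sub>j\<close> therefore lie in \<open>V\<^sub>j\<close> while the coordinates of all others vanish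
  there, and \<open>V\<^bsub>j-1\<^esub>\<close> is described by the strict inequality. So the dimension of \<open>S\<^sub>j\<close> at \<open>x\<close> is
  the number of summands alive at \<open>x\<close> with the same slope as \<open>S\<^sub>j\<close> (\<open>dim_quotient\<close>). Rays do not
  occur among the summands because their translates would accumulate at a single vertex.

  It remains that every interval of positive multiplicity contributes a summand \<open>N[u,v]\<close> of \<open>V\<close>.
  The chain and the cochain of one copy compose to an endomorphism of \<open>N[u,v]\<close> with diagonal
  coefficient 1. Inserting the projections to the indecomposable summands of \<open>V\<close> writes this 1 as a
  sum, so some summand gives an endomorphism with nonzero diagonal coefficient. Endomorphisms of
  \<open>N[u,v]\<close> are triangular with constant diagonal, so this one is invertible, and the indecomposable
  summand splits off \<open>N[u,v]\<close> and hence equals it (\<open>interval_in_N_summands\<close>).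
\<close>

section \<open>Dimensions of finite-dimensional subspaces\<close>

text \<open>
  The ambient space may be infinite-dimensional, and there \<^term>\<open>vector_space.dim\<close> assigns 0 to
  subspaces without a finite basis. Finiteness is therefore carried along with the subspace.
\<close>

definition fd_subspace :: "('k::field \<Rightarrow> 'b::ab_group_add \<Rightarrow> 'b) \<Rightarrow> 'b set \<Rightarrow> bool" where
  "fd_subspace s A \<longleftrightarrow> module.subspace s A \<and> (\<exists>X. finite X \<and> module.span s X = A)"

context vector_space
begin

text \<open>
  A basis given as an indexed family. This form suits the two later uses, where the vectors come from
  two different sources or are indexed by direct summands.
\<close>

lemma dim_eq_card_family:
  assumes "finite P" "subspace W" "\<And>i. i \<in> P \<Longrightarrow> e i \<in> W"
    and spanning: "\<And>w. w \<in> W \<Longrightarrow> \<exists>a. w = (\<Sum>i\<in>P. scale (a i) (e i))"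
    and indep: "\<And>a i. (\<Sum>i\<in>P. scale (a i) (e i)) = 0 \<Longrightarrow> i \<in> P \<Longrightarrow> a i = 0"
  shows "dim W = card P"
proof -
  have inj: "inj_on e P"
  proof (rule inj_onI, rule ccontr)
    fix i j assume ij: "i \<in> P" "j \<in> P" "e i = e j" "i \<noteq> j"
    let ?a = "\<lambda>k. if k = i then 1 else if k = j then - 1 else 0"
    have "(\<Sum>k\<in>P. scale (?a k) (e k)) = (\<Sum>k\<in>{i, j}. scale (?a k) (e k))"
      using ij assms(1) by (intro sum.mono_neutral_right) auto
    also have "\<dots> = 0" using ij by auto
    finally have 0: "(\<Sum>k\<in>P. scale (?a k) (e k)) = 0" .
    show False using indep[OF 0 ij(1)] by simp
  qed
  have "independent (e ` P)"
  proof (rule independent_if_scalars_zero)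
    fix f x assume 0: "(\<Sum>x\<in>e ` P. scale (f x) x) = 0" and x: "x \<in> e ` P"
    from 0 have "(\<Sum>i\<in>P. scale (f (e i)) (e i)) = 0"
      by (simp add: sum.reindex[OF inj])
    from indep[OF this] x show "f x = 0" by auto
  qed (use assms in auto)
  moreover have "W \<subseteq> span (e ` P)"
  proof
    fix w assume "w \<in> W"
    then obtain a where "w = (\<Sum>i\<in>P. scale (a i) (e i))" using spanning by blast
    then show "w \<in> span (e ` P)" by (auto intro!: span_sum span_scale intro: span_base)
  qed
  ultimately show ?thesis
    using dim_unique[of "e ` P" W "card P"] assms(3) card_image[OF inj] by auto
qed

lemma fd_basis:
  assumes "fd_subspace scale B"
  obtains X where "finite X" "X \<subseteq> B" "independent X" "span X = B" "card X = dim B"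
proof -
  obtain Y where Y: "finite Y" "span Y = B" and B: "subspace B"
    using assms by (auto simp: fd_subspace_def)
  obtain X where X: "X \<subseteq> B" "independent X" "B \<subseteq> span X" "card X = dim B"
    using basis_exists by blast
  have "finite X" using independent_span_bound[of Y X] X Y by auto
  moreover have "span X = B" using X B by (metis span_subspace)
  ultimately show ?thesis using that X by blast
qed

lemma fd_basis_extend:
  assumes B: "fd_subspace scale B" and A: "subspace A" "A \<subseteq> B"
  obtains X0 X where "finite X" "X0 \<subseteq> X" "independent X" "span X0 = A" "span X = B"
    "card X0 = dim A" "card X = dim B"
proof -
  obtain Y where Y: "finite Y" "span Y = B" and B: "subspace B"
    using B by (auto simp: fd_subspace_def)
  obtain X0 where X0: "X0 \<subseteq> A" "independent X0" "A \<subseteq> span X0" "card X0 = dim A"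
    using basis_exists by blast
  obtain X where X: "X0 \<subseteq> X" "X \<subseteq> B" "independent X" "B \<subseteq> span X"
    using maximal_independent_subset_extend[of X0 B] X0 A by blast
  have "finite X" using independent_span_bound[of Y X] X Y by auto
  moreover have "span X0 = A" "span X = B" using X0 X A B by (metis span_subspace)+
  moreover have "card X = dim B" using X by (simp add: basis_card_eq_dim)
  ultimately show ?thesis using that X X0 by blast
qed

lemma fd_subset:
  assumes "fd_subspace scale B" and "subspace A" "A \<subseteq> B"
  shows "fd_subspace scale A"
proof -
  obtain X0 X where "finite X" "X0 \<subseteq> X" "independent X" "span X0 = A" "span X = B"
    "card X0 = dim A" "card X = dim B"
    by (rule fd_basis_extend[OF assms])
  then show ?thesis unfolding fd_subspace_def using assms(2) finite_subset by blast
qed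

lemma fd_dim_mono:
  assumes "fd_subspace scale B" and "subspace A" "A \<subseteq> B"
  shows "dim A \<le> dim B"
proof -
  obtain X0 X where "finite X" "X0 \<subseteq> X" "independent X" "span X0 = A" "span X = B"
    "card X0 = dim A" "card X = dim B"
    by (rule fd_basis_extend[OF assms])
  then show ?thesis using card_mono by metis
qed

lemma fd_dim_eq:
  assumes "fd_subspace scale B" and "subspace A" "A \<subseteq> B" "dim A = dim B"
  shows "A = B"
proof -
  obtain X0 X where X: "finite X" "X0 \<subseteq> X" "independent X" "span X0 = A" "span X = B"
    "card X0 = dim A" "card X = dim B"
    by (rule fd_basis_extend[OF assms(1,2,3)])
  then have "X0 = X" using assms(4) card_subset_eq by metis
  then show ?thesis using X by simp
qed

end

lemma linear_between_0:
  assumes "vector_space s1" "vector_space s2" "linear_between s1 s2 A B f" "module.subspace s1 A"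
  shows "f 0 = 0"
proof -
  interpret v1: vector_space s1 by fact
  interpret v2: vector_space s2 by fact
  have "0 \<in> A" using assms(4) by (rule v1.subspace_0)
  then have "f (0 + 0) = f 0 + f 0" using assms(3) unfolding linear_between_def by blast
  then show ?thesis by simp
qed

lemma linear_between_sum:
  assumes "vector_space s1" "vector_space s2" "linear_between s1 s2 A B f" "module.subspace s1 A"
    and "\<And>i. i \<in> I \<Longrightarrow> x i \<in> A"
  shows "f (\<Sum>i\<in>I. s1 (a i) (x i)) = (\<Sum>i\<in>I. s2 (a i) (f (x i)))"
proof -
  interpret v1: vector_space s1 by fact
  interpret v2: vector_space s2 by fact
  show ?thesis using assms(5)
  proof (induction I rule: infinite_finite_induct)
    case (insert i I)
    have "(\<Sum>i\<in>I. s1 (a i) (x i)) \<in> A"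
      by (intro v1.subspace_sum v1.subspace_scale assms(4)) (use insert in auto)
    moreover have "s1 (a i) (x i) \<in> A" by (intro v1.subspace_scale assms(4)) (use insert in auto)
    moreover have "f (s1 (a i) (x i)) = s2 (a i) (f (x i))"
      using assms(3) insert unfolding linear_between_def by blast
    ultimately show ?case using insert assms(3) unfolding linear_between_def by simp
  qed (use linear_between_0[OF assms(1-4)] in auto)
qed

lemma linear_between_subset:
  assumes "linear_between s1 s2 A B f" "A' \<subseteq> A" "f ` A' \<subseteq> B'"
  shows "linear_between s1 s2 A' B' f"
  using assms unfolding linear_between_def by (auto simp: subset_iff)

lemma linear_between_compose:
  assumes "linear_between s1 s2 A B f" "linear_between s2 s3 B C g"
  shows "linear_between s1 s3 A C (\<lambda>x. g (f x))"
  using assms unfolding linear_between_def by (auto simp: Pi_iff)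

lemma linear_between_vimage_subspace:
  assumes "vector_space s1" "vector_space s2" "linear_between s1 s2 B C f"
    and "module.subspace s1 B" "module.subspace s2 A'"
  shows "module.subspace s1 {b \<in> B. f b \<in> A'}"
proof -
  interpret v1: vector_space s1 by fact
  interpret v2: vector_space s2 by fact
  show ?thesis
    using assms(3-5) linear_between_0[OF assms(1-4)] unfolding v1.subspace_def v2.subspace_def
    by (auto simp: linear_between_def)
qed

lemma linear_between_image_subspace:
  assumes "vector_space s1" "vector_space s2" "linear_between s1 s2 B C f"
    and "module.subspace s1 B"
  shows "module.subspace s2 (f ` B)"
proof -
  interpret v1: vector_space s1 by fact
  interpret v2: vector_space s2 by fact
  show ?thesis
  proof (rule v2.subspaceI)
    show "0 \<in> f ` B" using linear_between_0[OF assms] v1.subspace_0[OF assms(4)] by (metis imageI)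
  next
    fix x y assume "x \<in> f ` B" "y \<in> f ` B"
    then obtain a b where "x = f a" "y = f b" "a \<in> B" "b \<in> B" by auto
    then show "x + y \<in> f ` B"
      using assms(3) v1.subspace_add[OF assms(4)] unfolding linear_between_def by (metis imageI)
  next
    fix c x assume "x \<in> f ` B"
    then obtain a where "x = f a" "a \<in> B" by auto
    then show "s2 c x \<in> f ` B"
      using assms(3) v1.subspace_scale[OF assms(4)] unfolding linear_between_def by (metis imageI)
  qed
qed

text \<open>
  The map induced by \<open>f\<close> from \<open>B\<close> to the quotient by \<open>A'\<close> satisfies rank-nullity. Stated without
  quotient spaces, this one equation contains both the usual rank-nullity formula
  (\<open>A' = {0}\<close>) and the modular law (\<open>f\<close> the identity). For the proof, extend a basis of the kernel to
  \<open>B\<close>; the images of the new vectors together with a basis of \<open>A'\<close> form a basis of the sum.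
\<close>

lemma dim_relative_rank_nullity:
  fixes B :: "'b::ab_group_add set" and A' :: "'c::ab_group_add set"
  assumes vs: "vector_space s1" "vector_space s2" and f: "linear_between s1 s2 B C f"
    and B: "fd_subspace s1 B" and A': "fd_subspace s2 A'"
  shows "vector_space.dim s1 B + vector_space.dim s2 A' =
    vector_space.dim s1 {b \<in> B. f b \<in> A'} + vector_space.dim s2 {f b + a | b a. b \<in> B \<and> a \<in> A'}"
proof -
  interpret v1: vector_space s1 by fact
  interpret v2: vector_space s2 by fact
  have sB: "v1.subspace B" and sA: "v2.subspace A'" using B A' by (auto simp: fd_subspace_def)
  let ?K = "{b \<in> B. f b \<in> A'}"
  let ?S = "{f b + a | b a. b \<in> B \<and> a \<in> A'}"
  have K: "v1.subspace ?K" "?K \<subseteq> B" using linear_between_vimage_subspace[OF vs f sB sA] by auto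
  obtain X0 X where X: "finite X" "X0 \<subseteq> X" "v1.independent X" "v1.span X0 = ?K" "v1.span X = B"
    "card X0 = v1.dim ?K" "card X = v1.dim B"
    by (rule v1.fd_basis_extend[OF B K])
  obtain D where D: "finite D" "D \<subseteq> A'" "v2.independent D" "v2.span D = A'" "card D = v2.dim A'"
    by (rule v2.fd_basis[OF A'])
  have XB: "x \<in> B" if "x \<in> X" for x using X(5) v1.span_base[OF that] by simp
  let ?P = "(X - X0) <+> D"
  let ?e = "case_sum f (\<lambda>d. d)"
  have S_sub: "v2.subspace ?S"
  proof -
    have "?S = {x + y|x y. x \<in> f ` B \<and> y \<in> A'}" by blast
    then show ?thesis
      using v2.subspace_sums[OF linear_between_image_subspace[OF vs f sB] sA] by simp
  qed
  have sum_split: "(\<Sum>i\<in>?P. s2 (a i) (?e i)) =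
      f (\<Sum>x\<in>X - X0. s1 (a (Inl x)) x) + (\<Sum>d\<in>D. s2 (a (Inr d)) d)" for a
  proof -
    have "f (\<Sum>x\<in>X - X0. s1 (a (Inl x)) x) = (\<Sum>x\<in>X - X0. s2 (a (Inl x)) (f x))"
      by (rule linear_between_sum[OF vs f sB]) (use XB in auto)
    then show ?thesis using X(1) D(1) by (simp add: sum.Plus)
  qed
  have "v2.dim ?S = card ?P"
  proof (rule v2.dim_eq_card_family[where e = ?e])
    show "finite ?P" using X D by auto
    show "v2.subspace ?S" by (rule S_sub)
    show "?e i \<in> ?S" if i: "i \<in> ?P" for i
    proof (cases i)
      case (Inl x)
      then have "?e i = f x + 0" "x \<in> B" "0 \<in> A'" using i XB sA v2.subspace_0 by auto
      then show ?thesis by blast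
    next
      case (Inr d)
      then have "?e i = f 0 + d" "0 \<in> B" "d \<in> A'"
        using i D(2) v1.subspace_0[OF sB] linear_between_0[OF vs f sB] by auto
      then show ?thesis by blast
    qed
    show "\<exists>a. w = (\<Sum>i\<in>?P. s2 (a i) (?e i))" if w: "w \<in> ?S" for w
    proof -
      obtain b a where ba: "w = f b + a" "b \<in> B" "a \<in> A'" using w by blast
      obtain p where p: "b = (\<Sum>x\<in>X. s1 (p x) x)"
        using ba(2) X(5) v1.span_finite[OF X(1)] by auto
      let ?k = "\<Sum>x\<in>X0. s1 (p x) x"
      have k: "?k \<in> ?K" using X(4) by (metis (no_types, lifting) v1.span_sum v1.span_scale v1.span_base)
      have r: "(\<Sum>x\<in>X - X0. s1 (p x) x) \<in> B"
        by (intro v1.subspace_sum v1.subspace_scale sB) (use XB in auto)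
      have "b = (\<Sum>x\<in>X - X0. s1 (p x) x) + ?k"
        unfolding p using X by (intro sum.subset_diff)
      then have fb: "f b = f (\<Sum>x\<in>X - X0. s1 (p x) x) + f ?k"
        using f r k unfolding linear_between_def by blast
      have "f ?k + a \<in> A'" using k ba sA v2.subspace_add by blast
      then obtain q where q: "f ?k + a = (\<Sum>d\<in>D. s2 (q d) d)"
        using D v2.span_finite[OF D(1)] by auto
      have "w = (\<Sum>i\<in>?P. s2 (case_sum p q i) (?e i))"
        unfolding sum_split using ba fb q by (simp add: add.assoc)
      then show ?thesis by blast
    qed
    show "a i = 0" if 0: "(\<Sum>i\<in>?P. s2 (a i) (?e i)) = 0" and i: "i \<in> ?P" for a i
    proof -
      let ?z = "\<Sum>x\<in>X - X0. s1 (a (Inl x)) x" and ?y = "\<Sum>d\<in>D. s2 (a (Inr d)) d"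
      have zB: "?z \<in> B" by (intro v1.subspace_sum v1.subspace_scale sB) (use XB in auto)
      have yA: "?y \<in> A'" by (intro v2.subspace_sum v2.subspace_scale sA) (use D in auto)
      have "f ?z = - ?y" using 0 unfolding sum_split by (simp add: eq_neg_iff_add_eq_0)
      then have "?z \<in> ?K" using zB yA sA v2.subspace_neg by auto
      then obtain c where c: "?z = (\<Sum>x\<in>X0. s1 (c x) x)"
        using X(4) v1.span_finite[of X0] X(1,2) finite_subset by (metis (mono_tags, lifting) rangeE)
      let ?g = "\<lambda>x. if x \<in> X0 then - c x else a (Inl x)"
      have "(\<Sum>x\<in>X. s1 (?g x) x) = (\<Sum>x\<in>X - X0. s1 (?g x) x) + (\<Sum>x\<in>X0. s1 (?g x) x)"
        using X by (intro sum.subset_diff)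
      also have "(\<Sum>x\<in>X - X0. s1 (?g x) x) = ?z" by (rule sum.cong) auto
      also have "(\<Sum>x\<in>X0. s1 (?g x) x) = - ?z" unfolding c by (simp add: sum_negf)
      finally have "(\<Sum>x\<in>X. s1 (?g x) x) = 0" by simp
      then have g0: "?g x = 0" if "x \<in> X" for x
        using v1.independentD[OF X(3) X(1) subset_refl, of ?g x] that by auto
      have aX: "a (Inl x) = 0" if "x \<in> X - X0" for x using g0[of x] that by auto
      then have "?z = 0" by simp
      then have "?y = 0" using 0 unfolding sum_split using linear_between_0[OF vs f sB] by simp
      then have "a (Inr d) = 0" if "d \<in> D" for d
        using v2.independentD[OF D(3) D(1) subset_refl, of "\<lambda>d. a (Inr d)" d] that by auto
      then show ?thesis using i aX by auto
    qed
  qed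
  also have "card ?P = card (X - X0) + card D" using X D by (simp add: card_Plus)
  also have "card (X - X0) = card X - card X0" using X by (metis card_Diff_subset finite_subset)
  finally show ?thesis using X D card_mono[OF X(1) X(2)] by simp
qed

corollary dim_rank_nullity:
  assumes vs: "vector_space s1" "vector_space s2" and f: "linear_between s1 s2 B C f"
    and B: "fd_subspace s1 B"
  shows "vector_space.dim s1 B = vector_space.dim s1 {b \<in> B. f b = 0} + vector_space.dim s2 (f ` B)"
proof -
  interpret v1: vector_space s1 by fact
  interpret v2: vector_space s2 by fact
  have 0: "v2.span {} = {0}" by (rule v2.span_empty)
  then have fd0: "fd_subspace s2 {0}" unfolding fd_subspace_def by (metis finite.emptyI v2.subspace_span)
  have dim0: "v2.dim {0} = 0"
    using v2.dim_span_eq_card_independent[OF v2.independent_empty] unfolding 0 by simp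
  have im: "{f b + a | b a. b \<in> B \<and> a \<in> {0}} = f ` B" by force
  have ker: "{b \<in> B. f b \<in> {0}} = {b \<in> B. f b = 0}" by simp
  show ?thesis
    using dim_relative_rank_nullity[OF vs f B fd0] unfolding im ker dim0 by simp
qed

corollary dim_modular:
  assumes vs: "vector_space s" 
    and A: "fd_subspace s A" and B: "fd_subspace s B"
  shows "vector_space.dim s A + vector_space.dim s B =
    vector_space.dim s (A \<inter> B) + vector_space.dim s {a + b | a b. a \<in> A \<and> b \<in> B}"
proof -
  have lin: "linear_between s s A A (\<lambda>x. x)" by (simp add: linear_between_def)
  have eq: "{b \<in> A. b \<in> B} = A \<inter> B" by auto
  show ?thesis using dim_relative_rank_nullity[OF vs vs lin A B] unfolding eq .
qed

lemma fd_image: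
  assumes vs: "vector_space s1" "vector_space s2" and f: "linear_between s1 s2 B C f"
    and B: "fd_subspace s1 B"
  shows "fd_subspace s2 (f ` B)"
proof -
  interpret v1: vector_space s1 by fact
  interpret v2: vector_space s2 by fact
  have sB: "v1.subspace B" using B by (simp add: fd_subspace_def)
  obtain X where X: "finite X" "v1.span X = B" using B by (auto simp: fd_subspace_def)
  have XB: "x \<in> B" if "x \<in> X" for x using X v1.span_base[OF that] by simp
  have sub: "v2.subspace (f ` B)" by (rule linear_between_image_subspace[OF vs f sB])
  have "f ` B \<subseteq> v2.span (f ` X)"
  proof safe
    fix b assume "b \<in> B"
    then obtain p where p: "b = (\<Sum>x\<in>X. s1 (p x) x)" using X v1.span_finite[OF X(1)] by auto
    have "f b = (\<Sum>x\<in>X. s2 (p x) (f x))"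
      unfolding p by (rule linear_between_sum[OF vs f sB]) (use XB in auto)
    then show "f b \<in> v2.span (f ` X)" by (auto intro!: v2.span_sum v2.span_scale intro: v2.span_base)
  qed
  moreover have "v2.span (f ` X) \<subseteq> f ` B"
    by (intro v2.span_minimal sub) (use XB in auto)
  ultimately show ?thesis unfolding fd_subspace_def using sub X(1)
    by (metis finite_imageI subset_antisym)
qed

lemma fd_sums:
  assumes vs: "vector_space s" and A: "fd_subspace s A" and B: "fd_subspace s B"
  shows "fd_subspace s {a + b | a b. a \<in> A \<and> b \<in> B}"
proof -
  interpret vector_space s by fact
  obtain X Y where "finite X" "span X = A" "finite Y" "span Y = B"
    using A B by (auto simp: fd_subspace_def)
  then have "span (X \<union> Y) = {a + b | a b. a \<in> A \<and> b \<in> B}" "finite (X \<union> Y)"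
    by (auto simp: span_Un)
  then show ?thesis unfolding fd_subspace_def by (metis subspace_span)
qed

section \<open>The Harder-Narasimhan filtration\<close>

lemma (in vector_space) fd_dim_0_iff:
  assumes "fd_subspace scale A"
  shows "dim A = 0 \<longleftrightarrow> A = {0}"
proof
  obtain X where X: "finite X" "X \<subseteq> A" "independent X" "span X = A" "card X = dim A"
    by (rule fd_basis[OF assms])
  assume "dim A = 0"
  then have "X = {}" using X by simp
  then show "A = {0}" using X span_empty by simp
next
  assume "A = {0}"
  then show "dim A = 0"
    using dim_span_eq_card_independent[OF independent_empty] by (simp add: span_empty)
qed

lemma subrep_Int:
  assumes "vector_space (rscale V)" "subrep Q V A" "subrep Q V B"
  shows "subrep Q V (\<lambda>x. A x \<inter> B x)"
proof -
  interpret vector_space "rscale V" by fact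
  show ?thesis using assms(2,3) unfolding subrep_def
    by (auto intro!: subspace_inter simp: image_subset_iff)
qed

lemma subrep_sum:
  assumes "quiver_rep Q V" "wf_digraph Q" "subrep Q V A" "subrep Q V B"
  shows "subrep Q V (\<lambda>x. {a + b | a b. a \<in> A x \<and> b \<in> B x})"
proof -
  interpret vector_space "rscale V" using assms(1) by (simp add: quiver_rep_def)
  interpret wf_digraph Q by fact
  show ?thesis unfolding subrep_def
  proof (intro conjI ballI)
    fix x assume x: "x \<in> verts Q"
    show "subspace {a + b | a b. a \<in> A x \<and> b \<in> B x}"
      by (rule subspace_sums) (use assms(3,4) x in \<open>simp_all add: subrep_def\<close>)
    have V: "subspace (rspace V x)" using assms(1) x by (simp add: quiver_rep_def)
    have "A x \<subseteq> rspace V x" "B x \<subseteq> rspace V x" using assms(3,4) x by (simp_all add: subrep_def)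
    then show "{a + b | a b. a \<in> A x \<and> b \<in> B x} \<subseteq> rspace V x"
      using subspace_add[OF V] by auto
  next
    fix e assume e: "e \<in> arcs Q"
    show "rmap V e ` {a + b |a b. a \<in> A (tail Q e) \<and> b \<in> B (tail Q e)}
         \<subseteq> {a + b |a b. a \<in> A (head Q e) \<and> b \<in> B (head Q e)}"
    proof safe
      fix a b assume ab: "a \<in> A (tail Q e)" "b \<in> B (tail Q e)"
      have "a \<in> rspace V (tail Q e)" "b \<in> rspace V (tail Q e)"
        using ab assms(3,4) tail_in_verts[OF e] unfolding subrep_def by auto
      then have "rmap V e (a + b) = rmap V e a + rmap V e b"
        using assms(1) e unfolding quiver_rep_def linear_between_def by blast
      moreover have "rmap V e a \<in> A (head Q e)" "rmap V e b \<in> B (head Q e)"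
        using ab assms(3,4) e by (simp_all add: subrep_def image_subset_iff)
      ultimately show "\<exists>a' b'. rmap V e (a + b) = a' + b' \<and> a' \<in> A (head Q e) \<and> b' \<in> B (head Q e)"
        by blast
    qed
  qed
qed

text \<open>
  The functional \<open>\<Sum>\<^sub>x (\<alpha>\<^sub>x - \<mu>) \<delta>\<^sub>x\<close> is additive in the dimension vector \<open>\<delta>\<close>, and for
  \<open>\<delta> \<noteq> 0\<close> it is nonpositive exactly if the slope is at most \<open>\<mu>\<close>. It replaces slopes throughout: slopes of zero
  representations never have to be excluded, and inequalities for successive quotients can be added.
\<close>

definition excess :: "('v, 'e) pre_digraph \<Rightarrow> ('v \<Rightarrow> real) \<Rightarrow> real \<Rightarrow> ('v \<Rightarrow> nat) \<Rightarrow> real" where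
  "excess Q \<alpha> \<mu> \<delta> = (\<Sum>x\<in>verts Q. (\<alpha> x - \<mu>) * real (\<delta> x))"

abbreviation sdim :: "('v, 'e, 'k::field, 'b::ab_group_add) qrep \<Rightarrow> ('v \<Rightarrow> 'b set) \<Rightarrow> 'v \<Rightarrow> nat" where
  "sdim V U x \<equiv> vector_space.dim (rscale V) (U x)"

lemma excess_add:
  assumes "\<And>x. x \<in> verts Q \<Longrightarrow> \<delta> x = \<beta> x + \<gamma> x"
  shows "excess Q \<alpha> \<mu> \<delta> = excess Q \<alpha> \<mu> \<beta> + excess Q \<alpha> \<mu> \<gamma>"
  unfolding excess_def by (simp add: assms distrib_left sum.distrib)

lemma excess_change_slope:
  "excess Q \<alpha> \<mu> \<delta> = excess Q \<alpha> \<nu> \<delta> + (\<nu> - \<mu>) * real (\<Sum>x\<in>verts Q. \<delta> x)"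
  unfolding excess_def by (simp add: algebra_simps sum.distrib sum_subtractf sum_distrib_left)

lemma excess_at_slope:
  assumes "finite (verts Q)"
  shows "excess Q \<alpha> (slope Q \<alpha> V) (\<lambda>x. dim_at V x) = 0"
proof (cases "(\<Sum>x\<in>verts Q. dim_at V x) = 0")
  case True
  then show ?thesis using assms by (simp add: excess_def)
next
  case False
  let ?T = "real (\<Sum>x\<in>verts Q. dim_at V x)"
  have "excess Q \<alpha> (slope Q \<alpha> V) (\<lambda>x. dim_at V x) =
     (\<Sum>x\<in>verts Q. \<alpha> x * real (dim_at V x)) - slope Q \<alpha> V * ?T"
    unfolding excess_def by (simp add: algebra_simps sum_subtractf sum_distrib_left)
  moreover have "?T \<noteq> 0" using False by linarith
  ultimately show ?thesis unfolding slope_def by simp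
qed

lemma semistable_excess:
  assumes "finite (verts Q)" "quiver_rep Q S" "semistable Q \<alpha> S" "subrep Q S U"
    and fd: "\<And>x. x \<in> verts Q \<Longrightarrow> fd_subspace (rscale S) (rspace S x)"
  shows "excess Q \<alpha> (slope Q \<alpha> S) (sdim S U) \<le> 0"
proof -
  interpret vector_space "rscale S" using assms(2) by (simp add: quiver_rep_def)
  have fdU: "fd_subspace (rscale S) (U x)" if "x \<in> verts Q" for x
    using fd_subset[OF fd[OF that]] assms(4) that unfolding subrep_def by blast
  let ?T = "real (\<Sum>x\<in>verts Q. sdim S U x)"
  show ?thesis
  proof (cases "nonzero_rep Q (restrict_rep S U)")
    case False
    then have "sdim S U x = 0" if "x \<in> verts Q" for x
      using fd_dim_0_iff[OF fdU[OF that]] that by (auto simp: nonzero_rep_def restrict_rep_def)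
    then show ?thesis by (simp add: excess_def)
  next
    case True
    then obtain x where "x \<in> verts Q" "sdim S U x \<noteq> 0"
      using fd_dim_0_iff[OF fdU] by (auto simp: nonzero_rep_def restrict_rep_def)
    then have T: "?T > 0" using assms(1) by (metis of_nat_0_less_iff sum_eq_0_iff not_gr_zero)
    have "slope Q \<alpha> (restrict_rep S U) \<le> slope Q \<alpha> S"
      using assms(3,4) True unfolding semistable_def by blast
    then have "(\<Sum>x\<in>verts Q. \<alpha> x * real (sdim S U x)) \<le> slope Q \<alpha> S * ?T"
      unfolding slope_def[of Q \<alpha> "restrict_rep S U"]
      using T by (simp add: dim_at_def restrict_rep_def divide_le_eq)
    then show ?thesis unfolding excess_def
      by (simp add: algebra_simps sum_subtractf sum_distrib_left)
  qed
qed

text \<open>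
  Semistability of a subquotient \<open>B / A\<close> pulled back to \<open>V\<close>: a subrepresentation between \<open>A\<close> and
  \<open>B\<close> has an image in the quotient, whose dimensions are the differences to those of \<open>A\<close>.
\<close>

lemma quotient_excess:
  fixes V :: "('v, 'e, 'k::field, 'b::ab_group_add) qrep"
    and S :: "('v, 'e, 'k, 'c::ab_group_add) qrep"
  assumes V: "finite (verts Q)" "wf_digraph Q" "quiver_rep Q V"
    and fd: "\<And>x. x \<in> verts Q \<Longrightarrow> fd_subspace (rscale V) (rspace V x)"
    and q: "quotient_rep Q (restrict_rep V B) A S" "subrep Q V B"
    and ss: "semistable Q \<alpha> S"
    and U: "subrep Q V U" "\<And>x. x \<in> verts Q \<Longrightarrow> A x \<subseteq> U x \<and> U x \<subseteq> B x"
  shows "excess Q \<alpha> (slope Q \<alpha> S) (sdim V U) \<le> excess Q \<alpha> (slope Q \<alpha> S) (sdim V A)"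
    and "excess Q \<alpha> (slope Q \<alpha> S) (sdim V B) = excess Q \<alpha> (slope Q \<alpha> S) (sdim V A)"
    and "x \<in> verts Q \<Longrightarrow> sdim V B x = sdim V A x + dim_at S x"
proof -
  have S: "quiver_rep Q S" using q by (simp add: quotient_rep_def)
  have vV: "vector_space (rscale V)" and vS: "vector_space (rscale S)"
    using V S by (simp_all add: quiver_rep_def)
  interpret v: vector_space "rscale V" by fact
  interpret w: vector_space "rscale S" by fact
  interpret wf_digraph Q by fact
  obtain p where p: "rep_hom Q (restrict_rep V B) S p"
    and ker: "\<And>x. x \<in> verts Q \<Longrightarrow> p x ` B x = rspace S x \<and> {b\<in>B x. p x b = 0} = A x"
    using q by (auto simp: quotient_rep_def restrict_rep_def)
  have lin: "linear_between (rscale V) (rscale S) (B x) (rspace S x) (p x)" if "x \<in> verts Q" for x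
    using p that by (auto simp: rep_hom_def restrict_rep_def)
  have fdB: "fd_subspace (rscale V) (B x)" if "x \<in> verts Q" for x
    using v.fd_subset[OF fd[OF that]] q(2) that unfolding subrep_def by blast
  have fdS: "fd_subspace (rscale S) (rspace S x)" if "x \<in> verts Q" for x
    using fd_image[OF vV vS lin[OF that] fdB[OF that]] ker[OF that] by simp
  have dims: "sdim V W x = sdim V A x + w.dim (p x ` W x)"
    if W: "subrep Q V W" "A x \<subseteq> W x" "W x \<subseteq> B x" and x: "x \<in> verts Q" for W x
  proof -
    have l: "linear_between (rscale V) (rscale S) (W x) (rspace S x) (p x)"
      using linear_between_subset[OF lin[OF x] W(3)] ker[OF x] W(3) by blast
    have f: "fd_subspace (rscale V) (W x)"
      using v.fd_subset[OF fdB[OF x] _ W(3)] W(1) x by (auto simp: subrep_def)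
    have k: "{b \<in> W x. p x b = 0} = A x" using ker[OF x] W by auto
    show ?thesis using dim_rank_nullity[OF vV vS l f] unfolding k .
  qed
  have AB: "A x \<subseteq> B x" if "x \<in> verts Q" for x using U(2)[OF that] by auto
  show B: "sdim V B x = sdim V A x + dim_at S x" if "x \<in> verts Q" for x
    using dims[OF q(2) AB _ that] ker that by (simp add: dim_at_def)
  show "excess Q \<alpha> (slope Q \<alpha> S) (sdim V B) = excess Q \<alpha> (slope Q \<alpha> S) (sdim V A)"
    using excess_add[of Q "sdim V B" "sdim V A" "dim_at S", OF B]
      excess_at_slope[OF V(1), of \<alpha> S] by simp
  have "subrep Q S (\<lambda>x. p x ` U x)" unfolding subrep_def
  proof (intro conjI ballI)
    fix x assume x: "x \<in> verts Q"
    have "linear_between (rscale V) (rscale S) (U x) (rspace S x) (p x)"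
      using linear_between_subset[OF lin[OF x], of "U x" "rspace S x"] ker[OF x] U(2)[OF x] by blast
    then show "w.subspace (p x ` U x)"
      using linear_between_image_subspace[OF vV vS] U(1) x by (auto simp: subrep_def)
    show "p x ` U x \<subseteq> rspace S x" using ker[OF x] U(2)[OF x] by blast
  next
    fix e assume e: "e \<in> arcs Q"
    show "rmap S e ` p (tail Q e) ` U (tail Q e) \<subseteq> p (head Q e) ` U (head Q e)"
    proof safe
      fix u assume u: "u \<in> U (tail Q e)"
      have "u \<in> B (tail Q e)" using u U(2)[OF tail_in_verts[OF e]] by blast
      then have "rmap S e (p (tail Q e) u) = p (head Q e) (rmap V e u)"
        using p e by (auto simp: rep_hom_def restrict_rep_def)
      moreover have "rmap V e u \<in> U (head Q e)" using U(1) e u by (simp add: subrep_def image_subset_iff)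
      ultimately show "rmap S e (p (tail Q e) u) \<in> p (head Q e) ` U (head Q e)" by simp
    qed
  qed
  then have "excess Q \<alpha> (slope Q \<alpha> S) (sdim S (\<lambda>x. p x ` U x)) \<le> 0"
    by (rule semistable_excess[OF V(1) S ss]) (rule fdS)
  moreover have "excess Q \<alpha> (slope Q \<alpha> S) (sdim V U) =
    excess Q \<alpha> (slope Q \<alpha> S) (sdim V A) + excess Q \<alpha> (slope Q \<alpha> S) (sdim S (\<lambda>x. p x ` U x))"
    by (rule excess_add) (use dims[OF U(1)] U(2) in blast)
  ultimately show "excess Q \<alpha> (slope Q \<alpha> S) (sdim V U) \<le> excess Q \<alpha> (slope Q \<alpha> S) (sdim V A)"
    by simp
qed

locale HN =
  fixes Q :: "('v, 'e) pre_digraph" and \<alpha> :: "'v \<Rightarrow> real"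
    and V :: "('v, 'e, 'k::field, 'b::ab_group_add) qrep"
    and m :: nat and F :: "nat \<Rightarrow> 'v \<Rightarrow> 'b set"
    and S :: "nat \<Rightarrow> ('v, 'e, 'k, 'c::ab_group_add) qrep"
  assumes finite_verts: "finite (verts Q)" and wf: "wf_digraph Q" and rep: "quiver_rep Q V"
    and fd: "x \<in> verts Q \<Longrightarrow> fd_subspace (rscale V) (rspace V x)"
    and HN: "HN_filtration Q \<alpha> V m F S"
begin

sublocale vector_space "rscale V"
  using rep by (simp add: quiver_rep_def)

abbreviation \<mu> :: "nat \<Rightarrow> real" where "\<mu> i \<equiv> slope Q \<alpha> (S i)"

abbreviation exc :: "real \<Rightarrow> ('v \<Rightarrow> 'b set) \<Rightarrow> real" where "exc \<nu> U \<equiv> excess Q \<alpha> \<nu> (sdim V U)"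

lemma F_subrep: "i \<le> m \<Longrightarrow> subrep Q V (F i)"
  using HN by (simp add: HN_filtration_def)

lemma F_0: "x \<in> verts Q \<Longrightarrow> F 0 x = {0}" and F_m: "x \<in> verts Q \<Longrightarrow> F m x = rspace V x"
  using HN by (simp_all add: HN_filtration_def)

lemma F_Suc: "i < m \<Longrightarrow> x \<in> verts Q \<Longrightarrow> F i x \<subseteq> F (Suc i) x"
proof -
  assume i: "i < m" and x: "x \<in> verts Q"
  have "\<forall>j\<in>{1..m}. \<forall>x\<in>verts Q. F (j - 1) x \<subseteq> F j x" using HN unfolding HN_filtration_def by blast
  from bspec[OF this, of "Suc i"] show ?thesis using i x by simp
qed

lemma slope_less: "1 \<le> i \<Longrightarrow> i < m \<Longrightarrow> \<mu> (Suc i) < \<mu> i"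
proof -
  assume i: "1 \<le> i" "i < m"
  have "\<forall>j\<in>{1..<m}. \<mu> (j + 1) < \<mu> j" using HN unfolding HN_filtration_def by blast
  from bspec[OF this, of i] show ?thesis using i by simp
qed

lemma slope_mono: "1 \<le> i \<Longrightarrow> i \<le> k \<Longrightarrow> k \<le> m \<Longrightarrow> \<mu> k \<le> \<mu> i"
proof (induction k)
  case (Suc k)
  show ?case
  proof (cases "i = Suc k")
    case False
    then have "\<mu> (Suc k) < \<mu> k" using slope_less[of k] Suc.prems by simp
    then show ?thesis using Suc False by simp
  qed simp
qed simp

lemma HN_quotient: "i < m \<Longrightarrow> quotient_rep Q (restrict_rep V (F (Suc i))) (F i) (S (Suc i))"
  and HN_quotient_semistable: "i < m \<Longrightarrow> semistable Q \<alpha> (S (Suc i))"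
proof -
  assume i: "i < m"
  have "\<forall>j\<in>{1..m}. quotient_rep Q (restrict_rep V (F j)) (F (j - 1)) (S j) \<and> semistable Q \<alpha> (S j)"
    using HN unfolding HN_filtration_def by blast
  from bspec[OF this, of "Suc i"]
  show "quotient_rep Q (restrict_rep V (F (Suc i))) (F i) (S (Suc i))" "semistable Q \<alpha> (S (Suc i))"
    using i by simp_all
qed

lemma excess_step:
  assumes "i < m" "subrep Q V U" "\<And>x. x \<in> verts Q \<Longrightarrow> F i x \<subseteq> U x \<and> U x \<subseteq> F (Suc i) x"
  shows "exc (\<mu> (Suc i)) U \<le> exc (\<mu> (Suc i)) (F i)"
    and "exc (\<mu> (Suc i)) (F (Suc i)) = exc (\<mu> (Suc i)) (F i)"
proof -
  have sub: "subrep Q V (F (Suc i))" using F_subrep assms(1) by simp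
  note q = quotient_excess[OF finite_verts wf rep fd HN_quotient[OF assms(1)] sub HN_quotient_semistable[OF assms(1)]
      assms(2,3)]
  show "exc (\<mu> (Suc i)) U \<le> exc (\<mu> (Suc i)) (F i)" by (rule q(1))
  show "exc (\<mu> (Suc i)) (F (Suc i)) = exc (\<mu> (Suc i)) (F i)" by (rule q(2))
qed

lemma dim_S:
  assumes i: "i < m" and x: "x \<in> verts Q"
  shows "sdim V (F (Suc i)) x = sdim V (F i) x + dim_at (S (Suc i)) x"
proof -
  have sub: "subrep Q V (F (Suc i))" "subrep Q V (F i)" using F_subrep i by simp_all
  show ?thesis
    by (rule quotient_excess(3)[OF finite_verts wf rep fd HN_quotient[OF i] sub(1) HN_quotient_semistable[OF i] sub(2)])
      (use F_Suc[OF i] x in auto)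
qed

lemma fd_subrep: "subrep Q V U \<Longrightarrow> x \<in> verts Q \<Longrightarrow> fd_subspace (rscale V) (U x)"
  using fd_subset[OF fd] unfolding subrep_def by blast

lemma subrepD: "subrep Q V U \<Longrightarrow> x \<in> verts Q \<Longrightarrow> subspace (U x)"
  unfolding subrep_def by blast

abbreviation plus_sub :: "('v \<Rightarrow> 'b set) \<Rightarrow> ('v \<Rightarrow> 'b set) \<Rightarrow> 'v \<Rightarrow> 'b set" where
  "plus_sub A B \<equiv> \<lambda>x. {a + b | a b. a \<in> A x \<and> b \<in> B x}"

lemma excess_modular:
  assumes "subrep Q V A" "subrep Q V B"
  shows "exc \<nu> A + exc \<nu> B = exc \<nu> (\<lambda>x. A x \<inter> B x) + exc \<nu> (plus_sub A B)"
proof -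
  have eq: "real (sdim V A x) + real (sdim V B x) =
      real (sdim V (\<lambda>x. A x \<inter> B x) x) + real (sdim V (plus_sub A B) x)" if "x \<in> verts Q" for x
  proof -
    have "sdim V A x + sdim V B x = sdim V (\<lambda>x. A x \<inter> B x) x + sdim V (plus_sub A B) x"
      by (rule dim_modular[OF vector_space_axioms fd_subrep[OF assms(1) that] fd_subrep[OF assms(2) that]])
    then show ?thesis by (simp only: of_nat_add[symmetric])
  qed
  show ?thesis unfolding excess_def sum.distrib[symmetric] distrib_left[symmetric]
    by (rule sum.cong[OF refl]) (simp only: eq)
qed

text \<open>
  A subrepresentation \<open>U\<close> is cut into the layers \<open>U \<inter> V\<^sub>i\<^sub>+\<^sub>1\<close> modulo \<open>U \<inter> V\<^sub>i\<close>. By the modular law each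
  layer has the dimensions of \<open>W\<close> modulo \<open>V\<^sub>i\<close>, where \<open>W\<close> lies between two consecutive steps, so that
  semistability of the quotient applies to it.
\<close>

lemma excess_layer:
  assumes i: "i < m" and U: "subrep Q V U"
  defines "W \<equiv> plus_sub (\<lambda>x. U x \<inter> F (Suc i) x) (F i)"
  shows "exc \<nu> (\<lambda>x. U x \<inter> F (Suc i) x) - exc \<nu> (\<lambda>x. U x \<inter> F i x) = exc \<nu> W - exc \<nu> (F i)"
    and "subrep Q V W"
    and "x \<in> verts Q \<Longrightarrow> F i x \<subseteq> W x \<and> W x \<subseteq> F (Suc i) x"
proof -
  let ?A = "\<lambda>x. U x \<inter> F (Suc i) x"
  have A: "subrep Q V ?A" by (rule subrep_Int[OF vector_space_axioms U F_subrep]) (use i in simp)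
  have Fi: "subrep Q V (F i)" using F_subrep i by simp
  show "subrep Q V W" unfolding W_def by (rule subrep_sum[OF rep wf A Fi])
  have "?A x \<inter> F i x = U x \<inter> F i x" if "x \<in> verts Q" for x
    using F_Suc[OF i that] by blast
  then have "exc \<nu> (\<lambda>x. ?A x \<inter> F i x) = exc \<nu> (\<lambda>x. U x \<inter> F i x)"
    unfolding excess_def by (intro sum.cong refl) simp
  then show "exc \<nu> ?A - exc \<nu> (\<lambda>x. U x \<inter> F i x) = exc \<nu> W - exc \<nu> (F i)"
    using excess_modular[OF A Fi, of \<nu>] unfolding W_def by simp
  show "F i x \<subseteq> W x \<and> W x \<subseteq> F (Suc i) x" if x: "x \<in> verts Q"
  proof
    have "0 \<in> ?A x" using subspace_0[OF subrepD[OF A x]] .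
    then show "F i x \<subseteq> W x" unfolding W_def by force
    have "subspace (F (Suc i) x)" using subrepD[OF F_subrep x] i by simp
    then show "W x \<subseteq> F (Suc i) x" unfolding W_def using F_Suc[OF i x] subspace_add by blast
  qed
qed

text \<open>
  A gap between nested subrepresentations weighs less for a larger slope. This is how the
  semistability inequality of one layer is transferred to the slope of another.
\<close>

lemma excess_gap_antimono:
  assumes "\<And>x. x \<in> verts Q \<Longrightarrow> A x \<subseteq> B x" "subrep Q V A" "subrep Q V B" "\<rho> \<le> \<nu>"
  shows "exc \<nu> B - exc \<nu> A \<le> exc \<rho> B - exc \<rho> A"
proof -
  have "(\<alpha> x - \<nu>) * (real (sdim V B x) - real (sdim V A x)) \<le>
      (\<alpha> x - \<rho>) * (real (sdim V B x) - real (sdim V A x))" if "x \<in> verts Q" for x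
  proof (rule mult_right_mono)
    have "sdim V A x \<le> sdim V B x"
      by (rule fd_dim_mono[OF fd_subrep[OF assms(3) that] subrepD[OF assms(2) that] assms(1)[OF that]])
    then show "0 \<le> real (sdim V B x) - real (sdim V A x)" by simp
  qed (use assms(4) in simp)
  then show ?thesis unfolding excess_def sum_subtractf[symmetric] right_diff_distrib[symmetric]
    by (intro sum_mono)
qed

text \<open>
  All slopes of \<open>V / V\<^sub>j\<close> are at most \<open>\<mu>\<^sub>j\<^sub>+\<^sub>1\<close>, so this bounds the slope of each of its
  subrepresentations: sum the inequalities of the layers above \<open>V\<^sub>j\<close>.
\<close>

lemma excess_above:
  assumes j: "j < m" and U: "subrep Q V U" "\<And>x. x \<in> verts Q \<Longrightarrow> F j x \<subseteq> U x"
  shows "exc (\<mu> (Suc j)) U \<le> exc (\<mu> (Suc j)) (F j)"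
proof -
  let ?\<nu> = "\<mu> (Suc j)"
  have "exc ?\<nu> (\<lambda>x. U x \<inter> F i x) \<le> exc ?\<nu> (F j)" if "j \<le> i" "i \<le> m" for i
    using that
  proof (induction i rule: dec_induct)
    case base
    have "U x \<inter> F j x = F j x" if "x \<in> verts Q" for x
      using U(2)[OF that] by blast
    then show ?case unfolding excess_def by (intro eq_refl sum.cong refl) simp
  next
    case (step i)
    let ?W = "plus_sub (\<lambda>x. U x \<inter> F (Suc i) x) (F i)"
    have i: "i < m" using step by simp
    note L = excess_layer[OF i U(1)]
    have "exc ?\<nu> ?W - exc ?\<nu> (F i) \<le> exc (\<mu> (Suc i)) ?W - exc (\<mu> (Suc i)) (F i)"
      by (rule excess_gap_antimono) (use L F_subrep i slope_mono[of "Suc j" "Suc i"] step in auto)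
    also have "\<dots> \<le> 0" using excess_step(1)[OF i L(2) L(3)] by simp
    finally show ?case using L(1)[of ?\<nu>] step by simp
  qed
  from this[of m] have "exc ?\<nu> (\<lambda>x. U x \<inter> F m x) \<le> exc ?\<nu> (F j)" using j by simp
  moreover have "U x \<inter> F m x = U x" if "x \<in> verts Q" for x
    using U(1) F_m[OF that] that unfolding subrep_def by blast
  then have "exc ?\<nu> (\<lambda>x. U x \<inter> F m x) = exc ?\<nu> U"
    unfolding excess_def by (intro sum.cong refl) simp
  ultimately show ?thesis by simp
qed

text \<open>
  The dual bound: all slopes of \<open>V\<^sub>j\<^sub>+\<^sub>1\<close> are at least \<open>\<mu>\<^sub>j\<^sub>+\<^sub>1\<close>, so the slope of each of its quotients is
  at least \<open>\<mu>\<^sub>j\<^sub>+\<^sub>1\<close>. Here the inequalities of the layers are summed from the bottom.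
\<close>

lemma excess_below:
  assumes j: "j < m" and U: "subrep Q V U" "\<And>x. x \<in> verts Q \<Longrightarrow> U x \<subseteq> F (Suc j) x"
  shows "exc (\<mu> (Suc j)) U \<le> exc (\<mu> (Suc j)) (F (Suc j))"
proof -
  let ?\<nu> = "\<mu> (Suc j)"
  have "exc ?\<nu> (\<lambda>x. U x \<inter> F i x) \<le> exc ?\<nu> (F i)" if "i \<le> Suc j" for i
    using that
  proof (induction i)
    case 0
    have "U x \<inter> F 0 x = F 0 x" if x: "x \<in> verts Q" for x
    proof -
      have "0 \<in> U x" by (rule subspace_0[OF subrepD[OF U(1) x]])
      moreover have "F 0 x = {0}" by (rule F_0[OF x])
      ultimately show ?thesis by simp
    qed
    then show ?case unfolding excess_def by (intro eq_refl sum.cong refl) simp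
  next
    case (Suc i)
    let ?W = "plus_sub (\<lambda>x. U x \<inter> F (Suc i) x) (F i)"
    have i: "i < m" using Suc j by simp
    note L = excess_layer[OF i U(1)]
    have "\<mu> (Suc j) \<le> \<mu> (Suc i)" by (rule slope_mono) (use Suc j in auto)
    then have "exc (\<mu> (Suc i)) (F (Suc i)) - exc (\<mu> (Suc i)) ?W \<le> exc ?\<nu> (F (Suc i)) - exc ?\<nu> ?W"
      by (intro excess_gap_antimono L(2) F_subrep conjunct2[OF L(3)]) (use i in auto)
    moreover have "exc (\<mu> (Suc i)) (F (Suc i)) - exc (\<mu> (Suc i)) ?W \<ge> 0"
      using excess_step[OF i L(2) L(3)] by linarith
    moreover have "exc ?\<nu> (\<lambda>x. U x \<inter> F i x) \<le> exc ?\<nu> (F i)" using Suc by simp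
    ultimately show ?case using L(1)[of ?\<nu>] by linarith
  qed
  from this[of "Suc j"] have "exc ?\<nu> (\<lambda>x. U x \<inter> F (Suc j) x) \<le> exc ?\<nu> (F (Suc j))" by simp
  moreover have "U x \<inter> F (Suc j) x = U x" if "x \<in> verts Q" for x
    using U(2)[OF that] by blast
  then have "exc ?\<nu> (\<lambda>x. U x \<inter> F (Suc j) x) = exc ?\<nu> U"
    unfolding excess_def by (intro sum.cong refl) simp
  ultimately show ?thesis by simp
qed

end

section \<open>Cyclic quivers and the Euler degree\<close>

type_synonym 'k nrep = "(int, int, 'k, int \<Rightarrow> 'k) qrep"

type_synonym 'k liftrep = "(int, int \<times> int, 'k, 'k) qrep"

locale cyclic =
  fixes n :: nat and fwd :: "int \<Rightarrow> bool"
  assumes n_pos: "0 < n"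
begin

abbreviation Q :: "(int, int) pre_digraph" where "Q \<equiv> cyclic_quiver n fwd"

abbreviation md :: "int \<Rightarrow> int" where "md m \<equiv> m mod int n"

text \<open>
  Edges of the unwinding are named by integers: edge \<open>m\<close> joins \<open>m - 1\<close> and \<open>m\<close> and lies over the
  edge \<open>m mod n\<close> of the quiver.
\<close>

definition src :: "int \<Rightarrow> int" where "src m = (if fwd (md m) then m - 1 else m)"

definition tgt :: "int \<Rightarrow> int" where "tgt m = (if fwd (md m) then m else m - 1)"

lemma verts_Q: "verts Q = {0..<int n}" and arcs_Q: "arcs Q = {0..<int n}"
  by (simp_all add: cyclic_quiver_def)

lemma md_in [simp]: "md m \<in> verts Q" "md m \<in> arcs Q"
  using n_pos by (simp_all add: verts_Q arcs_Q)

lemma md_id: "x \<in> verts Q \<Longrightarrow> md x = x"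
  by (simp add: verts_Q)

lemma tail_md: "tail Q (md m) = md (src m)" and head_md: "head Q (md m) = md (tgt m)"
  by (simp_all add: cyclic_quiver_def src_def tgt_def mod_diff_left_eq)

lemma arc_md: "e \<in> arcs Q \<Longrightarrow> md e = e"
  by (simp add: arcs_Q)

lemma tail_src: "e \<in> arcs Q \<Longrightarrow> tail Q e = md (src e)"
  using tail_md[of e] by (simp add: arc_md)

lemma head_tgt: "e \<in> arcs Q \<Longrightarrow> head Q e = md (tgt e)"
  using head_md[of e] by (simp add: arc_md)

lemma finite_verts_Q: "finite (verts Q)"
  by (simp add: verts_Q)

lemma wf_Q: "wf_digraph Q"
  by unfold_locales (simp_all add: tail_src head_tgt)

lemmas tail_in_Q = wf_digraph.tail_in_verts[OF wf_Q]
  and head_in_Q = wf_digraph.head_in_verts[OF wf_Q]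

lemma sum_shift_mod: "(\<Sum>j\<in>{0..<int n}. f (md (j - 1))) = (\<Sum>j\<in>{0..<int n}. (f j :: int))"
proof (rule sum.reindex_bij_betw)
  show "bij_betw (\<lambda>j. md (j - 1)) {0..<int n} {0..<int n}"
  proof (rule bij_betw_byWitness[where f' = "\<lambda>j. md (j + 1)"])
    show "\<forall>a\<in>{0..<int n}. md (md (a - 1) + 1) = a" by (simp add: mod_add_left_eq)
    show "\<forall>a\<in>{0..<int n}. md (md (a + 1) - 1) = a" by (simp add: mod_diff_left_eq)
  qed (use n_pos in auto)
qed

abbreviation eexcess :: "real \<Rightarrow> (int \<Rightarrow> nat) \<Rightarrow> real" where
  "eexcess \<equiv> excess Q (euler_stability Q)"

definition edge_defect :: "(int \<Rightarrow> nat) \<Rightarrow> int" where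
  "edge_defect \<delta> = (\<Sum>e\<in>arcs Q. int (\<delta> (tail Q e)) - int (\<delta> (head Q e)))"

definition euler_degree :: "(int \<Rightarrow> nat) \<Rightarrow> int" where
  "euler_degree \<delta> = (\<Sum>x\<in>verts Q. (1 - int (in_degree Q x)) * int (\<delta> x))"

definition total :: "(int \<Rightarrow> nat) \<Rightarrow> nat" where
  "total \<delta> = (\<Sum>x\<in>verts Q. \<delta> x)"

text \<open>
  Exactly two ends of edges meet at each vertex of the cycle, so the sum of \<open>\<delta>\<close> over the vertices is half the
  sum over all ends of edges. The in-degrees contribute the heads, and the difference is a sum of
  local terms that are controlled by kernels and cokernels of the edge maps. The factor 2 also gives
  the integrality on which the semistability proof rests.
\<close>

lemma euler_degree_edges: "2 * euler_degree \<delta> = edge_defect \<delta>"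
proof -
  have "(\<Sum>x\<in>verts Q. int (in_degree Q x) * int (\<delta> x)) =
      (\<Sum>x\<in>verts Q. \<Sum>e\<in>{e \<in> arcs Q. head Q e = x}. int (\<delta> (head Q e)))"
    by (intro sum.cong refl) (simp add: in_degree_def in_arcs_def)
  also have "\<dots> = (\<Sum>e\<in>arcs Q. int (\<delta> (head Q e)))"
    by (rule sum.group) (use wf_digraph.head_in_verts[OF wf_Q] in \<open>auto simp: arcs_Q verts_Q\<close>)
  finally have heads: "(\<Sum>x\<in>verts Q. int (in_degree Q x) * int (\<delta> x)) = (\<Sum>e\<in>arcs Q. int (\<delta> (head Q e)))" .
  have "(\<Sum>e\<in>arcs Q. int (\<delta> (tail Q e)) + int (\<delta> (head Q e))) =
      (\<Sum>j\<in>{0..<int n}. int (\<delta> (md (j - 1))) + int (\<delta> j))"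
    unfolding arcs_Q by (intro sum.cong refl) (simp add: cyclic_quiver_def)
  also have "\<dots> = 2 * (\<Sum>x\<in>verts Q. int (\<delta> x))"
    using sum_shift_mod[of "\<lambda>j. int (\<delta> j)"] by (simp add: sum.distrib verts_Q)
  finally have "(\<Sum>e\<in>arcs Q. int (\<delta> (tail Q e)) + int (\<delta> (head Q e))) = 2 * (\<Sum>x\<in>verts Q. int (\<delta> x))" .
  then show ?thesis unfolding euler_degree_def edge_defect_def
    using heads by (simp add: left_diff_distrib sum_subtractf sum.distrib)
qed

lemma excess_euler:
  "eexcess \<nu> \<delta> = real_of_int (euler_degree \<delta>) - \<nu> * real (total \<delta>)"
  unfolding excess_def euler_degree_def total_def euler_stability_def
  by (simp add: left_diff_distrib sum_subtractf sum_distrib_left)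

text \<open>
  The dimension vector of \<open>N[u,v]\<close>.
\<close>

definition residue_count :: "int \<Rightarrow> int \<Rightarrow> int \<Rightarrow> nat" where
  "residue_count u v x = card {m \<in> {u..v}. md m = x}"

definition arc_sign :: "int \<Rightarrow> int" where
  "arc_sign m = (if fwd (md m) then 1 else - 1)"

lemma total_residue_count: "total (residue_count u v) = nat (v - u + 1)"
proof -
  have "total (residue_count u v) = (\<Sum>x\<in>verts Q. \<Sum>m\<in>{m \<in> {u..v}. md m = x}. 1)"
    unfolding total_def residue_count_def by simp
  also have "\<dots> = (\<Sum>m\<in>{u..v}. 1)"
    by (rule sum.group) (auto simp: finite_verts_Q simp del: md_in intro: md_in)
  finally show ?thesis by simp
qed

text \<open>
  Shifting the interval by one shows that the dimensions of \<open>N[u,v]\<close> at the two ends of an edge agree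
  up to the contributions of \<open>v + 1\<close> and \<open>u\<close>; only the two edges leaving the interval matter.
\<close>

lemma edge_defect_residue_count:
  assumes "u \<le> v"
  shows "edge_defect (residue_count u v) = arc_sign (v + 1) - arc_sign u"
proof -
  have shift: "int (residue_count u v (md (j - 1))) - int (residue_count u v j) =
      (if md (v + 1) = j then 1 else 0) - (if md u = j then 1 else 0)" if j: "j \<in> arcs Q" for j
  proof -
    define A where "A = {m \<in> {u + 1..v}. md m = j}"
    have A: "finite A" "v + 1 \<notin> A" "u \<notin> A"
      by (auto simp: A_def intro: finite_subset[of _ "{u..v}"])
    have "bij_betw (\<lambda>m. m + 1) {m \<in> {u..v}. md m = md (j - 1)} {m \<in> {u + 1..v + 1}. md m = j}"
    proof (rule bij_betw_byWitness[where f' = "\<lambda>m. m - 1"])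
      have "md (m + 1) = j" if "md m = md (j - 1)" for m
        using that j arc_md[OF j] by (metis diff_add_cancel mod_add_left_eq)
      then show "(\<lambda>m. m + 1) ` {m \<in> {u..v}. md m = md (j - 1)} \<subseteq> {m \<in> {u + 1..v + 1}. md m = j}"
        by auto
      show "(\<lambda>m. m - 1) ` {m \<in> {u + 1..v + 1}. md m = j} \<subseteq> {m \<in> {u..v}. md m = md (j - 1)}"
        by (auto simp: mod_diff_left_eq)
    qed auto
    then have "residue_count u v (md (j - 1)) = card {m \<in> {u + 1..v + 1}. md m = j}"
      unfolding residue_count_def by (rule bij_betw_same_card)
    also have "{m \<in> {u + 1..v + 1}. md m = j} = (if md (v + 1) = j then insert (v + 1) A else A)"
      using assms by (auto simp: A_def order_le_less)
    also have "card \<dots> = card A + (if md (v + 1) = j then 1 else 0)" using A by auto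
    finally have 1: "residue_count u v (md (j - 1)) = card A + (if md (v + 1) = j then 1 else 0)" .
    have "{m \<in> {u..v}. md m = j} = (if md u = j then insert u A else A)"
      using assms by (auto simp: A_def order_le_less)
    then have "residue_count u v j = card A + (if md u = j then 1 else 0)"
      unfolding residue_count_def using A by auto
    with 1 show ?thesis by simp
  qed
  have "edge_defect (residue_count u v) = (\<Sum>j\<in>arcs Q. arc_sign j *
      (int (residue_count u v (md (j - 1))) - int (residue_count u v j)))"
    unfolding edge_defect_def
    by (intro sum.cong refl) (simp add: cyclic_quiver_def arc_sign_def)
  also have "\<dots> = (\<Sum>j\<in>arcs Q. (if md (v + 1) = j then arc_sign j else 0) - (if md u = j then arc_sign j else 0))"
    by (intro sum.cong refl) (use shift in auto)
  also have "\<dots> = arc_sign (md (v + 1)) - arc_sign (md u)"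
    by (simp add: sum_subtractf finite_verts_Q arcs_Q n_pos)
  finally show ?thesis by (simp add: arc_sign_def)
qed

lemma finite_residues [simp]: "finite {m. u \<le> m \<and> m \<le> v \<and> md m = x}"
  by (rule finite_subset[of _ "{u..v}"]) auto

section \<open>The representations \<open>N[u,v]\<close>\<close>

abbreviation scaleN :: "'k::field \<Rightarrow> (int \<Rightarrow> 'k) \<Rightarrow> int \<Rightarrow> 'k" where
  "scaleN \<equiv> \<lambda>k f m. k * f m"

lemma vector_space_scaleN: "vector_space scaleN"
  by unfold_locales (auto simp: algebra_simps fun_eq_iff)

definition unitvec :: "int \<Rightarrow> int \<Rightarrow> 'k::field" where
  "unitvec m = (\<lambda>i. if i = m then 1 else 0)"

abbreviation (input) N :: "int \<Rightarrow> int \<Rightarrow> 'k::field nrep" where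
  "N u v \<equiv> N_rep n fwd u v"

lemma rscale_N [simp]: "rscale (N u v) = scaleN"
  by (simp add: N_rep_def)

lemma rspace_N: "f \<in> rspace (N u v) x \<longleftrightarrow> (\<forall>m. f m \<noteq> 0 \<longrightarrow> u \<le> m \<and> m \<le> v \<and> md m = x)"
  by (simp add: N_rep_def)

lemma rmap_N: "rmap (N u v) (md m) f i =
    (if u \<le> i \<and> i \<le> v then f (if fwd (md m) then i - 1 else i + 1) else 0)"
  by (simp add: N_rep_def)

lemma rspace_N_outside: "f \<in> rspace (N u v) x \<Longrightarrow> \<not> (u \<le> m \<and> m \<le> v \<and> md m = x) \<Longrightarrow> f m = 0"
  by (auto simp: rspace_N)

lemma subspace_N: "module.subspace scaleN (rspace (N u v) x)"
proof -
  interpret vector_space scaleN by (rule vector_space_scaleN)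
  show ?thesis
  proof (rule subspaceI)
    show "0 \<in> rspace (N u v) x" by (simp add: rspace_N)
    show "f + g \<in> rspace (N u v) x" if "f \<in> rspace (N u v) x" "g \<in> rspace (N u v) x" for f g
      unfolding rspace_N
    proof (intro allI impI)
      fix m assume "(f + g) m \<noteq> 0"
      then have "f m \<noteq> 0 \<or> g m \<noteq> 0" by auto
      then show "u \<le> m \<and> m \<le> v \<and> md m = x" using that unfolding rspace_N by blast
    qed
    show "scaleN c f \<in> rspace (N u v) x" if "f \<in> rspace (N u v) x" for c f
      using that by (simp add: rspace_N)
  qed
qed

lemma sum_scaleN_unitvec:
  "finite P \<Longrightarrow> (\<Sum>m\<in>P. scaleN (a m) (unitvec m)) = (\<lambda>i. if i \<in> P then a i else 0)"
proof
  fix i assume "finite P"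
  have "(\<Sum>m\<in>P. scaleN (a m) (unitvec m)) i = (\<Sum>m\<in>P. a m * unitvec m i)"
    by (induction P rule: infinite_finite_induct) auto
  also have "\<dots> = (\<Sum>m\<in>P. if m = i then a m else 0)" by (rule sum.cong) (auto simp: unitvec_def)
  finally show "(\<Sum>m\<in>P. scaleN (a m) (unitvec m)) i = (if i \<in> P then a i else 0)"
    using \<open>finite P\<close> by simp
qed

lemma N_expand:
  assumes "f \<in> rspace (N u v) x"
  shows "f = (\<Sum>m\<in>{m \<in> {u..v}. md m = x}. scaleN (f m) (unitvec m))"
  by (subst sum_scaleN_unitvec) (use rspace_N_outside[OF assms] in \<open>auto simp: fun_eq_iff\<close>)

lemma unitvec_in_N: "u \<le> m \<Longrightarrow> m \<le> v \<Longrightarrow> unitvec m \<in> rspace (N u v) (md m)"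
  by (auto simp: rspace_N unitvec_def)

lemma dim_N: "dim_at (N u v :: 'k::field nrep) x = residue_count u v x"
proof -
  interpret vector_space "scaleN :: 'k \<Rightarrow> _" by (rule vector_space_scaleN)
  let ?P = "{m \<in> {u..v}. md m = x}"
  let ?N = "rspace (N u v) x :: (int \<Rightarrow> 'k) set"
  have P: "finite ?P" by simp
  have "dim ?N = card ?P"
  proof (rule dim_eq_card_family[where e = unitvec])
    show "finite ?P" by (rule P)
    show "subspace ?N" by (rule subspace_N)
    show "unitvec m \<in> ?N" if "m \<in> ?P" for m using that unitvec_in_N by auto
    show "\<exists>a. f = (\<Sum>m\<in>?P. scaleN (a m) (unitvec m))" if "f \<in> ?N" for f
      using N_expand[OF that] by blast
    show "a m = 0" if "(\<Sum>m\<in>?P. scaleN (a m) (unitvec m)) = 0" "m \<in> ?P" for a m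
      using that unfolding sum_scaleN_unitvec[OF P] by (auto dest!: fun_cong[of _ _ m])
  qed
  then show ?thesis by (simp add: dim_at_def residue_count_def)
qed

lemma fd_N: "fd_subspace scaleN (rspace (N u v) x :: (int \<Rightarrow> 'k::field) set)"
proof -
  interpret vector_space "scaleN :: 'k \<Rightarrow> _" by (rule vector_space_scaleN)
  let ?P = "{m \<in> {u..v}. md m = x}"
  let ?N = "rspace (N u v) x :: (int \<Rightarrow> 'k) set"
  have "?N \<subseteq> span (unitvec ` ?P)"
  proof
    fix f assume f: "f \<in> ?N"
    have "(\<Sum>m\<in>?P. scaleN (f m) (unitvec m)) \<in> span (unitvec ` ?P)"
      by (intro span_sum span_scale span_base imageI)
    then show "f \<in> span (unitvec ` ?P)" using N_expand[OF f] by simp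
  qed
  moreover have "span (unitvec ` ?P) \<subseteq> ?N"
    by (rule span_minimal) (use unitvec_in_N subspace_N in auto)
  ultimately have "span (unitvec ` ?P) = ?N" by (rule subset_antisym[rotated])
  moreover have "finite (unitvec ` ?P :: (int \<Rightarrow> 'k) set)" by simp
  ultimately show ?thesis unfolding fd_subspace_def using subspace_N by blast
qed

lemma rmap_N_linear:
  "linear_between scaleN scaleN (rspace (N u v) (md (src m))) (rspace (N u v) (md (tgt m)))
     (rmap (N u v) (md m))"
  unfolding linear_between_def
proof (intro conjI ballI allI)
  show "rmap (N u v) (md m) \<in> rspace (N u v) (md (src m)) \<rightarrow> rspace (N u v) (md (tgt m))"
  proof
    fix f assume f: "f \<in> rspace (N u v) (md (src m))"
    show "rmap (N u v) (md m) f \<in> rspace (N u v) (md (tgt m))"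
      unfolding rspace_N
    proof (intro allI impI)
      fix i assume i: "rmap (N u v) (md m) f i \<noteq> 0"
      let ?i = "if fwd (md m) then i - 1 else i + 1"
      from i have ui: "u \<le> i" "i \<le> v" "f ?i \<noteq> 0" by (auto simp: rmap_N split: if_splits)
      then have "md ?i = md (src m)" using f by (auto simp: rspace_N)
      then have "md i = md (tgt m)" unfolding src_def tgt_def
        by (cases "fwd (md m)") (simp_all add: mod_eq_dvd_iff algebra_simps)
      then show "u \<le> i \<and> i \<le> v \<and> md i = md (tgt m)" using ui by simp
    qed
  qed
qed (auto simp: rmap_N fun_eq_iff)

lemma quiver_rep_N: "quiver_rep Q (N u v)"
  unfolding quiver_rep_def
proof (intro conjI ballI)
  fix e assume e: "e \<in> arcs Q"
  show "linear_between (rscale (N u v)) (rscale (N u v)) (rspace (N u v) (tail Q e))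
      (rspace (N u v) (head Q e)) (rmap (N u v) e)"
    using rmap_N_linear[of u v e] unfolding arc_md[OF e] tail_src[OF e] head_tgt[OF e] by simp
qed (simp_all add: vector_space_scaleN subspace_N)

end

context cyclic
begin

section \<open>Semistability of \<open>N[u,v]\<close>\<close>

text \<open>
  The dimension of the kernel of the map of \<open>N[u,v]\<close> at \<open>e\<close>. It is nonzero only if some lift of
  \<open>e\<close> leaves the interval, and then \<open>kernel_position\<close> is the index of the basis vector that is killed.
\<close>

definition kernel_dim :: "int \<Rightarrow> int \<Rightarrow> int \<Rightarrow> nat" where
  "kernel_dim u v e = (if fwd e then (if md (v + 1) = e then 1 else 0) else (if md u = e then 1 else 0))"

definition kernel_position :: "int \<Rightarrow> int \<Rightarrow> int \<Rightarrow> int" where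
  "kernel_position u v e = (if fwd e then v else u)"

lemma sum_kernel_dim:
  "(\<Sum>e\<in>arcs Q. kernel_dim u v e) = (if fwd (md (v + 1)) then 1 else 0) + (if fwd (md u) then 0 else 1)"
proof -
  have "(\<Sum>e\<in>arcs Q. kernel_dim u v e) =
     (\<Sum>e\<in>arcs Q. (if md (v + 1) = e then (if fwd e then 1 else 0) else 0) +
        (if md u = e then (if fwd e then 0 else 1) else 0))"
    by (intro sum.cong refl) (simp add: kernel_dim_def)
  also have "\<dots> = (\<Sum>e\<in>arcs Q. if md (v + 1) = e then (if fwd e then 1 else 0) else 0) +
       (\<Sum>e\<in>arcs Q. if md u = e then (if fwd e then 0 else 1) else 0)"
    by (rule sum.distrib)
  also have "\<dots> = (if fwd (md (v + 1)) then 1 else 0) + (if fwd (md u) then 0 else 1)"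
    by (simp add: arcs_Q n_pos)
  finally show ?thesis .
qed

lemma kernel_N:
  assumes e: "e \<in> arcs Q" and f: "f \<in> rspace (N u v) (tail Q e)" "rmap (N u v) e f = 0"
  shows "f = scaleN (f (kernel_position u v e)) (unitvec (kernel_position u v e))"
    and "kernel_dim u v e = 0 \<Longrightarrow> f = 0"
proof -
  have 0: "f m = 0" if "m \<noteq> kernel_position u v e" for m
  proof (cases "u \<le> m \<and> m \<le> v")
    case True
    let ?i = "if fwd e then m + 1 else m - 1"
    have "u \<le> ?i \<and> ?i \<le> v" using True that by (auto simp: kernel_position_def split: if_splits)
    moreover have "rmap (N u v) e f ?i = 0" using f(2) by simp
    ultimately show ?thesis using rmap_N[of u v e f ?i] arc_md[OF e] by (auto split: if_splits)
  next
    case False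
    then show ?thesis using rspace_N_outside[OF f(1)] by auto
  qed
  then show 1: "f = scaleN (f (kernel_position u v e)) (unitvec (kernel_position u v e))"
    by (auto simp: fun_eq_iff unitvec_def)
  assume k: "kernel_dim u v e = 0"
  have "md (kernel_position u v e) \<noteq> tail Q e"
  proof
    assume "md (kernel_position u v e) = tail Q e"
    then have "md (kernel_position u v e) = md (src e)" using tail_src[OF e] by simp
    moreover have "fwd (md e) = fwd e" using arc_md[OF e] by simp
    ultimately have "md (if fwd e then v + 1 else u) = md e"
      by (cases "fwd e") (simp_all add: kernel_position_def src_def mod_eq_dvd_iff algebra_simps)
    then show False using k arc_md[OF e] by (auto simp: kernel_dim_def split: if_splits)
  qed
  then have "f (kernel_position u v e) = 0" using rspace_N_outside[OF f(1)] by blast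
  then show "f = 0" using 1 by (simp add: fun_eq_iff)
qed

context
  fixes u v :: int and K :: "int \<Rightarrow> (int \<Rightarrow> 'k::field) set"
  assumes uv: "u \<le> v" and K: "subrep Q (N u v) K"
begin

interpretation vector_space "scaleN :: 'k \<Rightarrow> (int \<Rightarrow> 'k) \<Rightarrow> int \<Rightarrow> 'k"
  by (rule vector_space_scaleN)

lemma subrep_N_subspace: "x \<in> verts Q \<Longrightarrow> subspace (K x)" "x \<in> verts Q \<Longrightarrow> K x \<subseteq> rspace (N u v) x"
  using K by (simp_all add: subrep_def)

lemma subrep_N_map: "e \<in> arcs Q \<Longrightarrow> f \<in> K (tail Q e) \<Longrightarrow> rmap (N u v) e f \<in> K (head Q e)"
  using K by (simp add: subrep_def image_subset_iff)

lemma subrep_N_fd: "x \<in> verts Q \<Longrightarrow> fd_subspace scaleN (K x)"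
  using fd_subset[OF fd_N subrep_N_subspace] .

text \<open>
  Along an edge a subrepresentation loses at most the kernel of the ambient map. Equality forces it
  to contain this kernel and to have a surjective map at the edge.
\<close>

lemma subrep_N_edge_dims:
  assumes e: "e \<in> arcs Q"
  shows "dim (K (tail Q e)) \<le> dim (K (head Q e)) + kernel_dim u v e"
    and "dim (K (tail Q e)) = dim (K (head Q e)) + kernel_dim u v e \<Longrightarrow>
      rmap (N u v) e ` K (tail Q e) = K (head Q e) \<and>
      (kernel_dim u v e = 1 \<longrightarrow> unitvec (kernel_position u v e) \<in> K (tail Q e))"
proof -
  let ?f = "rmap (N u v :: 'k nrep) e"
  let ?w = "unitvec (kernel_position u v e) :: int \<Rightarrow> 'k"
  have t: "tail Q e \<in> verts Q" and h: "head Q e \<in> verts Q"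
    using tail_in_Q[OF e] head_in_Q[OF e] .
  have lin0: "linear_between scaleN scaleN (rspace (N u v) (tail Q e)) (rspace (N u v) (head Q e)) ?f"
    using rmap_N_linear[of u v e, where 'a = 'k] unfolding arc_md[OF e] tail_src[OF e] head_tgt[OF e] .
  have im: "?f ` K (tail Q e) \<subseteq> K (head Q e)" using subrep_N_map[OF e] by blast
  have lin: "linear_between scaleN scaleN (K (tail Q e)) (K (head Q e)) ?f"
    by (rule linear_between_subset[OF lin0 subrep_N_subspace(2)[OF t] im])
  let ?Z = "{f \<in> K (tail Q e). ?f f = 0}"
  have rn: "dim (K (tail Q e)) = dim ?Z + dim (?f ` K (tail Q e))"
    by (rule dim_rank_nullity[OF vector_space_scaleN vector_space_scaleN lin subrep_N_fd[OF t]])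
  have sub_im: "subspace (?f ` K (tail Q e))"
    by (rule linear_between_image_subspace[OF vector_space_scaleN vector_space_scaleN lin subrep_N_subspace(1)[OF t]])
  have d_im: "dim (?f ` K (tail Q e)) \<le> dim (K (head Q e))"
    by (rule fd_dim_mono[OF subrep_N_fd[OF h] sub_im im])
  have "?Z = {f \<in> K (tail Q e). ?f f \<in> {0}}" by simp
  then have sub_Z: "subspace ?Z"
    using linear_between_vimage_subspace[OF vector_space_scaleN vector_space_scaleN lin subrep_N_subspace(1)[OF t] subspace_single_0]
    by simp
  have Zw: "?Z \<subseteq> span {?w}"
  proof
    fix f assume "f \<in> ?Z"
    then have "f = scaleN (f (kernel_position u v e)) ?w" using kernel_N(1)[OF e] subrep_N_subspace(2)[OF t] by blast
    then show "f \<in> span {?w}" by (metis insertI1 span_base span_scale)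
  qed
  have ka: "kernel_dim u v e = 0 \<or> kernel_dim u v e = 1" by (simp add: kernel_dim_def)
  have d_Z: "dim ?Z \<le> kernel_dim u v e"
  proof (cases "kernel_dim u v e = 0")
    case True
    then have "?Z \<subseteq> span {}" using kernel_N(2)[OF e] subrep_N_subspace(2)[OF t] by (auto simp: span_empty)
    then have "dim ?Z \<le> card ({} :: (int \<Rightarrow> 'k) set)" by (rule dim_le_card) simp
    then show ?thesis by simp
  next
    case False
    have "dim ?Z \<le> card {?w}" using Zw by (rule dim_le_card) simp
    then show ?thesis using False ka by simp
  qed
  show "dim (K (tail Q e)) \<le> dim (K (head Q e)) + kernel_dim u v e" using rn d_im d_Z by simp
  assume eq: "dim (K (tail Q e)) = dim (K (head Q e)) + kernel_dim u v e"
  then have d: "dim (?f ` K (tail Q e)) = dim (K (head Q e))" "dim ?Z = kernel_dim u v e"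
    using rn d_im d_Z by linarith+
  show "?f ` K (tail Q e) = K (head Q e) \<and> (kernel_dim u v e = 1 \<longrightarrow> ?w \<in> K (tail Q e))"
  proof (intro conjI impI)
    show "?f ` K (tail Q e) = K (head Q e)" by (rule fd_dim_eq[OF subrep_N_fd[OF h] sub_im im d(1)])
    assume k: "kernel_dim u v e = 1"
    have iff: "dim ?Z = 0 \<longleftrightarrow> ?Z = {0}"
      by (rule fd_dim_0_iff[OF fd_subset[OF subrep_N_fd[OF t] sub_Z]]) auto
    have "?Z \<noteq> {0}" unfolding iff[symmetric] using d(2) k by simp
    then obtain f where f: "f \<in> ?Z" "f \<noteq> 0" using subspace_0[OF sub_Z] by blast
    then have "f = scaleN (f (kernel_position u v e)) ?w" using kernel_N(1)[OF e] subrep_N_subspace(2)[OF t] by blast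
    moreover define c where "c = f (kernel_position u v e)"
    ultimately have fc: "f = scaleN c ?w" by simp
    then have "c \<noteq> 0" using f by (auto simp: fun_eq_iff)
    then have "?w = scaleN (inverse c) f" unfolding fc by (simp add: fun_eq_iff)
    then show "?w \<in> K (tail Q e)" using subspace_scale[OF subrep_N_subspace(1)[OF t]] f by auto
  qed
qed

lemma subrep_N_edge_defect:
  "edge_defect (\<lambda>x. dim (K x)) \<le> int (\<Sum>e\<in>arcs Q. kernel_dim u v e)"
  "edge_defect (\<lambda>x. dim (K x)) = int (\<Sum>e\<in>arcs Q. kernel_dim u v e) \<Longrightarrow> e \<in> arcs Q \<Longrightarrow>
     dim (K (tail Q e)) = dim (K (head Q e)) + kernel_dim u v e"
proof -
  have *: "(\<Sum>e\<in>arcs Q. int (dim (K (head Q e)) + kernel_dim u v e) - int (dim (K (tail Q e))))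
     = int (\<Sum>e\<in>arcs Q. kernel_dim u v e) - edge_defect (\<lambda>x. dim (K x))"
    unfolding edge_defect_def by (simp add: sum.distrib sum_subtractf)
  have nn: "0 \<le> int (dim (K (head Q e)) + kernel_dim u v e) - int (dim (K (tail Q e)))" if "e \<in> arcs Q" for e
    using subrep_N_edge_dims(1)[OF that] by simp
  have "0 \<le> int (\<Sum>e\<in>arcs Q. kernel_dim u v e) - edge_defect (\<lambda>x. dim (K x))"
    unfolding *[symmetric] by (rule sum_nonneg) (rule nn)
  then show "edge_defect (\<lambda>x. dim (K x)) \<le> int (\<Sum>e\<in>arcs Q. kernel_dim u v e)" by simp
  assume "edge_defect (\<lambda>x. dim (K x)) = int (\<Sum>e\<in>arcs Q. kernel_dim u v e)" and e: "e \<in> arcs Q"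
  then have "(\<Sum>e\<in>arcs Q. int (dim (K (head Q e)) + kernel_dim u v e) - int (dim (K (tail Q e)))) = 0"
    using * by simp
  then have "int (dim (K (head Q e)) + kernel_dim u v e) - int (dim (K (tail Q e))) = 0"
    by (subst (asm) sum_nonneg_eq_0_iff) (use nn e in \<open>auto simp: arcs_Q\<close>)
  then show "dim (K (tail Q e)) = dim (K (head Q e)) + kernel_dim u v e" by simp
qed

lemma subrep_N_total_le: "total (\<lambda>x. dim (K x)) \<le> nat (v - u + 1)"
proof -
  have "dim (K x) \<le> residue_count u v x" if "x \<in> verts Q" for x
    using fd_dim_mono[OF fd_N subrep_N_subspace(1,2), OF that that] dim_N[of u v x, where 'k = 'k] by (simp add: dim_at_def)
  then show ?thesis unfolding total_residue_count[symmetric] total_def by (rule sum_mono)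
qed

text \<open>
  If the edge at \<open>u\<close> points into the interval, no vector in the image of its map has a component
  at \<open>u\<close>. For a subrepresentation with surjective maps the vanishing of this coordinate then
  propagates from each position to the next: backwards through surjectivity or by applying the map.
\<close>

lemma subrep_N_zero_if_surjective:
  assumes eq: "\<And>e. e \<in> arcs Q \<Longrightarrow> rmap (N u v) e ` K (tail Q e) = K (head Q e)"
    and u: "fwd (md u)" and x: "x \<in> verts Q"
  shows "K x = {0}"
proof -
  have im: "rmap (N u v) (md m) ` K (md (src m)) = K (md (tgt m))" for m
    using eq[OF md_in(2)] unfolding tail_md head_md .
  have *: "\<forall>f\<in>K (md m). f m = 0" if "u \<le> m" "m \<le> v" for m
    using that
  proof (induction m rule: int_ge_induct)
    case base
    show ?case
    proof
      fix f assume "f \<in> K (md u)"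
      then obtain g where g: "g \<in> K (md (u - 1))" "f = rmap (N u v) (md u) g"
        using im[of u] u by (auto simp: src_def tgt_def)
      then have "f u = g (u - 1)" using uv u by (simp add: rmap_N)
      then show "f u = 0" using rspace_N_outside[of g u v] subrep_N_subspace(2)[OF md_in(1)] g(1) by fastforce
    qed
  next
    case (step m)
    show ?case
    proof (cases "fwd (md (m + 1))")
      case True
      show ?thesis
      proof
        fix f assume "f \<in> K (md (m + 1))"
        then obtain g where g: "g \<in> K (md m)" "f = rmap (N u v) (md (m + 1)) g"
          using im[of "m + 1"] True by (auto simp: src_def tgt_def)
        then show "f (m + 1) = 0" using True step by (simp add: rmap_N)
      qed
    next
      case False
      show ?thesis
      proof
        fix f assume f: "f \<in> K (md (m + 1))"
        then have "rmap (N u v) (md (m + 1)) f \<in> K (md m)"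
          using im[of "m + 1"] False by (auto simp: src_def tgt_def)
        then have "rmap (N u v) (md (m + 1)) f m = 0" using step by simp
        then show "f (m + 1) = 0" using False step by (simp add: rmap_N)
      qed
    qed
  qed
  show ?thesis
  proof
    show "{0} \<subseteq> K x" using subspace_0[OF subrep_N_subspace(1)[OF x]] by simp
    show "K x \<subseteq> {0}"
    proof
      fix f assume f: "f \<in> K x"
      have "f m = 0" for m
      proof (cases "u \<le> m \<and> m \<le> v \<and> md m = x")
        case True
        then show ?thesis using * f by auto
      next
        case False
        then show ?thesis using rspace_N_outside subrep_N_subspace(2)[OF x] f by blast
      qed
      then show "f \<in> {0}" by (simp add: fun_eq_iff)
    qed
  qed
qed

text \<open>
  If the edge at \<open>u\<close> points out of the interval, the basis vector at \<open>u\<close> lies in its kernel, hence in the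
  subrepresentation by \<open>ker\<close>. Membership propagates to the right: by applying the map, or, against
  the direction of the edge, by lifting along the surjection and correcting by the kernel.
\<close>

lemma subrep_N_all_if_surjective:
  assumes eq: "\<And>e. e \<in> arcs Q \<Longrightarrow> rmap (N u v) e ` K (tail Q e) = K (head Q e)"
    and ker: "\<And>e. e \<in> arcs Q \<Longrightarrow> kernel_dim u v e = 1 \<Longrightarrow> unitvec (kernel_position u v e) \<in> K (tail Q e)"
    and u: "\<not> fwd (md u)" and x: "x \<in> verts Q"
  shows "K x = rspace (N u v) x"
proof -
  have im: "rmap (N u v) (md m) ` K (md (src m)) = K (md (tgt m))" for m
    using eq[OF md_in(2)] unfolding tail_md head_md .
  have bu: "unitvec u \<in> K (md u)"
    using ker[of "md u"] u by (simp add: kernel_dim_def kernel_position_def tail_md src_def)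
  have *: "unitvec m \<in> K (md m)" if "u \<le> m" "m \<le> v" for m
    using that
  proof (induction m rule: int_ge_induct)
    case base
    show ?case by (rule bu)
  next
    case (step m)
    have m: "unitvec m \<in> K (md m)" using step by simp
    show ?case
    proof (cases "fwd (md (m + 1))")
      case True
      have "rmap (N u v) (md (m + 1)) (unitvec m :: int \<Rightarrow> 'k) \<in> K (md (m + 1))"
        using im[of "m + 1"] True m by (auto simp: src_def tgt_def)
      moreover have "rmap (N u v) (md (m + 1)) (unitvec m :: int \<Rightarrow> 'k) = unitvec (m + 1)"
        using True step by (auto simp: rmap_N fun_eq_iff unitvec_def)
      ultimately show ?thesis by simp
    next
      case False
      obtain g where g: "g \<in> K (md (m + 1))" "unitvec m = rmap (N u v) (md (m + 1)) g"
        using im[of "m + 1"] False m by (auto simp: src_def tgt_def)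
      have gN: "g \<in> rspace (N u v) (md (m + 1))" using g subrep_N_subspace(2)[OF md_in(1)] by blast
      \<comment> \<open>the map of this edge only forgets the coordinate at \<open>u\<close>\<close>
      have gi: "g (i + 1) = unitvec m i" if "u \<le> i" "i \<le> v" for i
        using fun_cong[OF g(2), of i] that False by (simp add: rmap_N)
      have gi': "g i = unitvec (m + 1) i" if "i \<noteq> u" for i
      proof (cases "u < i \<and> i \<le> v")
        case True
        then show ?thesis using gi[of "i - 1"] by (auto simp: unitvec_def)
      next
        case False
        then show ?thesis using rspace_N_outside[OF gN, of i] step that by (auto simp: unitvec_def)
      qed
      have "g = unitvec (m + 1) + scaleN (g u) (unitvec u)"
        using gi' step by (auto simp: fun_eq_iff unitvec_def)
      then have "unitvec (m + 1) = g - scaleN (g u) (unitvec u)" by (metis add_diff_cancel_right')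
      moreover have "scaleN (g u) (unitvec u) \<in> K (md (m + 1))"
      proof (cases "md u = md (m + 1)")
        case True
        then show ?thesis using bu subspace_scale[OF subrep_N_subspace(1)[OF md_in(1)]] by metis
      next
        case False
        then have "scaleN (g u) (unitvec u) = (0 :: int \<Rightarrow> 'k)"
          using rspace_N_outside[OF gN, of u] by (auto simp: fun_eq_iff)
        then show ?thesis using subspace_0[OF subrep_N_subspace(1)[OF md_in(1)]] by (simp only:)
      qed
      ultimately show ?thesis using subspace_diff[OF subrep_N_subspace(1)[OF md_in(1)] g(1)] by metis
    qed
  qed
  have "rspace (N u v) x \<subseteq> K x"
  proof
    fix f :: "int \<Rightarrow> 'k" assume f: "f \<in> rspace (N u v) x"
    have "(\<Sum>m\<in>{m \<in> {u..v}. md m = x}. scaleN (f m) (unitvec m)) \<in> K x"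
      by (intro subspace_sum subspace_scale subrep_N_subspace(1)[OF x]) (use * in auto)
    then show "f \<in> K x" using N_expand[OF f] by simp
  qed
  then show ?thesis using subrep_N_subspace(2)[OF x] by blast
qed

end

definition N_slope :: "int \<Rightarrow> int \<Rightarrow> real" where
  "N_slope u v = real_of_int (arc_sign (v + 1) - arc_sign u) / 2 / real_of_int (v - u + 1)"

lemma euler_degree_N:
  assumes "u \<le> v"
  shows "euler_degree (residue_count u v) = int (\<Sum>e\<in>arcs Q. kernel_dim u v e) - 1"
proof -
  have "2 * euler_degree (residue_count u v) = 2 * (int (\<Sum>e\<in>arcs Q. kernel_dim u v e) - 1)"
    unfolding euler_degree_edges edge_defect_residue_count[OF assms] sum_kernel_dim
    by (simp add: arc_sign_def)
  then show ?thesis by simp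
qed

lemma N_slope_degree:
  assumes "u \<le> v"
  shows "N_slope u v = real_of_int (euler_degree (residue_count u v)) / real_of_int (v - u + 1)"
proof -
  have "arc_sign (v + 1) - arc_sign u = 2 * euler_degree (residue_count u v)"
    using euler_degree_edges edge_defect_residue_count[OF assms] by simp
  then show ?thesis unfolding N_slope_def by simp
qed

lemma slope_euler:
  "slope Q (euler_stability Q) V = real_of_int (euler_degree (dim_at V)) / real (total (dim_at V))"
  unfolding slope_def euler_degree_def total_def euler_stability_def by simp

lemma slope_N:
  assumes "u \<le> v"
  shows "slope Q (euler_stability Q) (N u v :: 'k::field nrep) = N_slope u v"
proof -
  have "dim_at (N u v :: 'k nrep) = residue_count u v"
    by (simp add: fun_eq_iff dim_N)
  then show ?thesis using assms
    by (simp add: slope_euler N_slope_degree[OF assms] total_residue_count)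
qed

lemma excess_N:
  assumes "u \<le> v"
  shows "eexcess (N_slope u v) (residue_count u v) = 0"
  using assms by (simp add: excess_euler N_slope_degree total_residue_count)

text \<open>
  Let \<open>k \<in> {0, 1, 2}\<close> be the total dimension of the kernels, so \<open>N[u,v]\<close> has degree \<open>k - 1\<close>, and
  every subrepresentation has degree at most \<open>k / 2\<close>. For \<open>k = 1\<close> integrality suffices. For \<open>k = 0\<close>
  and \<open>k = 2\<close> there remains one value of the degree that would violate the inequality or would be
  tight; then all inequalities along the edges are equalities, and the subrepresentation is zero
  respectively everything. All other values are settled by comparing the total dimensions.
\<close>

lemma N_semistable:
  fixes K :: "int \<Rightarrow> (int \<Rightarrow> 'k::field) set"
  assumes uv: "u \<le> v" and K: "subrep Q (N u v) K"
  shows "eexcess (N_slope u v) (sdim (N u v) K) \<le> 0"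
proof -
  interpret vector_space "scaleN :: 'k \<Rightarrow> (int \<Rightarrow> 'k) \<Rightarrow> int \<Rightarrow> 'k"
    by (rule vector_space_scaleN)
  let ?k = "int (\<Sum>e\<in>arcs Q. kernel_dim u v e)"
  let ?\<delta> = "\<lambda>x. dim (K x)"
  let ?L = "real_of_int (v - u + 1)"
  have sl: "N_slope u v = real_of_int (?k - 1) / ?L"
    using N_slope_degree[OF uv] euler_degree_N[OF uv] by simp
  have L: "?L > 0" using uv by simp
  have tot: "real (total ?\<delta>) \<le> ?L" using subrep_N_total_le[OF uv K] uv by linarith
  have deg: "2 * euler_degree ?\<delta> \<le> ?k"
    using subrep_N_edge_defect(1)[OF uv K] unfolding euler_degree_edges .
  have key: "real_of_int (euler_degree ?\<delta>) * ?L \<le> real_of_int (?k - 1) * real (total ?\<delta>)"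
  proof -
    consider "fwd (md u)" "\<not> fwd (md (v + 1))" | "\<not> fwd (md u)" "fwd (md (v + 1))" | "?k = 1"
      unfolding sum_kernel_dim by (cases "fwd (md u)"; cases "fwd (md (v + 1))") auto
    then show ?thesis
    proof cases
      case 1
      then have k: "?k = 0" unfolding sum_kernel_dim by simp
      show ?thesis
      proof (cases "euler_degree ?\<delta> = 0")
        case True
        then have d: "edge_defect ?\<delta> = ?k" using euler_degree_edges[of ?\<delta>] k by simp
        have "K x = {0}" if "x \<in> verts Q" for x
          by (rule subrep_N_zero_if_surjective[OF uv K _ 1(1) that])
            (use subrep_N_edge_dims(2)[OF uv K] subrep_N_edge_defect(2)[OF uv K d] in blast)
        then have "?\<delta> x = 0" if "x \<in> verts Q" for x
          using that fd_dim_0_iff[OF subrep_N_fd[OF uv K that]] by blast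
        then have "total ?\<delta> = 0" by (simp add: total_def)
        then show ?thesis using True by simp
      next
        case False
        then have "euler_degree ?\<delta> \<le> - 1" using deg k by linarith
        then have "real_of_int (euler_degree ?\<delta>) \<le> - 1" by linarith
        then have "real_of_int (euler_degree ?\<delta>) * ?L \<le> - 1 * ?L" using L by (intro mult_right_mono) auto
        then show ?thesis using tot k by simp
      qed
    next
      case 2
      then have k: "?k = 2" unfolding sum_kernel_dim by simp
      show ?thesis
      proof (cases "euler_degree ?\<delta> = 1")
        case True
        then have d: "edge_defect ?\<delta> = ?k" using euler_degree_edges[of ?\<delta>] k by simp
        have "K x = rspace (N u v) x" if "x \<in> verts Q" for x
          by (rule subrep_N_all_if_surjective[OF uv K _ _ 2(1) that])
            (use subrep_N_edge_dims(2)[OF uv K] subrep_N_edge_defect(2)[OF uv K d] in blast)+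
        then have "?\<delta> x = residue_count u v x" if "x \<in> verts Q" for x
          using that dim_N[of u v x, where 'k = 'k] by (simp add: dim_at_def)
        then have "total ?\<delta> = total (residue_count u v)" by (simp add: total_def)
        then show ?thesis using True k uv by (simp add: total_residue_count)
      next
        case False
        then have "euler_degree ?\<delta> \<le> 0" using deg k by linarith
        then have "real_of_int (euler_degree ?\<delta>) * ?L \<le> 0" using L by (intro mult_nonpos_nonneg) auto
        then show ?thesis using k by simp
      qed
    next
      case 3
      then have "euler_degree ?\<delta> \<le> 0" using deg by linarith
      then have "real_of_int (euler_degree ?\<delta>) * ?L \<le> 0" using L by (intro mult_nonpos_nonneg) auto
      then show ?thesis using 3 by simp
    qed
  qed
  have "eexcess (N_slope u v) ?\<delta> =
      (real_of_int (euler_degree ?\<delta>) * ?L - real_of_int (?k - 1) * real (total ?\<delta>)) / ?L"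
    unfolding excess_euler sl using L by (simp add: field_simps)
  also have "\<dots> \<le> 0" using key L by (simp add: divide_nonpos_pos)
  finally show ?thesis by simp
qed

end

section \<open>Homomorphisms and the filtration\<close>

lemma subrep_hom_vimage:
  assumes "wf_digraph Q" "quiver_rep Q W" "quiver_rep Q V" "rep_hom Q W V f" "subrep Q V B"
    and "subrep Q W A"
  shows "subrep Q W (\<lambda>x. {b \<in> A x. f x b \<in> B x})"
  unfolding subrep_def
proof (intro conjI ballI)
  interpret wf_digraph Q by fact
  fix x assume x: "x \<in> verts Q"
  have A: "A x \<subseteq> rspace W x" "module.subspace (rscale W) (A x)" using assms(6) x by (auto simp: subrep_def)
  have "linear_between (rscale W) (rscale V) (rspace W x) (rspace V x) (f x)"
    using assms(4) x by (simp add: rep_hom_def)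
  then have "linear_between (rscale W) (rscale V) (A x) (rspace V x) (f x)"
    by (rule linear_between_subset) (use A \<open>linear_between _ _ _ _ _\<close> in \<open>auto simp: linear_between_def\<close>)
  then show "module.subspace (rscale W) {b \<in> A x. f x b \<in> B x}"
    by (rule linear_between_vimage_subspace[rotated 2])
      (use assms x A in \<open>auto simp: quiver_rep_def subrep_def\<close>)
  show "{b \<in> A x. f x b \<in> B x} \<subseteq> rspace W x" using A by auto
next
  interpret wf_digraph Q by fact
  fix e assume e: "e \<in> arcs Q"
  show "rmap W e ` {b \<in> A (tail Q e). f (tail Q e) b \<in> B (tail Q e)}
       \<subseteq> {b \<in> A (head Q e). f (head Q e) b \<in> B (head Q e)}"
  proof safe
    fix b assume b: "b \<in> A (tail Q e)" "f (tail Q e) b \<in> B (tail Q e)"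
    show "rmap W e b \<in> A (head Q e)" using assms(6) e b by (simp add: subrep_def image_subset_iff)
    have "b \<in> rspace W (tail Q e)" using b assms(6) tail_in_verts[OF e] by (auto simp: subrep_def)
    then have "f (head Q e) (rmap W e b) = rmap V e (f (tail Q e) b)"
      using assms(4) e by (simp add: rep_hom_def)
    then show "f (head Q e) (rmap W e b) \<in> B (head Q e)"
      using assms(5) e b by (simp add: subrep_def image_subset_iff)
  qed
qed

lemma subrep_hom_image:
  assumes "wf_digraph Q" "quiver_rep Q W" "quiver_rep Q V" "rep_hom Q W V f" "subrep Q W A"
  shows "subrep Q V (\<lambda>x. f x ` A x)"
  unfolding subrep_def
proof (intro conjI ballI)
  fix x assume x: "x \<in> verts Q"
  have A: "A x \<subseteq> rspace W x" "module.subspace (rscale W) (A x)" using assms(5) x by (auto simp: subrep_def)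
  have l: "linear_between (rscale W) (rscale V) (rspace W x) (rspace V x) (f x)"
    using assms(4) x by (simp add: rep_hom_def)
  show im: "f x ` A x \<subseteq> rspace V x" using l A by (auto simp: linear_between_def)
  have "linear_between (rscale W) (rscale V) (A x) (rspace V x) (f x)"
    by (rule linear_between_subset[OF l A(1) im])
  then show "module.subspace (rscale V) (f x ` A x)"
    by (rule linear_between_image_subspace[rotated 2]) (use assms A in \<open>auto simp: quiver_rep_def\<close>)
next
  interpret wf_digraph Q by fact
  fix e assume e: "e \<in> arcs Q"
  show "rmap V e ` f (tail Q e) ` A (tail Q e) \<subseteq> f (head Q e) ` A (head Q e)"
  proof safe
    fix b assume b: "b \<in> A (tail Q e)"
    then have "b \<in> rspace W (tail Q e)" using assms(5) tail_in_verts[OF e] by (auto simp: subrep_def)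
    then have "rmap V e (f (tail Q e) b) = f (head Q e) (rmap W e b)"
      using assms(4) e by (simp add: rep_hom_def)
    moreover have "rmap W e b \<in> A (head Q e)" using assms(5) e b by (simp add: subrep_def image_subset_iff)
    ultimately show "rmap V e (f (tail Q e) b) \<in> f (head Q e) ` A (head Q e)" by simp
  qed
qed

lemma subrep_self: "wf_digraph Q \<Longrightarrow> quiver_rep Q V \<Longrightarrow> subrep Q V (rspace V)"
  unfolding subrep_def quiver_rep_def linear_between_def by (auto simp: image_subset_iff)

context HN
begin

lemma plus_sub_ge:
  assumes "subrep Q V U" "x \<in> verts Q"
  shows "B x \<subseteq> plus_sub U B x"
  using subspace_0[OF subrepD[OF assms]] by force

lemma plus_sub_ge':
  assumes "subrep Q V B" "x \<in> verts Q"
  shows "U x \<subseteq> plus_sub U B x"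
  using subspace_0[OF subrepD[OF assms]] by force

text \<open>
  With \<open>\<delta>\<close> the dimension vector of the image of \<open>U\<close> in \<open>V / V\<^sub>j\<close>: if its slope is at least \<open>\<nu>\<close>,
  while all slopes of \<open>V / V\<^sub>j\<close> are below \<open>\<nu>\<close>, then this image must be zero.
\<close>

lemma contained_if_excess_positive:
  assumes j: "j < m" and U: "subrep Q V U"
    and \<delta>: "\<And>x. x \<in> verts Q \<Longrightarrow> \<delta> x + sdim V (F j) x = sdim V (plus_sub U (F j)) x"
    and ex: "0 \<le> excess Q \<alpha> \<nu> \<delta>" and \<nu>: "\<mu> (Suc j) < \<nu>"
    and x: "x \<in> verts Q"
  shows "U x \<subseteq> F j x"
proof -
  let ?U = "plus_sub U (F j)"
  have Fj: "subrep Q V (F j)" using F_subrep j by simp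
  have U': "subrep Q V ?U" by (rule subrep_sum[OF rep wf U Fj])
  have "exc (\<mu> (Suc j)) ?U \<le> exc (\<mu> (Suc j)) (F j)"
    by (rule excess_above[OF j U']) (rule plus_sub_ge[OF U])
  moreover have "exc (\<mu> (Suc j)) ?U = excess Q \<alpha> (\<mu> (Suc j)) \<delta> + exc (\<mu> (Suc j)) (F j)"
    by (rule excess_add) (simp add: \<delta>)
  ultimately have "excess Q \<alpha> (\<mu> (Suc j)) \<delta> \<le> 0" by simp
  moreover have "excess Q \<alpha> (\<mu> (Suc j)) \<delta> = excess Q \<alpha> \<nu> \<delta> + (\<nu> - \<mu> (Suc j)) * real (\<Sum>x\<in>verts Q. \<delta> x)"
    by (rule excess_change_slope)
  ultimately have "(\<nu> - \<mu> (Suc j)) * real (\<Sum>x\<in>verts Q. \<delta> x) \<le> 0" using ex by linarith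
  then have "real (\<Sum>x\<in>verts Q. \<delta> x) \<le> 0" using \<nu> by (simp add: mult_le_0_iff)
  then have "(\<Sum>x\<in>verts Q. \<delta> x) = 0" by linarith
  then have "\<delta> x = 0" using x finite_verts by simp
  then have d: "sdim V (F j) x = sdim V ?U x" using \<delta>[OF x] by simp
  have "F j x = ?U x"
  proof (rule fd_dim_eq)
    show "fd_subspace (rscale V) (?U x)" by (rule fd_subrep[OF U' x])
    show "subspace (F j x)" by (rule subrepD[OF Fj x])
    show "F j x \<subseteq> ?U x" by (rule plus_sub_ge[OF U x])
  qed (rule d)
  then show ?thesis using plus_sub_ge'[OF Fj x, of U] by simp
qed

text \<open>
  With \<open>\<delta>\<close> the dimension vector of \<open>V\<^sub>j\<^sub>+\<^sub>1 / K\<close>: a nonzero quotient of \<open>V\<^sub>j\<^sub>+\<^sub>1\<close> cannot have slope at most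
  \<open>\<nu>\<close> if all slopes of \<open>V\<^sub>j\<^sub>+\<^sub>1\<close> exceed \<open>\<nu>\<close>.
\<close>

lemma all_if_excess_negative:
  assumes j: "j < m" and K: "subrep Q V K" "\<And>x. x \<in> verts Q \<Longrightarrow> K x \<subseteq> F (Suc j) x"
    and \<delta>: "\<And>x. x \<in> verts Q \<Longrightarrow> \<delta> x + sdim V K x = sdim V (F (Suc j)) x"
    and ex: "excess Q \<alpha> \<nu> \<delta> \<le> 0" and \<nu>: "\<nu> < \<mu> (Suc j)"
    and x: "x \<in> verts Q"
  shows "K x = F (Suc j) x"
proof -
  have F: "subrep Q V (F (Suc j))" using F_subrep j by simp
  have "exc (\<mu> (Suc j)) K \<le> exc (\<mu> (Suc j)) (F (Suc j))"
    by (rule excess_below[OF j K])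
  moreover have "exc (\<mu> (Suc j)) (F (Suc j)) = excess Q \<alpha> (\<mu> (Suc j)) \<delta> + exc (\<mu> (Suc j)) K"
    by (rule excess_add) (simp add: \<delta>)
  ultimately have "0 \<le> excess Q \<alpha> (\<mu> (Suc j)) \<delta>" by simp
  moreover have "excess Q \<alpha> (\<mu> (Suc j)) \<delta> = excess Q \<alpha> \<nu> \<delta> + (\<nu> - \<mu> (Suc j)) * real (\<Sum>x\<in>verts Q. \<delta> x)"
    by (rule excess_change_slope)
  ultimately have "0 \<le> (\<nu> - \<mu> (Suc j)) * real (\<Sum>x\<in>verts Q. \<delta> x)" using ex by linarith
  then have "real (\<Sum>x\<in>verts Q. \<delta> x) \<le> 0" using \<nu> by (simp add: zero_le_mult_iff)
  then have "(\<Sum>x\<in>verts Q. \<delta> x) = 0" by linarith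
  then have "\<delta> x = 0" using x finite_verts by simp
  then have d: "sdim V K x = sdim V (F (Suc j)) x" using \<delta>[OF x] by simp
  show ?thesis
    by (rule fd_dim_eq[OF fd_subrep[OF F x] subrepD[OF K(1) x] K(2)[OF x] d])
qed

text \<open>
  The image of \<open>W\<close> in \<open>V / V\<^sub>j\<close> is a quotient of \<open>W\<close>, so its slope is at least \<open>\<sigma>\<close>.
\<close>

lemma hom_from_semistable:
  fixes W :: "('v, 'e, 'k, 'w::ab_group_add) qrep"
  assumes W: "quiver_rep Q W" "\<And>x. x \<in> verts Q \<Longrightarrow> fd_subspace (rscale W) (rspace W x)"
    and ss: "\<And>K. subrep Q W K \<Longrightarrow> excess Q \<alpha> \<sigma> (sdim W K) \<le> 0"
    and sl: "excess Q \<alpha> \<sigma> (dim_at W) = 0"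
    and f: "rep_hom Q W V f" and j: "j < m" and \<sigma>: "\<mu> (Suc j) < \<sigma>"
    and x: "x \<in> verts Q" and b: "b \<in> rspace W x"
  shows "f x b \<in> F j x"
proof -
  interpret W: vector_space "rscale W" using W by (simp add: quiver_rep_def)
  let ?K = "\<lambda>x. {b \<in> rspace W x. f x b \<in> F j x}"
  let ?U = "\<lambda>x. f x ` rspace W x"
  have Fj: "subrep Q V (F j)" using F_subrep j by simp
  have K: "subrep Q W ?K" by (rule subrep_hom_vimage[OF wf W(1) rep f Fj subrep_self[OF wf W(1)]])
  have U: "subrep Q V ?U" by (rule subrep_hom_image[OF wf W(1) rep f subrep_self[OF wf W(1)]])
  have "?U x \<subseteq> F j x"
  proof (rule contained_if_excess_positive[OF j U _ _ \<sigma> x])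
    fix x assume x: "x \<in> verts Q"
    have lin: "linear_between (rscale W) (rscale V) (rspace W x) (rspace V x) (f x)"
      using f x by (simp add: rep_hom_def)
    have eq: "{f x b + a |b a. b \<in> rspace W x \<and> a \<in> F j x} = plus_sub ?U (F j) x" by blast
    have "dim_at W x + sdim V (F j) x = sdim W ?K x + sdim V (plus_sub ?U (F j)) x"
      using dim_relative_rank_nullity[OF W.vector_space_axioms vector_space_axioms lin W(2)[OF x] fd_subrep[OF Fj x]]
      unfolding eq dim_at_def .
    moreover have "sdim W ?K x \<le> dim_at W x"
      unfolding dim_at_def by (rule W.fd_dim_mono[OF W(2)[OF x]]) (use K x in \<open>auto simp: subrep_def\<close>)
    ultimately show "(dim_at W x - sdim W ?K x) + sdim V (F j) x = sdim V (plus_sub ?U (F j)) x" by simp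
  next
    have "excess Q \<alpha> \<sigma> (dim_at W) = excess Q \<alpha> \<sigma> (\<lambda>x. dim_at W x - sdim W ?K x) + excess Q \<alpha> \<sigma> (sdim W ?K)"
    proof (rule excess_add)
      fix x assume x: "x \<in> verts Q"
      have "sdim W ?K x \<le> dim_at W x"
        unfolding dim_at_def by (rule W.fd_dim_mono[OF W(2)[OF x]]) (use K x in \<open>auto simp: subrep_def\<close>)
      then show "dim_at W x = dim_at W x - sdim W ?K x + sdim W ?K x" by simp
    qed
    then show "0 \<le> excess Q \<alpha> \<sigma> (\<lambda>x. dim_at W x - sdim W ?K x)" using ss[OF K] sl by linarith
  qed
  then show ?thesis using b by blast
qed

text \<open>
  The image of \<open>V\<^sub>j\<^sub>+\<^sub>1\<close> is a subrepresentation of \<open>W\<close>, so its slope is at most \<open>\<sigma>\<close>.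
\<close>

lemma hom_to_semistable:
  fixes W :: "('v, 'e, 'k, 'w::ab_group_add) qrep"
  assumes W: "quiver_rep Q W"
    and ss: "\<And>K. subrep Q W K \<Longrightarrow> excess Q \<alpha> \<sigma> (sdim W K) \<le> 0"
    and g: "rep_hom Q V W g" and j: "j < m" and \<sigma>: "\<sigma> < \<mu> (Suc j)"
    and x: "x \<in> verts Q" and b: "b \<in> F (Suc j) x"
  shows "g x b = 0"
proof -
  interpret W: vector_space "rscale W" using W by (simp add: quiver_rep_def)
  let ?K = "\<lambda>x. {b \<in> F (Suc j) x. g x b \<in> {0}}"
  let ?G = "\<lambda>x. g x ` F (Suc j) x"
  have F: "subrep Q V (F (Suc j))" using F_subrep j by simp
  have "rmap W e 0 = 0" if e: "e \<in> arcs Q" for e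
    by (rule linear_between_0[OF W.vector_space_axioms W.vector_space_axioms])
      (use W e wf_digraph.tail_in_verts[OF wf e] in \<open>auto simp: quiver_rep_def\<close>)
  then have Z: "subrep Q W (\<lambda>x. {0})"
    using W W.subspace_0 by (auto simp: subrep_def quiver_rep_def)
  have K: "subrep Q V ?K" by (rule subrep_hom_vimage[OF wf rep W g Z F])
  have G: "subrep Q W ?G" by (rule subrep_hom_image[OF wf rep W g F])
  have "?K x = F (Suc j) x"
  proof (rule all_if_excess_negative[OF j K _ _ ss[OF G] \<sigma> x])
    fix x assume x: "x \<in> verts Q"
    have "linear_between (rscale V) (rscale W) (rspace V x) (rspace W x) (g x)"
      using g x by (simp add: rep_hom_def)
    then have lin: "linear_between (rscale V) (rscale W) (F (Suc j) x) (rspace W x) (g x)"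
      by (rule linear_between_subset) (use F G x in \<open>auto simp: subrep_def\<close>)
    have eq: "?K x = {b \<in> F (Suc j) x. g x b = 0}" by simp
    show "sdim W ?G x + sdim V ?K x = sdim V (F (Suc j)) x"
      using dim_rank_nullity[OF vector_space_axioms W.vector_space_axioms lin fd_subrep[OF F x]]
      unfolding eq by simp
  qed auto
  then show ?thesis using b by blast
qed

end

section \<open>Chains and cochains along the unwinding\<close>

locale cyclic_rep = cyclic n fwd
  for n :: nat and fwd :: "int \<Rightarrow> bool" +
  fixes V :: "(int, int, 'k::field, 'b::ab_group_add) qrep"
  assumes rep_V: "quiver_rep Q V"
    and fd_V: "x \<in> verts Q \<Longrightarrow> fd_subspace (rscale V) (rspace V x)"
begin

interpretation vector_space "rscale V"
  using rep_V by (simp add: quiver_rep_def)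

abbreviation Vm :: "int \<Rightarrow> 'b set" where "Vm m \<equiv> rspace V (md m)"

abbreviation Ve :: "int \<Rightarrow> 'b \<Rightarrow> 'b" where "Ve m \<equiv> rmap V (md m)"

lemma Ve_linear: "linear_between (rscale V) (rscale V) (Vm (src m)) (Vm (tgt m)) (Ve m)"
  using rep_V md_in(2)[of m] unfolding quiver_rep_def by (metis tail_md head_md)

lemma Vm_subspace: "subspace (Vm m)"
  using rep_V md_in(1)[of m] by (simp add: quiver_rep_def)

text \<open>
  A homomorphism from the interval representation on \<open>J\<close> to the lift of \<open>V\<close>, given by the images of
  its basis vectors.
\<close>

definition chain :: "int set \<Rightarrow> (int \<Rightarrow> 'b) \<Rightarrow> bool" where
  "chain J c \<longleftrightarrow> (\<forall>m\<in>J. c m \<in> Vm m) \<and>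
     (\<forall>m. src m \<in> J \<longrightarrow> Ve m (c (src m)) = (if tgt m \<in> J then c (tgt m) else 0))"

text \<open>
  A homomorphism from the lift of \<open>V\<close> to the interval representation on \<open>J\<close>, given by its components.
\<close>

definition cochain :: "int set \<Rightarrow> (int \<Rightarrow> 'b \<Rightarrow> 'k) \<Rightarrow> bool" where
  "cochain J \<gamma> \<longleftrightarrow> (\<forall>m\<in>J. linear_between (rscale V) (*) (Vm m) UNIV (\<gamma> m)) \<and>
     (\<forall>m. tgt m \<in> J \<longrightarrow> (\<forall>b\<in>Vm (src m). \<gamma> (tgt m) (Ve m b) = (if src m \<in> J then \<gamma> (src m) b else 0)))"

lemma src_shift: "src (m + a * int n) = src m + a * int n"
  and tgt_shift: "tgt (m + a * int n) = tgt m + a * int n"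
  by (simp_all add: src_def tgt_def)

lemma chain_UNIV_shift: "chain UNIV c \<Longrightarrow> chain UNIV (\<lambda>m. c (m + a * int n))"
proof -
  assume c: "chain UNIV c"
  show ?thesis unfolding chain_def
  proof (intro conjI ballI allI impI)
    fix m
    have "c (m + a * int n) \<in> Vm (m + a * int n)" using c unfolding chain_def by blast
    then show "c (m + a * int n) \<in> Vm m" by simp
    have "Ve (m + a * int n) (c (src (m + a * int n))) =
        (if tgt (m + a * int n) \<in> UNIV then c (tgt (m + a * int n)) else 0)"
      using c unfolding chain_def by blast
    then show "Ve m (c (src m + a * int n)) = (if tgt m \<in> UNIV then c (tgt m + a * int n) else 0)"
      by (simp add: src_shift tgt_shift)
  qed
qed

lemma chain_UNIV_add: "chain UNIV c \<Longrightarrow> chain UNIV c' \<Longrightarrow> chain UNIV (\<lambda>m. c m + c' m)"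
  unfolding chain_def using Vm_subspace subspace_add Ve_linear
  by (auto simp: linear_between_def)

lemma chain_UNIV_scale: "chain UNIV c \<Longrightarrow> chain UNIV (\<lambda>m. rscale V k (c m))"
  unfolding chain_def using Vm_subspace subspace_scale Ve_linear
  by (auto simp: linear_between_def)

lemma chain_UNIV_zero: "chain UNIV (\<lambda>m. 0)"
  unfolding chain_def
  using Vm_subspace subspace_0 linear_between_0[OF vector_space_axioms vector_space_axioms Ve_linear Vm_subspace]
  by auto

text \<open>
  Because the lift of \<open>V\<close> is periodic, homomorphisms between a finite interval representation
  and the lift descend to homomorphisms between \<open>N[u,v]\<close> and \<open>V\<close>. The formula does not mention the
  vertex: a vector of \<open>N[u,v]\<close> at \<open>x\<close> is supported on the positions over \<open>x\<close>.
\<close>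

definition chain_hom :: "int \<Rightarrow> int \<Rightarrow> (int \<Rightarrow> 'b) \<Rightarrow> (int \<Rightarrow> 'k) \<Rightarrow> 'b" where
  "chain_hom u v c f = (\<Sum>i\<in>{u..v}. rscale V (f i) (c i))"

definition cochain_hom :: "int \<Rightarrow> int \<Rightarrow> (int \<Rightarrow> 'b \<Rightarrow> 'k) \<Rightarrow> int \<Rightarrow> 'b \<Rightarrow> int \<Rightarrow> 'k" where
  "cochain_hom u v \<gamma> x b = (\<lambda>i. if u \<le> i \<and> i \<le> v \<and> md i = x then \<gamma> i b else 0)"

lemma chain_hom_unitvec: "u \<le> i \<Longrightarrow> i \<le> v \<Longrightarrow> chain_hom u v c (unitvec i) = c i"
proof -
  assume "u \<le> i" "i \<le> v"
  have "chain_hom u v c (unitvec i) = (\<Sum>k\<in>{u..v}. if k = i then c k else 0)"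
    unfolding chain_hom_def by (rule sum.cong) (auto simp: unitvec_def)
  then show ?thesis using \<open>u \<le> i\<close> \<open>i \<le> v\<close> by simp
qed

definition step :: "int \<Rightarrow> int" where "step e = (if fwd (md e) then 1 else - 1)"

lemma tgt_src: "tgt m = src m + step m"
  by (simp add: tgt_def src_def step_def)

lemma step_md [simp]: "step (md e) = step e"
  by (simp add: step_def)

lemma rmap_N_step: "rmap (N u v) (md e) f i = (if u \<le> i \<and> i \<le> v then f (i - step e) else 0)"
  by (simp add: rmap_N step_def)

text \<open>
  Path lifting for a single edge. It reduces statements about \<open>V\<close>, where only residue classes are
  known, to the defining conditions of chains and cochains.
\<close>

lemma lift_edge:
  assumes "md i = md (src e)"
  obtains m where "md m = md e" "src m = i" "tgt m = i + step e"
proof -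
  define m where "m = e + (i - src e)"
  have "md m = md e" using assms unfolding m_def by (simp add: mod_eq_dvd_iff)
  moreover from this have "src m = i" by (simp add: m_def src_def)
  moreover from calculation have "tgt m = i + step e" using tgt_src[of m] by (metis step_md)
  ultimately show ?thesis using that by blast
qed

lemma chain_step:
  assumes "chain J c" "i \<in> J" "md i = md (src e)"
  shows "Ve e (c i) = (if i + step e \<in> J then c (i + step e) else 0)"
proof -
  obtain m where m: "md m = md e" "src m = i" "tgt m = i + step e" by (rule lift_edge[OF assms(3)])
  have "Ve m (c (src m)) = (if tgt m \<in> J then c (tgt m) else 0)"
    using assms(1,2) m unfolding chain_def by blast
  then show ?thesis using m by simp
qed

lemma cochain_step:
  assumes "cochain J \<gamma>" "i + step e \<in> J" "md i = md (src e)" "b \<in> Vm (src e)"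
  shows "\<gamma> (i + step e) (Ve e b) = (if i \<in> J then \<gamma> i b else 0)"
proof -
  obtain m where m: "md m = md e" "src m = i" "tgt m = i + step e" by (rule lift_edge[OF assms(3)])
  have "b \<in> Vm (src m)" using assms m by simp
  then have "\<gamma> (tgt m) (Ve m b) = (if src m \<in> J then \<gamma> (src m) b else 0)"
    using assms(1,2) m unfolding cochain_def by metis
  then show ?thesis using m by simp
qed

lemma chain_hom_restrict:
  assumes "f \<in> rspace (N u v) x"
  shows "chain_hom u v c f = (\<Sum>i\<in>{i \<in> {u..v}. md i = x}. rscale V (f i) (c i))"
  unfolding chain_hom_def
  by (rule sum.mono_neutral_right) (use rspace_N_outside[OF assms] in auto)

text \<open>
  Both ways around the square give the sum over the positions \<open>k\<close> of the interval whose predecessor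
  along the edge lies over its tail; the terms are matched by shifting the index by \<open>step e\<close>.
\<close>

lemma chain_hom_rep_hom:
  assumes c: "chain {u..v} c"
  shows "rep_hom Q (N u v) V (\<lambda>x. chain_hom u v c)"
  unfolding rep_hom_def
proof (intro conjI ballI)
  fix x assume x: "x \<in> verts Q"
  show "linear_between (rscale (N u v)) (rscale V) (rspace (N u v) x) (rspace V x) (chain_hom u v c)"
    unfolding linear_between_def
  proof (intro conjI ballI allI)
    show "chain_hom u v c \<in> rspace (N u v) x \<rightarrow> rspace V x"
    proof
      fix f :: "int \<Rightarrow> 'k" assume f: "f \<in> rspace (N u v) x"
      have "c i \<in> rspace V x" if "i \<in> {i \<in> {u..v}. md i = x}" for i
        using c that unfolding chain_def by auto
      then show "chain_hom u v c f \<in> rspace V x"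
        unfolding chain_hom_restrict[OF f]
        by (intro subspace_sum subspace_scale) (use rep_V x in \<open>auto simp: quiver_rep_def\<close>)
    qed
  qed (simp_all add: chain_hom_def scale_left_distrib sum.distrib scale_sum_right)
next
  fix e and f :: "int \<Rightarrow> 'k" assume e: "e \<in> arcs Q" and f: "f \<in> rspace (N u v) (tail Q e)"
  have e': "md e = e" by (rule arc_md[OF e])
  let ?P = "{i \<in> {u..v}. md i = md (src e)}"
  have f': "f \<in> rspace (N u v) (md (src e))" using f tail_src[OF e] by simp
  have cP: "c i \<in> Vm (src e)" if i: "i \<in> ?P" for i
  proof -
    have "c i \<in> Vm i" using c i unfolding chain_def by blast
    then show ?thesis using i by simp
  qed
  have "Ve e (chain_hom u v c f) = (\<Sum>i\<in>?P. rscale V (f i) (Ve e (c i)))"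
    unfolding chain_hom_restrict[OF f']
    by (rule linear_between_sum[OF vector_space_axioms vector_space_axioms Ve_linear Vm_subspace cP])
  also have "\<dots> = (\<Sum>i\<in>?P. if i + step e \<in> {u..v} then rscale V (f i) (c (i + step e)) else 0)"
    by (intro sum.cong refl) (use chain_step[OF c] in auto)
  also have "\<dots> = (\<Sum>i\<in>{i \<in> ?P. i + step e \<in> {u..v}}. rscale V (f i) (c (i + step e)))"
    by (rule sum.inter_filter[symmetric]) simp
  also have "\<dots> = (\<Sum>k\<in>{k \<in> {u..v}. k - step e \<in> ?P}. rscale V (f (k - step e)) (c k))"
    by (rule sum.reindex_bij_witness[where i = "\<lambda>k. k - step e" and j = "\<lambda>i. i + step e"]) auto
  also have "\<dots> = (\<Sum>k\<in>{u..v}. rscale V (rmap (N u v) (md e) f k) (c k))"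
  proof (rule sum.mono_neutral_cong_left)
    show "\<forall>k\<in>{u..v} - {k \<in> {u..v}. k - step e \<in> ?P}. rscale V (rmap (N u v) (md e) f k) (c k) = 0"
    proof
      fix k assume k: "k \<in> {u..v} - {k \<in> {u..v}. k - step e \<in> ?P}"
      then have "f (k - step e) = 0" using rspace_N_outside[OF f', of "k - step e"] by auto
      then show "rscale V (rmap (N u v) (md e) f k) (c k) = 0" by (simp add: rmap_N_step)
    qed
  qed (auto simp: rmap_N_step)
  finally show "chain_hom u v c (rmap (N u v) e f) = rmap V e (chain_hom u v c f)"
    unfolding chain_hom_def[of u v c "rmap (N u v) e f"] e' by simp
qed

lemma cochain_hom_rep_hom:
  assumes \<gamma>: "cochain {u..v} \<gamma>"
  shows "rep_hom Q V (N u v) (cochain_hom u v \<gamma>)"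
  unfolding rep_hom_def
proof (intro conjI ballI)
  fix x assume x: "x \<in> verts Q"
  have lin: "linear_between (rscale V) (*) (rspace V x) UNIV (\<gamma> i)" if "u \<le> i" "i \<le> v" "md i = x" for i
    using \<gamma> that unfolding cochain_def by auto
  show "linear_between (rscale V) (rscale (N u v)) (rspace V x) (rspace (N u v) x) (cochain_hom u v \<gamma> x)"
    unfolding linear_between_def
  proof (intro conjI ballI allI)
    show "cochain_hom u v \<gamma> x \<in> rspace V x \<rightarrow> rspace (N u v) x"
      by (auto simp: cochain_hom_def rspace_N)
    show "cochain_hom u v \<gamma> x (a + b) = cochain_hom u v \<gamma> x a + cochain_hom u v \<gamma> x b"
      if "a \<in> rspace V x" "b \<in> rspace V x" for a b
      using lin that by (auto simp: cochain_hom_def fun_eq_iff linear_between_def)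
    show "cochain_hom u v \<gamma> x (rscale V k a) = rscale (N u v) k (cochain_hom u v \<gamma> x a)"
      if "a \<in> rspace V x" for k a
      using lin that by (auto simp: cochain_hom_def fun_eq_iff linear_between_def)
  qed
next
  fix e b assume e: "e \<in> arcs Q" and b: "b \<in> rspace V (tail Q e)"
  have e': "md e = e" by (rule arc_md[OF e])
  have b': "b \<in> Vm (src e)" using b tail_src[OF e] by simp
  show "cochain_hom u v \<gamma> (head Q e) (rmap V e b) = rmap (N u v) e (cochain_hom u v \<gamma> (tail Q e) b)"
  proof
    fix k
    have hd: "head Q e = md (src e + step e)" using head_tgt[OF e] tgt_src by simp
    have iff: "md k = md (src e + step e) \<longleftrightarrow> md (k - step e) = md (src e)"
      by (simp add: mod_eq_dvd_iff algebra_simps)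
    have rm: "rmap (N u v) e f i = (if u \<le> i \<and> i \<le> v then f (i - step e) else 0)" for f :: "int \<Rightarrow> 'k" and i
      using rmap_N_step[of u v e f i] unfolding e' .
    show "cochain_hom u v \<gamma> (head Q e) (rmap V e b) k = rmap (N u v) e (cochain_hom u v \<gamma> (tail Q e) b) k"
    proof (cases "u \<le> k \<and> k \<le> v \<and> md (k - step e) = md (src e)")
      case True
      have "\<gamma> (k - step e + step e) (Ve e b) = (if k - step e \<in> {u..v} then \<gamma> (k - step e) b else 0)"
        by (rule cochain_step[OF \<gamma> _ _ b']) (use True in auto)
      then show ?thesis using True iff e'
        unfolding cochain_hom_def hd tail_src[OF e] rm by auto
    next
      case False
      then show ?thesis using iff
        unfolding cochain_hom_def hd tail_src[OF e] rm by auto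
    qed
  qed
qed

end

section \<open>Position of chains and cochains relative to the filtration\<close>

locale cyclic_HN = cyclic_rep n fwd V +
    HN "cyclic_quiver n fwd" "euler_stability (cyclic_quiver n fwd)" V m F S
  for n :: nat and fwd :: "int \<Rightarrow> bool"
    and V :: "(int, int, 'k::field, 'b::ab_group_add) qrep"
    and m :: nat and F :: "nat \<Rightarrow> int \<Rightarrow> 'b set"
    and S :: "nat \<Rightarrow> (int, int, 'k, 'c::ab_group_add) qrep"
begin

lemma finite_chain_in_F:
  assumes c: "chain {u..v} c" and j: "j < m" and \<sigma>: "\<mu> (Suc j) < N_slope u v"
    and i: "u \<le> i" "i \<le> v"
  shows "c i \<in> F j (md i)"
proof -
  have uv: "u \<le> v" using i by simp
  have "chain_hom u v c (unitvec i) \<in> F j (md i)"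
  proof (rule hom_from_semistable[OF quiver_rep_N _ _ _ chain_hom_rep_hom[OF c] j \<sigma> md_in(1)])
    show "fd_subspace (rscale (N u v)) (rspace (N u v) x :: (int \<Rightarrow> 'k) set)" for x
      using fd_N by simp
    show "eexcess (N_slope u v) (sdim (N u v) K) \<le> 0"
      if "subrep Q (N u v) K" for K :: "int \<Rightarrow> (int \<Rightarrow> 'k) set"
      by (rule N_semistable[OF uv that])
    have "dim_at (N u v :: 'k nrep) = residue_count u v"
      by (simp add: fun_eq_iff dim_N)
    then show "eexcess (N_slope u v)
        (dim_at (N u v :: 'k nrep)) = 0"
      using excess_N[OF uv] by simp
    show "(unitvec i :: int \<Rightarrow> 'k) \<in> rspace (N u v) (md i)" by (rule unitvec_in_N[OF i])
  qed
  then show ?thesis using chain_hom_unitvec i by simp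
qed

lemma finite_cochain_vanishes:
  assumes \<gamma>: "cochain {u..v} \<gamma>" and j: "j < m" and \<sigma>: "N_slope u v < \<mu> (Suc j)"
    and i: "u \<le> i" "i \<le> v" and b: "b \<in> F (Suc j) (md i)"
  shows "\<gamma> i b = 0"
proof -
  have uv: "u \<le> v" using i by simp
  have "cochain_hom u v \<gamma> (md i) b = 0"
    by (rule hom_to_semistable[OF quiver_rep_N N_semistable[OF uv] cochain_hom_rep_hom[OF \<gamma>] j \<sigma> md_in(1) b])
  from fun_cong[OF this, of i] show ?thesis using i by (simp add: cochain_hom_def)
qed

text \<open>
  A bi-infinite chain corresponds to a homomorphism to \<open>V\<close> from an infinite-dimensional
  representation of \<open>Q\<close>, to which slopes do not apply. The subrepresentation of \<open>V\<close> formed by the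
  values of all such chains takes the place of the image.
\<close>

definition chain_values :: "int \<Rightarrow> 'b set" where
  "chain_values x = {c i | c i. chain UNIV c \<and> md i = x}"

lemma chain_values_eq:
  assumes "x \<in> verts Q"
  shows "chain_values x = {c x | c. chain UNIV c}"
proof
  show "{c x | c. chain UNIV c} \<subseteq> chain_values x"
    unfolding chain_values_def using md_id[OF assms] by blast
  show "chain_values x \<subseteq> {c x | c. chain UNIV c}"
  proof
    fix b assume "b \<in> chain_values x"
    then obtain c i where c: "chain UNIV c" "md i = x" "b = c i" unfolding chain_values_def by blast
    have "i = x + (i div int n) * int n" using c(2) by (metis add.commute div_mult_mod_eq)
    then have "b = (\<lambda>k. c (k + (i div int n) * int n)) x" using c(3) by simp
    then show "b \<in> {c x | c. chain UNIV c}"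
      using chain_UNIV_shift[OF c(1), of "i div int n"] by (intro CollectI exI conjI)
  qed
qed

lemma chain_values_subrep: "subrep Q V chain_values"
  unfolding subrep_def
proof (intro conjI ballI)
  fix x assume x: "x \<in> verts Q"
  show "subspace (chain_values x)"
    unfolding chain_values_eq[OF x]
  proof (rule subspaceI)
    show "0 \<in> {c x |c. chain UNIV c}"
      using chain_UNIV_zero by (intro CollectI exI[of _ "\<lambda>m. 0"]) simp
    show "a + b \<in> {c x |c. chain UNIV c}" if "a \<in> {c x |c. chain UNIV c}" "b \<in> {c x |c. chain UNIV c}" for a b
    proof -
      obtain c c' where "a = c x" "b = c' x" "chain UNIV c" "chain UNIV c'" using \<open>a \<in> _\<close> \<open>b \<in> _\<close> by blast
      then show ?thesis using chain_UNIV_add by (intro CollectI exI[of _ "\<lambda>m. c m + c' m"]) simp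
    qed
    show "rscale V k a \<in> {c x |c. chain UNIV c}" if "a \<in> {c x |c. chain UNIV c}" for k a
    proof -
      obtain c where "a = c x" "chain UNIV c" using \<open>a \<in> _\<close> by blast
      then show ?thesis using chain_UNIV_scale by (intro CollectI exI[of _ "\<lambda>m. rscale V k (c m)"]) simp
    qed
  qed
  show "chain_values x \<subseteq> rspace V x"
    unfolding chain_values_def chain_def by blast
next
  fix e assume e: "e \<in> arcs Q"
  show "rmap V e ` chain_values (tail Q e) \<subseteq> chain_values (head Q e)"
  proof safe
    fix b assume "b \<in> chain_values (tail Q e)"
    then obtain c i where c: "chain UNIV c" "md i = md (src e)" "b = c i"
      unfolding chain_values_def tail_src[OF e] by blast
    have "rmap V e b = c (i + step e)" using chain_step[OF c(1) _ c(2)] c(3) arc_md[OF e] by simp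
    moreover have "md (i + step e) = head Q e"
      unfolding head_tgt[OF e] tgt_src using c(2) by (metis mod_add_cong)
    ultimately show "rmap V e b \<in> chain_values (head Q e)"
      unfolding chain_values_def using c(1) by blast
  qed
qed

lemma chain_values_surj:
  assumes e: "e \<in> arcs Q"
  shows "chain_values (head Q e) \<subseteq> rmap V e ` chain_values (tail Q e)"
proof
  fix b assume "b \<in> chain_values (head Q e)"
  then obtain c k where c: "chain UNIV c" "md k = md (tgt e)" "b = c k"
    unfolding chain_values_def head_tgt[OF e] by blast
  let ?i = "k - step e"
  have i: "md ?i = md (src e)" using c(2) unfolding tgt_src by (simp add: mod_eq_dvd_iff algebra_simps)
  have "rmap V e (c ?i) = c (?i + step e)" using chain_step[OF c(1) _ i] arc_md[OF e] by simp
  moreover have "c ?i \<in> chain_values (tail Q e)"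
    unfolding chain_values_def tail_src[OF e] using c(1) i by blast
  ultimately show "b \<in> rmap V e ` chain_values (tail Q e)" using c(3) by (metis diff_add_cancel image_eqI)
qed

lemma edge_linear: "e \<in> arcs Q \<Longrightarrow> linear_between (rscale V) (rscale V) (rspace V (tail Q e)) (rspace V (head Q e)) (rmap V e)"
  using rep_V by (simp add: quiver_rep_def)

text \<open>
  On the image of the chain values in \<open>V / V\<^sub>j\<close> all edge maps are surjective, so its Euler degree is
  nonnegative, whereas all slopes of \<open>V / V\<^sub>j\<close> are negative. In the proof surjectivity is expressed by
  the relative dimensions \<open>?\<delta>\<close>, which do not increase along an edge.
\<close>

lemma infinite_chain_in_F:
  assumes c: "chain UNIV c" and j: "j < m" and \<sigma>: "\<mu> (Suc j) < 0"
  shows "c i \<in> F j (md i)"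
proof -
  have Fj: "subrep Q V (F j)" using F_subrep j by simp
  note U = chain_values_subrep
  let ?U = "plus_sub chain_values (F j)"
  have U': "subrep Q V ?U" by (rule subrep_sum[OF rep wf U Fj])
  let ?\<delta> = "\<lambda>x. sdim V ?U x - sdim V (F j) x"
  have le: "sdim V (F j) x \<le> sdim V ?U x" if x: "x \<in> verts Q" for x
  proof (rule fd_dim_mono)
    show "fd_subspace (rscale V) (?U x)" by (rule fd_subrep[OF U' x])
    show "subspace (F j x)" by (rule subrepD[OF Fj x])
    show "F j x \<subseteq> ?U x" by (rule plus_sub_ge[OF U x])
  qed
  have edge: "?\<delta> (head Q e) \<le> ?\<delta> (tail Q e)" if e: "e \<in> arcs Q" for e
  proof -
    have t: "tail Q e \<in> verts Q" and h: "head Q e \<in> verts Q"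
      using tail_in_Q[OF e] head_in_Q[OF e] .
    have Ut: "?U (tail Q e) \<subseteq> rspace V (tail Q e)" using U' t unfolding subrep_def by blast
    have Uim: "rmap V e ` ?U (tail Q e) \<subseteq> ?U (head Q e)" using U' e unfolding subrep_def by blast
    have lin: "linear_between (rscale V) (rscale V) (?U (tail Q e)) (?U (head Q e)) (rmap V e)"
      by (rule linear_between_subset[OF edge_linear[OF e] Ut Uim])
    let ?P = "{b \<in> ?U (tail Q e). rmap V e b \<in> F j (head Q e)}"
    let ?S = "{rmap V e b + a |b a. b \<in> ?U (tail Q e) \<and> a \<in> F j (head Q e)}"
    have dims: "sdim V ?U (tail Q e) + sdim V (F j) (head Q e) = dim ?P + dim ?S"
      by (rule dim_relative_rank_nullity[OF vector_space_axioms vector_space_axioms lin fd_subrep[OF U' t] fd_subrep[OF Fj h]])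
    have P_sub: "subspace ?P"
      by (rule linear_between_vimage_subspace[OF vector_space_axioms vector_space_axioms lin subrepD[OF U' t] subrepD[OF Fj h]])
    have "F j (tail Q e) \<subseteq> ?P"
      using plus_sub_ge[OF U t, of "F j"] Fj e unfolding subrep_def by blast
    then have 1: "sdim V (F j) (tail Q e) \<le> dim ?P"
      by (intro fd_dim_mono[OF fd_subset[OF fd_subrep[OF U' t] P_sub]] subrepD[OF Fj t]) auto
    have S_sub: "?S = {x + y |x y. x \<in> rmap V e ` ?U (tail Q e) \<and> y \<in> F j (head Q e)}" by blast
    have im_sub: "fd_subspace (rscale V) (rmap V e ` ?U (tail Q e))"
      by (rule fd_image[OF vector_space_axioms vector_space_axioms lin fd_subrep[OF U' t]])
    have S_fd: "fd_subspace (rscale V) ?S"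
      unfolding S_sub by (rule fd_sums[OF vector_space_axioms im_sub fd_subrep[OF Fj h]])
    have "?U (head Q e) \<subseteq> ?S"
    proof
      fix b assume "b \<in> ?U (head Q e)"
      then obtain x y where xy: "b = x + y" "x \<in> chain_values (head Q e)" "y \<in> F j (head Q e)" by blast
      then obtain z where z: "x = rmap V e z" "z \<in> chain_values (tail Q e)"
        using chain_values_surj[OF e] by blast
      have "z \<in> ?U (tail Q e)" using z(2) plus_sub_ge'[OF Fj t, of chain_values] by blast
      then show "b \<in> ?S" using xy z by blast
    qed
    then have 2: "sdim V ?U (head Q e) \<le> dim ?S"
      by (rule fd_dim_mono[OF S_fd subrepD[OF U' h]])
    show ?thesis using dims 1 2 le[OF t] le[OF h] by linarith
  qed
  have "0 \<le> edge_defect ?\<delta>"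
    unfolding edge_defect_def by (rule sum_nonneg) (use edge in fastforce)
  then have "0 \<le> euler_degree ?\<delta>" unfolding euler_degree_edges[symmetric] by simp
  then have ex: "0 \<le> eexcess 0 ?\<delta>" unfolding excess_euler by simp
  have "chain_values (md i) \<subseteq> F j (md i)"
  proof (rule contained_if_excess_positive[OF j U _ ex \<sigma> md_in(1)])
    show "?\<delta> x + sdim V (F j) x = sdim V ?U x" if "x \<in> verts Q" for x
      using le[OF that] by simp
  qed
  then show ?thesis unfolding chain_values_def using c by blast
qed

definition cochain_kernel :: "(int \<Rightarrow> 'b set) \<Rightarrow> int \<Rightarrow> 'b set" where
  "cochain_kernel B x = {b \<in> B x. \<forall>\<gamma> i. cochain UNIV \<gamma> \<longrightarrow> md i = x \<longrightarrow> \<gamma> i b = 0}"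

lemma cochain_linear:
  assumes "cochain UNIV \<gamma>"
  shows "linear_between (rscale V) (*) (Vm i) UNIV (\<gamma> i)"
  using assms unfolding cochain_def by blast

lemma cochain_kernel_subrep:
  assumes B: "subrep Q V B"
  shows "subrep Q V (cochain_kernel B)"
  unfolding subrep_def
proof (intro conjI ballI)
  fix x assume x: "x \<in> verts Q"
  have BV: "B x \<subseteq> rspace V x" and sB: "subspace (B x)" using B x by (auto simp: subrep_def)
  have l: "linear_between (rscale V) (*) (rspace V x) UNIV (\<gamma> i)" if "cochain UNIV \<gamma>" "md i = x" for \<gamma> i
    using cochain_linear[OF that(1), of i] that(2) by simp
  have vs: "vector_space ((*) :: 'k \<Rightarrow> 'k \<Rightarrow> 'k)" by unfold_locales (auto simp: algebra_simps)
  have sV: "subspace (rspace V x)" using rep_V x by (simp add: quiver_rep_def)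
  show "subspace (cochain_kernel B x)"
  proof (rule subspaceI)
    show "0 \<in> cochain_kernel B x"
      unfolding cochain_kernel_def using subspace_0[OF sB] linear_between_0[OF vector_space_axioms vs l sV] by blast
    show "a + b \<in> cochain_kernel B x" if "a \<in> cochain_kernel B x" "b \<in> cochain_kernel B x" for a b
      unfolding cochain_kernel_def
    proof (intro CollectI conjI allI impI)
      show "a + b \<in> B x" using that subspace_add[OF sB] unfolding cochain_kernel_def by blast
      fix \<gamma> i assume g: "cochain UNIV \<gamma>" "md i = x"
      have "a \<in> rspace V x" "b \<in> rspace V x" "\<gamma> i a = 0" "\<gamma> i b = 0"
        using that g BV unfolding cochain_kernel_def by auto
      then show "\<gamma> i (a + b) = 0" using l[OF g] unfolding linear_between_def by simp
    qed
    show "rscale V k a \<in> cochain_kernel B x" if "a \<in> cochain_kernel B x" for k a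
      unfolding cochain_kernel_def
    proof (intro CollectI conjI allI impI)
      show "rscale V k a \<in> B x" using that subspace_scale[OF sB] unfolding cochain_kernel_def by blast
      fix \<gamma> i assume g: "cochain UNIV \<gamma>" "md i = x"
      have "a \<in> rspace V x" "\<gamma> i a = 0"
        using that g BV unfolding cochain_kernel_def by auto
      then show "\<gamma> i (rscale V k a) = 0" using l[OF g] unfolding linear_between_def by simp
    qed
  qed
  show "cochain_kernel B x \<subseteq> rspace V x" using BV unfolding cochain_kernel_def by blast
next
  fix e assume e: "e \<in> arcs Q"
  have t: "tail Q e \<in> verts Q" using wf_digraph.tail_in_verts[OF wf_Q e] .
  show "rmap V e ` cochain_kernel B (tail Q e) \<subseteq> cochain_kernel B (head Q e)"
  proof safe
    fix b assume b: "b \<in> cochain_kernel B (tail Q e)"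
    have bB: "b \<in> B (tail Q e)" using b unfolding cochain_kernel_def by blast
    have bV: "b \<in> Vm (src e)" using bB B t tail_src[OF e] unfolding subrep_def by auto
    show "rmap V e b \<in> cochain_kernel B (head Q e)"
      unfolding cochain_kernel_def
    proof (intro CollectI conjI allI impI)
      show "rmap V e b \<in> B (head Q e)" using bB B e by (simp add: subrep_def image_subset_iff)
      fix \<gamma> k assume g: "cochain UNIV \<gamma>" "md k = head Q e"
      have i: "md (k - step e) = md (src e)"
        using g(2) unfolding head_tgt[OF e] tgt_src by (simp add: mod_eq_dvd_iff algebra_simps)
      have "\<gamma> (k - step e + step e) (Ve e b) = (if k - step e \<in> UNIV then \<gamma> (k - step e) b else 0)"
        by (rule cochain_step[OF g(1) UNIV_I i bV])
      also have "\<dots> = 0" using b g(1) i unfolding cochain_kernel_def tail_src[OF e] by simp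
      finally show "\<gamma> k (rmap V e b) = 0" using arc_md[OF e] by simp
    qed
  qed
qed

lemma cochain_kernel_inj:
  assumes B: "subrep Q V B" and e: "e \<in> arcs Q" and b: "b \<in> B (tail Q e)"
    and K: "rmap V e b \<in> cochain_kernel B (head Q e)"
  shows "b \<in> cochain_kernel B (tail Q e)"
  unfolding cochain_kernel_def
proof (intro CollectI conjI allI impI)
  have t: "tail Q e \<in> verts Q" using wf_digraph.tail_in_verts[OF wf_Q e] .
  have bV: "b \<in> Vm (src e)" using b B t tail_src[OF e] unfolding subrep_def by auto
  show "b \<in> B (tail Q e)" by (rule b)
  fix \<gamma> i assume g: "cochain UNIV \<gamma>" "md i = tail Q e"
  have i: "md i = md (src e)" using g(2) tail_src[OF e] by simp
  have "md (i + step e) = head Q e"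
    unfolding head_tgt[OF e] tgt_src using i by (metis mod_add_cong)
  then have "\<gamma> (i + step e) (rmap V e b) = 0" using K g(1) unfolding cochain_kernel_def by blast
  moreover have "\<gamma> (i + step e) (Ve e b) = (if i \<in> UNIV then \<gamma> i b else 0)"
    by (rule cochain_step[OF g(1) UNIV_I i bV])
  ultimately show "\<gamma> i b = 0" using arc_md[OF e] by simp
qed

text \<open>
  Modulo the common kernel of all cochains the edge maps are injective, so the quotient of \<open>V\<^sub>j\<^sub>+\<^sub>1\<close> by
  this kernel has Euler degree at most zero, whereas all slopes of \<open>V\<^sub>j\<^sub>+\<^sub>1\<close> are positive.
\<close>

lemma infinite_cochain_vanishes:
  assumes \<gamma>: "cochain UNIV \<gamma>" and j: "j < m" and \<sigma>: "0 < \<mu> (Suc j)"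
    and b: "b \<in> F (Suc j) (md i)"
  shows "\<gamma> i b = 0"
proof -
  let ?F = "F (Suc j)"
  have F: "subrep Q V ?F" using F_subrep j by simp
  let ?K = "cochain_kernel ?F"
  have K: "subrep Q V ?K" by (rule cochain_kernel_subrep[OF F])
  have KF: "?K x \<subseteq> ?F x" for x unfolding cochain_kernel_def by blast
  let ?\<delta> = "\<lambda>x. sdim V ?F x - sdim V ?K x"
  have le: "sdim V ?K x \<le> sdim V ?F x" if x: "x \<in> verts Q" for x
    by (rule fd_dim_mono[OF fd_subrep[OF F x] subrepD[OF K x] KF])
  have edge: "?\<delta> (tail Q e) \<le> ?\<delta> (head Q e)" if e: "e \<in> arcs Q" for e
  proof -
    have t: "tail Q e \<in> verts Q" and h: "head Q e \<in> verts Q"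
      using tail_in_Q[OF e] head_in_Q[OF e] .
    have Ft: "?F (tail Q e) \<subseteq> rspace V (tail Q e)" using F t unfolding subrep_def by blast
    have Fim: "rmap V e ` ?F (tail Q e) \<subseteq> ?F (head Q e)" using F e unfolding subrep_def by blast
    have lin: "linear_between (rscale V) (rscale V) (?F (tail Q e)) (?F (head Q e)) (rmap V e)"
      by (rule linear_between_subset[OF edge_linear[OF e] Ft Fim])
    let ?P = "{b \<in> ?F (tail Q e). rmap V e b \<in> ?K (head Q e)}"
    let ?S = "{rmap V e b + a |b a. b \<in> ?F (tail Q e) \<and> a \<in> ?K (head Q e)}"
    have dims: "sdim V ?F (tail Q e) + sdim V ?K (head Q e) = dim ?P + dim ?S"
      by (rule dim_relative_rank_nullity[OF vector_space_axioms vector_space_axioms lin fd_subrep[OF F t] fd_subrep[OF K h]])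
    have P_sub: "subspace ?P"
      by (rule linear_between_vimage_subspace[OF vector_space_axioms vector_space_axioms lin subrepD[OF F t] subrepD[OF K h]])
    have PK: "?P \<subseteq> ?K (tail Q e)" using cochain_kernel_inj[OF F e] by blast
    have 1: "dim ?P \<le> sdim V ?K (tail Q e)"
      by (rule fd_dim_mono[OF fd_subrep[OF K t] P_sub PK])
    have S_eq: "?S = {x + y |x y. x \<in> rmap V e ` ?F (tail Q e) \<and> y \<in> ?K (head Q e)}" by blast
    have S_sub: "subspace ?S"
      unfolding S_eq
      by (rule subspace_sums[OF linear_between_image_subspace[OF vector_space_axioms vector_space_axioms lin subrepD[OF F t]] subrepD[OF K h]])
    have SF: "?S \<subseteq> ?F (head Q e)"
    proof
      fix w assume "w \<in> ?S"
      then obtain b a where "w = rmap V e b + a" "b \<in> ?F (tail Q e)" "a \<in> ?K (head Q e)" by blast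
      then show "w \<in> ?F (head Q e)" using Fim KF subspace_add[OF subrepD[OF F h]] by blast
    qed
    have 2: "dim ?S \<le> sdim V ?F (head Q e)"
      by (rule fd_dim_mono[OF fd_subrep[OF F h] S_sub SF])
    show ?thesis using dims 1 2 le[OF t] le[OF h] by linarith
  qed
  have "edge_defect ?\<delta> \<le> 0"
    unfolding edge_defect_def by (rule sum_nonpos) (use edge in fastforce)
  then have "euler_degree ?\<delta> \<le> 0" unfolding euler_degree_edges[symmetric] by simp
  then have ex: "eexcess 0 ?\<delta> \<le> 0" unfolding excess_euler by simp
  have "?K (md i) = ?F (md i)"
  proof (rule all_if_excess_negative[OF j K KF _ ex \<sigma> md_in(1)])
    show "?\<delta> x + sdim V ?K x = sdim V ?F x" if "x \<in> verts Q" for x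
      using le[OF that] by simp
  qed
  then show ?thesis using b \<gamma> unfolding cochain_kernel_def by blast
qed

end

section \<open>The decomposition of the lift\<close>

type_synonym lift_index = "nat + int \<times> int extended \<times> int \<times> nat"

definition lift_indices :: "nat \<Rightarrow> nat \<Rightarrow> (int \<Rightarrow> int extended \<Rightarrow> nat) \<Rightarrow> lift_index set" where
  "lift_indices n dinf d = {..<dinf} <+> {(u, v, c, k). u \<in> {0..<int n} \<and> Fin u \<le> v \<and> k < d u v}"

definition lift_summand :: "nat \<Rightarrow> (int \<Rightarrow> bool) \<Rightarrow> lift_index \<Rightarrow> (int, int \<times> int, 'k::field, 'k) qrep" where
  "lift_summand n fwd = case_sum (\<lambda>k. I_rep n fwd Minf Pinf)
     (\<lambda>(u, v, c, k). I_rep n fwd (Fin (u + c * int n)) (v + Fin (c * int n)))"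

locale lift_iso = cyclic_rep n fwd V
  for n :: nat and fwd :: "int \<Rightarrow> bool"
    and V :: "(int, int, 'k::field, 'b::ab_group_add) qrep" +
  fixes dinf :: nat and d :: "int \<Rightarrow> int extended \<Rightarrow> nat"
    and \<phi> :: "int \<Rightarrow> 'b \<Rightarrow> lift_index \<Rightarrow> 'k"
  assumes hom: "rep_hom (unwinding n fwd) (lift_rep n V)
      (rep_sum (lift_indices n dinf d) (lift_summand n fwd)) \<phi>"
    and bij: "bij_betw (\<phi> x) (rspace (lift_rep n V) x)
      (rspace (rep_sum (lift_indices n dinf d) (lift_summand n fwd)) x)"
begin

interpretation vector_space "rscale V"
  using rep_V by (simp add: quiver_rep_def)

abbreviation index_set :: "lift_index set" where "index_set \<equiv> lift_indices n dinf d"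

definition interval :: "lift_index \<Rightarrow> int set" where
  "interval = case_sum (\<lambda>k. UNIV)
     (\<lambda>(u, v, c, k). {m. Fin (u + c * int n) \<le> Fin m \<and> Fin m \<le> v + Fin (c * int n)})"

lemma lift_summand_simps:
  "rscale (lift_summand n fwd i :: 'k liftrep) = (*)"
  "rspace (lift_summand n fwd i :: 'k liftrep) x = (if x \<in> interval i then UNIV else {0})"
  "rmap (lift_summand n fwd i :: 'k liftrep) (md y, y div int n) b =
    (if src y \<in> interval i \<and> tgt y \<in> interval i then b else 0)"
proof -
  have tl: "tail (unwinding n fwd) (md y, y div int n) = src y"
    and hd: "head (unwinding n fwd) (md y, y div int n) = tgt y"
    by (simp_all add: unwinding_def src_def tgt_def)
  show "rscale (lift_summand n fwd i :: 'k liftrep) = (*)"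
    by (cases i) (auto simp: lift_summand_def I_rep_def)
  show "rspace (lift_summand n fwd i :: 'k liftrep) x = (if x \<in> interval i then UNIV else {0})"
    by (cases i) (auto simp: lift_summand_def I_rep_def interval_def split: if_splits)
  show "rmap (lift_summand n fwd i :: 'k liftrep) (md y, y div int n) b =
    (if src y \<in> interval i \<and> tgt y \<in> interval i then b else 0)"
    by (cases i) (auto simp: lift_summand_def I_rep_def interval_def tl hd split: if_splits)
qed

abbreviation W :: "(int, int \<times> int, 'k, lift_index \<Rightarrow> 'k) qrep" where
  "W \<equiv> rep_sum index_set (lift_summand n fwd)"

lemma rspace_W: "f \<in> rspace W x \<longleftrightarrow>
    finite {i. f i \<noteq> 0} \<and> (\<forall>i. f i \<noteq> 0 \<longrightarrow> i \<in> index_set \<and> x \<in> interval i)"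
  unfolding rep_sum_def by (auto simp: lift_summand_simps(2))

lemma \<phi>_linear: "linear_between (rscale V) (\<lambda>k f i. k * f i) (Vm x) (rspace W x) (\<phi> x)"
proof -
  have "linear_between (rscale V) (rscale W) (Vm x) (rspace W x) (\<phi> x)"
    using hom unfolding rep_hom_def by (simp add: unwinding_def lift_rep_def)
  moreover have "rscale W = (\<lambda>k f i. k * f i)"
    by (simp add: rep_sum_def lift_summand_simps(1))
  ultimately show ?thesis by simp
qed

lemma \<phi>_in: "b \<in> Vm x \<Longrightarrow> \<phi> x b \<in> rspace W x"
  using \<phi>_linear[of x] unfolding linear_between_def by blast

lemma \<phi>_bij: "bij_betw (\<phi> x) (Vm x) (rspace W x)"
  using bij by (simp add: lift_rep_def)

lemma \<phi>_inj: "a \<in> Vm x \<Longrightarrow> b \<in> Vm x \<Longrightarrow> \<phi> x a = \<phi> x b \<Longrightarrow> a = b"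
  using \<phi>_bij by (auto simp: bij_betw_def inj_on_def)

lemma \<phi>_outside: "b \<in> Vm x \<Longrightarrow> \<not> (i \<in> index_set \<and> x \<in> interval i) \<Longrightarrow> \<phi> x b i = 0"
  using \<phi>_in rspace_W by blast

lemma \<phi>_edge:
  assumes "b \<in> Vm (src y)"
  shows "\<phi> (tgt y) (Ve y b) i =
    (if i \<in> index_set \<and> src y \<in> interval i \<and> tgt y \<in> interval i then \<phi> (src y) b i else 0)"
proof -
  let ?e = "(md y, y div int n)"
  have tl: "tail (unwinding n fwd) ?e = src y" and hd: "head (unwinding n fwd) ?e = tgt y"
    by (simp_all add: unwinding_def src_def tgt_def)
  have "?e \<in> arcs (unwinding n fwd)" using n_pos by (simp add: unwinding_def)
  then have "\<forall>b\<in>rspace (lift_rep n V) (src y). \<phi> (tgt y) (rmap (lift_rep n V) ?e b) = rmap W ?e (\<phi> (src y) b)"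
    using hom tl hd unfolding rep_hom_def by metis
  then have "\<phi> (tgt y) (Ve y b) = rmap W ?e (\<phi> (src y) b)"
    using assms by (simp add: lift_rep_def)
  then show ?thesis by (simp add: rep_sum_def lift_summand_simps(3))
qed

lemma \<phi>_cochain:
  assumes "i \<in> index_set"
  shows "cochain (interval i) (\<lambda>x b. \<phi> x b i)"
  unfolding cochain_def
proof (intro conjI ballI allI impI)
  fix x show "linear_between (rscale V) (*) (Vm x) UNIV (\<lambda>b. \<phi> x b i)"
    using \<phi>_linear[of x] unfolding linear_between_def by auto
next
  fix y b assume "tgt y \<in> interval i" "b \<in> Vm (src y)"
  then show "\<phi> (tgt y) (Ve y b) i = (if src y \<in> interval i then \<phi> (src y) b i else 0)"
    using \<phi>_edge assms by simp
qed

definition unit_coordinate :: "lift_index \<Rightarrow> lift_index \<Rightarrow> 'k" where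
  "unit_coordinate i = (\<lambda>i'. if i' = i then 1 else 0)"

definition lifted_basis :: "lift_index \<Rightarrow> int \<Rightarrow> 'b" where
  "lifted_basis i x = inv_into (Vm x) (\<phi> x) (unit_coordinate i)"

lemma lifted_basis:
  assumes "i \<in> index_set" "x \<in> interval i"
  shows "lifted_basis i x \<in> Vm x" "\<phi> x (lifted_basis i x) = unit_coordinate i"
proof -
  have "unit_coordinate i \<in> rspace W x"
    unfolding rspace_W using assms by (auto simp: unit_coordinate_def)
  then have "unit_coordinate i \<in> \<phi> x ` Vm x" using \<phi>_bij by (auto simp: bij_betw_def)
  then show "lifted_basis i x \<in> Vm x" "\<phi> x (lifted_basis i x) = unit_coordinate i"
    unfolding lifted_basis_def by (rule inv_into_into, rule f_inv_into_f)
qed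

lemma vector_space_fun: "vector_space (\<lambda>k (f :: lift_index \<Rightarrow> 'k) i. k * f i)"
  by unfold_locales (auto simp: algebra_simps fun_eq_iff)

lemma \<phi>_0: "\<phi> x 0 = 0"
  by (rule linear_between_0[OF vector_space_axioms vector_space_fun \<phi>_linear Vm_subspace])

text \<open>
  The chain condition can be tested on coordinates, where it is the definition of the edge maps of the
  summands.
\<close>

lemma lifted_basis_chain:
  assumes i: "i \<in> index_set"
  shows "chain (interval i) (lifted_basis i)"
  unfolding chain_def
proof (intro conjI ballI allI impI)
  show "lifted_basis i x \<in> Vm x" if "x \<in> interval i" for x using lifted_basis(1)[OF i that] .
  fix y assume s: "src y \<in> interval i"
  note b = lifted_basis[OF i s]
  have l: "Ve y (lifted_basis i (src y)) \<in> Vm (tgt y)" using b(1) Ve_linear unfolding linear_between_def by blast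
  have r: "(if tgt y \<in> interval i then lifted_basis i (tgt y) else 0) \<in> Vm (tgt y)"
    using lifted_basis(1)[OF i] subspace_0[OF Vm_subspace] by simp
  show "Ve y (lifted_basis i (src y)) = (if tgt y \<in> interval i then lifted_basis i (tgt y) else 0)"
  proof (rule \<phi>_inj[OF l r])
    show "\<phi> (tgt y) (Ve y (lifted_basis i (src y))) = \<phi> (tgt y) (if tgt y \<in> interval i then lifted_basis i (tgt y) else 0)"
    proof
      fix i'
      show "\<phi> (tgt y) (Ve y (lifted_basis i (src y))) i' = \<phi> (tgt y) (if tgt y \<in> interval i then lifted_basis i (tgt y) else 0) i'"
        using \<phi>_edge[OF b(1), of i'] b(2) lifted_basis(2)[OF i, of "tgt y"] \<phi>_0 i s
        by (auto simp: unit_coordinate_def)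
    qed
  qed
qed

definition indices_at :: "int \<Rightarrow> lift_index set" where
  "indices_at x = {i \<in> index_set. x \<in> interval i}"

text \<open>
  Applied to the steps of the filtration: a subspace that contains the basis vectors of the summands
  in \<open>P\<close> and on which all other coordinates vanish is spanned by these basis vectors.
\<close>

lemma dim_card_indices:
  assumes P: "finite P" "P \<subseteq> indices_at x" and U: "subspace U" "U \<subseteq> Vm x"
    and b: "\<And>i. i \<in> P \<Longrightarrow> lifted_basis i x \<in> U"
    and c: "\<And>b i. b \<in> U \<Longrightarrow> i \<in> indices_at x \<Longrightarrow> i \<notin> P \<Longrightarrow> \<phi> x b i = 0"
  shows "dim U = card P"
proof -
  have PI: "i \<in> index_set" "x \<in> interval i" if "i \<in> P" for i using P that by (auto simp: indices_at_def)
  have \<phi>_sum: "\<phi> x (\<Sum>i\<in>P. rscale V (a i) (lifted_basis i x)) = (\<lambda>i'. if i' \<in> P then a i' else 0)" for a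
  proof
    fix i'
    have "\<phi> x (\<Sum>i\<in>P. rscale V (a i) (lifted_basis i x)) = (\<Sum>i\<in>P. (\<lambda>i'. a i * \<phi> x (lifted_basis i x) i'))"
      by (rule linear_between_sum[OF vector_space_axioms vector_space_fun \<phi>_linear Vm_subspace])
        (use b U in blast)
    also have "\<dots> = (\<Sum>i\<in>P. (\<lambda>i'. a i * unit_coordinate i i'))"
      by (intro sum.cong refl) (use lifted_basis(2) PI in simp)
    finally have "\<phi> x (\<Sum>i\<in>P. rscale V (a i) (lifted_basis i x)) i' = (\<Sum>i\<in>P. (\<lambda>i'. a i * unit_coordinate i i')) i'" by simp
    also have "\<dots> = (\<Sum>i\<in>P. a i * unit_coordinate i i')" by (induction P rule: infinite_finite_induct) auto
    also have "\<dots> = (\<Sum>i\<in>P. if i' = i then a i else 0)" by (intro sum.cong refl) (simp add: unit_coordinate_def)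
    also have "\<dots> = (if i' \<in> P then a i' else 0)" using P by simp
    finally show "\<phi> x (\<Sum>i\<in>P. rscale V (a i) (lifted_basis i x)) i' = (if i' \<in> P then a i' else 0)" .
  qed
  show ?thesis
  proof (rule dim_eq_card_family[where e = "\<lambda>i. lifted_basis i x", OF P(1) U(1) b])
    fix w assume w: "w \<in> U"
    have "w = (\<Sum>i\<in>P. rscale V (\<phi> x w i) (lifted_basis i x))"
    proof (rule \<phi>_inj)
      show "w \<in> Vm x" using w U by blast
      show "(\<Sum>i\<in>P. rscale V (\<phi> x w i) (lifted_basis i x)) \<in> Vm x"
        by (intro subspace_sum subspace_scale Vm_subspace) (use b U in blast)
      show "\<phi> x w = \<phi> x (\<Sum>i\<in>P. rscale V (\<phi> x w i) (lifted_basis i x))"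
        unfolding \<phi>_sum
      proof
        fix i show "\<phi> x w i = (if i \<in> P then \<phi> x w i else 0)"
          using c[OF w, of i] \<phi>_outside[of w x i] w U unfolding indices_at_def by auto
      qed
    qed
    then show "\<exists>a. w = (\<Sum>i\<in>P. rscale V (a i) (lifted_basis i x))" by blast
  next
    fix a i assume "(\<Sum>i\<in>P. rscale V (a i) (lifted_basis i x)) = 0" "i \<in> P"
    then show "a i = 0" using fun_cong[OF \<phi>_sum[of a], of i] \<phi>_0 by simp
  qed
qed

text \<open>
  A finite set \<open>P\<close> of summands alive at \<open>x\<close> indexes a basis of the subspace on which all other
  coordinates vanish, so \<open>card P\<close> is bounded by the dimension of the space over \<open>x\<close>.
\<close>

lemma finite_indices_at: "finite (indices_at x)"
proof (rule ccontr)
  assume "infinite (indices_at x)"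
  then obtain P where P: "finite P" "card P = Suc (dim (Vm x))" "P \<subseteq> indices_at x"
    using infinite_arbitrarily_large by blast
  let ?U = "{b \<in> Vm x. \<phi> x b \<in> {f. \<forall>i\<in>indices_at x - P. f i = 0}}"
  have U: "subspace ?U"
  proof (rule linear_between_vimage_subspace[OF vector_space_axioms vector_space_fun \<phi>_linear Vm_subspace])
    interpret f: vector_space "\<lambda>k (f :: lift_index \<Rightarrow> 'k) i. k * f i" by (rule vector_space_fun)
    show "f.subspace {f. \<forall>i\<in>indices_at x - P. f i = 0}" by (rule f.subspaceI) auto
  qed
  have "dim ?U = card P"
  proof (rule dim_card_indices[OF P(1,3) U])
    fix i assume i: "i \<in> P"
    then have "i \<in> index_set" "x \<in> interval i" using P by (auto simp: indices_at_def)
    then show "lifted_basis i x \<in> ?U" using lifted_basis i by (auto simp: unit_coordinate_def)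
  qed auto
  moreover have "dim ?U \<le> dim (Vm x)"
    by (rule fd_dim_mono[OF fd_V[OF md_in(1)] U]) auto
  ultimately show False using P(2) by simp
qed

text \<open>
  All translates of a ray \<open>[u,\<infinity>]\<close> to the left contain the vertex 0.
\<close>

lemma no_rays:
  assumes "u \<in> {0..<int n}"
  shows "d u Pinf = 0"
proof (rule ccontr)
  assume "d u Pinf \<noteq> 0"
  let ?f = "\<lambda>a :: nat. Inr (u, Pinf, - 1 - int a, 0) :: lift_index"
  have "?f a \<in> indices_at 0" for a
  proof -
    have "u + (- 1 - int a) * int n \<le> 0"
    proof -
      have "(- 1 - int a) * int n \<le> - 1 * int n" by (rule mult_right_mono) auto
      then show ?thesis using assms by simp
    qed
    then show ?thesis using assms \<open>d u Pinf \<noteq> 0\<close>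
      by (auto simp: indices_at_def lift_indices_def interval_def Plus_def)
  qed
  then have "range ?f \<subseteq> indices_at 0" by blast
  moreover have "inj ?f" by (rule injI) simp
  ultimately show False using finite_indices_at[of 0] finite_subset infinite_UNIV_nat finite_imageD by metis
qed

text \<open>
  The value at rays is arbitrary, since \<open>no_rays\<close> excludes them; at \<open>I[-\<infinity>,\<infinity>]\<close> it is the slope that
  \<open>infinite_chain_in_F\<close> and \<open>infinite_cochain_vanishes\<close> assign to bi-infinite intervals.
\<close>

definition index_slope :: "lift_index \<Rightarrow> real" where
  "index_slope = case_sum (\<lambda>k. 0) (\<lambda>(u, v, c, k). case v of Fin w \<Rightarrow> N_slope u w | _ \<Rightarrow> 0)"

lemma index_set_cases:
  assumes "i \<in> index_set"
  obtains (inf) k where "i = Inl k" "k < dinf" "interval i = UNIV" "index_slope i = 0"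
  | (fin) u w c k where "i = Inr (u, Fin w, c, k)" "u \<in> {0..<int n}" "u \<le> w" "k < d u (Fin w)"
      "interval i = {u + c * int n..w + c * int n}" "index_slope i = N_slope (u + c * int n) (w + c * int n)"
proof (cases i)
  case (Inl k)
  then show ?thesis using assms inf[of k] by (auto simp: lift_indices_def interval_def index_slope_def)
next
  case (Inr t)
  obtain u v c k where t: "t = (u, v, c, k)" by (cases t)
  have m: "u \<in> {0..<int n}" "Fin u \<le> v" "k < d u v"
    using assms unfolding Inr t lift_indices_def by auto
  show ?thesis
  proof (cases v)
    case (Fin w)
    have s: "w + c * int n + 1 = w + 1 + c * int n" by simp
    have "N_slope (u + c * int n) (w + c * int n) = N_slope u w"
      unfolding N_slope_def s by (simp add: arc_sign_def)
    then show ?thesis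
      by (intro fin[of u w c k]) (use m in \<open>auto simp: Inr t Fin interval_def index_slope_def\<close>)
  next
    case Pinf
    then show ?thesis using no_rays[OF m(1)] m by simp
  next
    case Minf
    then show ?thesis using m by simp
  qed
qed

text \<open>
  The translates of \<open>[u,w]\<close> through \<open>x\<close> correspond to the positions of \<open>[u,w]\<close> over \<open>x\<close>, which
  number the dimension of \<open>N[u,w]\<close> at \<open>x\<close>.
\<close>

lemma card_lifts:
  assumes x: "x \<in> verts Q"
  shows "card {c. u + c * int n \<le> x \<and> x \<le> w + c * int n} = residue_count u w x"
  unfolding residue_count_def
proof (rule bij_betw_same_card, rule bij_betw_byWitness[where f' = "\<lambda>m. (x - m) div int n"])
  let ?f = "\<lambda>c. x - c * int n"
  show "\<forall>c\<in>{c. u + c * int n \<le> x \<and> x \<le> w + c * int n}. (x - ?f c) div int n = c"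
    using n_pos by simp
  have *: "(x - m) div int n * int n = x - m" if "md m = x" for m
  proof -
    have "int n dvd x - m" using that md_id[OF x] by (metis mod_eq_dvd_iff)
    then show ?thesis by simp
  qed
  then show "\<forall>m\<in>{m \<in> {u..w}. md m = x}. ?f ((x - m) div int n) = m" by simp
  have "md (x - c * int n) = x" for c using md_id[OF x] mod_mult_self1[of x "- c" "int n"] by simp
  then show "?f ` {c. u + c * int n \<le> x \<and> x \<le> w + c * int n} \<subseteq> {m \<in> {u..w}. md m = x}" by auto
  show "(\<lambda>m. (x - m) div int n) ` {m \<in> {u..w}. md m = x} \<subseteq> {c. u + c * int n \<le> x \<and> x \<le> w + c * int n}"
    using * by auto
qed

text \<open>
  The set \<open>A\<close> may contain pairs of multiplicity zero, so that it can later be chosen among the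
  summands of an arbitrary decomposition of \<open>V\<close>.
\<close>

lemma card_indices_slope:
  assumes x: "x \<in> verts Q" and A: "finite A"
    "\<And>u w. (u, w) \<in> A \<Longrightarrow> u \<in> {0..<int n} \<and> u \<le> w \<and> N_slope u w = \<nu>"
    "\<And>u w. u \<in> {0..<int n} \<Longrightarrow> u \<le> w \<Longrightarrow> N_slope u w = \<nu> \<Longrightarrow> d u (Fin w) > 0 \<Longrightarrow> (u, w) \<in> A"
  shows "card {i \<in> indices_at x. index_slope i = \<nu>} =
    (if \<nu> = 0 then dinf else 0) + (\<Sum>(u, w)\<in>A. d u (Fin w) * residue_count u w x)"
proof -
  let ?L = "{i \<in> indices_at x. index_slope i = \<nu>}"
  let ?C = "\<lambda>(u, w). {c. u + c * int n \<le> x \<and> x \<le> w + c * int n} \<times> {..<d u (Fin w)}"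
  let ?I = "(if \<nu> = 0 then Inl ` {..<dinf} else {}) :: lift_index set"
  let ?f = "\<lambda>((u, w), (c, k)). Inr (u, Fin w, c, k) :: lift_index"
  let ?B = "?f ` (SIGMA p:A. ?C p)"
  have L: "?L = ?I \<union> ?B"
  proof (intro subset_antisym subsetI)
    fix i assume i: "i \<in> ?L"
    then have "i \<in> index_set" by (simp add: indices_at_def)
    then show "i \<in> ?I \<union> ?B"
    proof (cases rule: index_set_cases)
      case (inf k)
      then show ?thesis using i by auto
    next
      case (fin u w c k)
      have "N_slope u w = \<nu>" using i fin(1) by (simp add: index_slope_def)
      then have "(u, w) \<in> A" using A(3) fin by auto
      moreover have "(c, k) \<in> ?C (u, w)" using i fin by (auto simp: indices_at_def)
      ultimately have "((u, w), (c, k)) \<in> (SIGMA p:A. ?C p)" by blast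
      then have "?f ((u, w), (c, k)) \<in> ?B" by (rule imageI)
      then show ?thesis using fin(1) by simp
    qed
  next
    fix i assume "i \<in> ?I \<union> ?B"
    then show "i \<in> ?L"
    proof
      assume "i \<in> ?I"
      then show ?thesis
        by (auto simp: indices_at_def lift_indices_def interval_def index_slope_def Plus_def split: if_splits)
    next
      assume "i \<in> ?B"
      then obtain u w c k where i: "i = Inr (u, Fin w, c, k)" "(u, w) \<in> A" "(c, k) \<in> ?C (u, w)" by auto
      then show ?thesis using A(2)[OF i(2)]
        by (auto simp: indices_at_def lift_indices_def interval_def index_slope_def Plus_def)
    qed
  qed
  have "finite ?L" using finite_indices_at by simp
  then have "finite ?I" "finite ?B" unfolding L by simp_all
  then have "card ?L = card ?I + card ?B"
    unfolding L by (rule card_Un_disjoint) auto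
  moreover have "card ?I = (if \<nu> = 0 then dinf else 0)" by (simp add: card_image)
  moreover have "card ?B = card (SIGMA p:A. ?C p)"
    by (rule card_image) (auto simp: inj_on_def)
  moreover have "card (SIGMA p:A. ?C p) = (\<Sum>p\<in>A. card (?C p))"
  proof (rule card_SigmaI[OF A(1)])
    have "finite {c. u + c * int n \<le> x \<and> x \<le> w + c * int n}" for u w
    proof (rule finite_subset)
      show "{c. u + c * int n \<le> x \<and> x \<le> w + c * int n} \<subseteq> (\<lambda>m. (x - m) div int n) ` {u..w}"
      proof
        fix c assume "c \<in> {c. u + c * int n \<le> x \<and> x \<le> w + c * int n}"
        then have "c = (x - (x - c * int n)) div int n" "x - c * int n \<in> {u..w}" using n_pos by auto
        then show "c \<in> (\<lambda>m. (x - m) div int n) ` {u..w}" by (rule image_eqI)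
      qed
    qed simp
    then show "\<forall>p\<in>A. finite (?C p)" by auto
  qed
  moreover have "(\<Sum>p\<in>A. card (?C p)) = (\<Sum>(u, w)\<in>A. d u (Fin w) * residue_count u w x)"
    by (rule sum.cong) (auto simp: card_cartesian_product card_lifts[OF x])
  ultimately show ?thesis by simp
qed

end

section \<open>Dimensions of the successive quotients\<close>

locale lift_HN = lift_iso n fwd V dinf d \<phi> + cyclic_HN n fwd V m F S
  for n :: nat and fwd :: "int \<Rightarrow> bool"
    and V :: "(int, int, 'k::field, 'b::ab_group_add) qrep"
    and dinf :: nat and d :: "int \<Rightarrow> int extended \<Rightarrow> nat"
    and \<phi> :: "int \<Rightarrow> 'b \<Rightarrow> lift_index \<Rightarrow> 'k"
    and m :: nat and F :: "nat \<Rightarrow> int \<Rightarrow> 'b set"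
    and S :: "nat \<Rightarrow> (int, int, 'k, 'c::ab_group_add) qrep"
begin

lemma lifted_basis_in_F:
  assumes i: "i \<in> indices_at x" and j: "j < m" and \<sigma>: "\<mu> (Suc j) < index_slope i"
  shows "lifted_basis i x \<in> F j (md x)"
proof -
  have iI: "i \<in> index_set" and x: "x \<in> interval i" using i by (auto simp: indices_at_def)
  from iI show ?thesis
  proof (cases rule: index_set_cases)
    case (inf k)
    then show ?thesis using infinite_chain_in_F[of "lifted_basis i" j x] lifted_basis_chain[OF iI] j \<sigma> by simp
  next
    case (fin u w c k)
    have "chain {u + c * int n..w + c * int n} (lifted_basis i)" using lifted_basis_chain[OF iI] fin(5) by simp
    then show ?thesis by (rule finite_chain_in_F[OF _ j]) (use \<sigma> x fin in auto)
  qed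
qed

lemma coordinate_vanishes_on_F:
  assumes i: "i \<in> indices_at x" and j: "j < m" and \<sigma>: "index_slope i < \<mu> (Suc j)"
    and b: "b \<in> F (Suc j) (md x)"
  shows "\<phi> x b i = 0"
proof -
  have iI: "i \<in> index_set" and x: "x \<in> interval i" using i by (auto simp: indices_at_def)
  from iI show ?thesis
  proof (cases rule: index_set_cases)
    case (inf k)
    then show ?thesis
      using infinite_cochain_vanishes[of "\<lambda>x b. \<phi> x b i" j b x] \<phi>_cochain[OF iI] j \<sigma> b by simp
  next
    case (fin u w c k)
    have "cochain {u + c * int n..w + c * int n} (\<lambda>x b. \<phi> x b i)" using \<phi>_cochain[OF iI] fin(5) by simp
    from finite_cochain_vanishes[OF this j, of x b] show ?thesis using \<sigma> x fin b by auto
  qed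
qed

text \<open>
  Slopes equal to \<open>\<mu>\<^sub>j\<^sub>+\<^sub>1\<close> are covered by passing to the next step, whose slope is strictly smaller; at the
  last step there is nothing to show because it is all of \<open>V\<close>.
\<close>

lemma dim_F_Suc:
  assumes j: "j < m"
  shows "sdim V (F (Suc j)) (md x) = card {i \<in> indices_at x. \<mu> (Suc j) \<le> index_slope i}"
proof (rule dim_card_indices)
  have F: "subrep Q V (F (Suc j))" using F_subrep j by simp
  show "finite {i \<in> indices_at x. \<mu> (Suc j) \<le> index_slope i}" using finite_indices_at by simp
  show "subspace (F (Suc j) (md x))" by (rule subrepD[OF F md_in(1)])
  show "F (Suc j) (md x) \<subseteq> Vm x" using F md_in(1) unfolding subrep_def by blast
  show "\<phi> x b i = 0" if "b \<in> F (Suc j) (md x)" "i \<in> indices_at x"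
      "i \<notin> {i \<in> indices_at x. \<mu> (Suc j) \<le> index_slope i}" for b i
    by (rule coordinate_vanishes_on_F[OF that(2) j _ that(1)]) (use that in auto)
  show "lifted_basis i x \<in> F (Suc j) (md x)" if i: "i \<in> {i \<in> indices_at x. \<mu> (Suc j) \<le> index_slope i}" for i
  proof (cases "Suc j = m")
    case True
    then show ?thesis using lifted_basis(1)[of i x] i F_m[OF md_in(1)] by (simp add: indices_at_def)
  next
    case False
    then have j': "Suc j < m" using j by simp
    show ?thesis
      by (rule lifted_basis_in_F[OF _ j']) (use i slope_less[of "Suc j"] j' in auto)
  qed
qed auto

text \<open>
  Here slopes equal to \<open>\<mu>\<^sub>j\<^sub>+\<^sub>1\<close> are covered by the previous slope, which is strictly larger; at the first
  step there is nothing to show because it is zero.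
\<close>

lemma dim_F:
  assumes j: "j < m"
  shows "sdim V (F j) (md x) = card {i \<in> indices_at x. \<mu> (Suc j) < index_slope i}"
proof (rule dim_card_indices)
  have F: "subrep Q V (F j)" using F_subrep j by simp
  show "finite {i \<in> indices_at x. \<mu> (Suc j) < index_slope i}" using finite_indices_at by simp
  show "subspace (F j (md x))" by (rule subrepD[OF F md_in(1)])
  show "F j (md x) \<subseteq> Vm x" using F md_in(1) unfolding subrep_def by blast
  show "lifted_basis i x \<in> F j (md x)" if i: "i \<in> {i \<in> indices_at x. \<mu> (Suc j) < index_slope i}" for i
    by (rule lifted_basis_in_F[OF _ j]) (use i in auto)
  show "\<phi> x b i = 0" if b: "b \<in> F j (md x)" and i: "i \<in> indices_at x"
      "i \<notin> {i \<in> indices_at x. \<mu> (Suc j) < index_slope i}" for b i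
  proof (cases j)
    case 0
    then have "b = 0" using b F_0[OF md_in(1)] by simp
    then show ?thesis using \<phi>_0 by simp
  next
    case (Suc k)
    show ?thesis
    proof (rule coordinate_vanishes_on_F[OF i(1), of k])
      show "k < m" using Suc j by simp
      show "index_slope i < \<mu> (Suc k)" using i slope_less[of j] j Suc by auto
      show "b \<in> F (Suc k) (md x)" using b Suc by simp
    qed
  qed
qed auto

lemma dim_quotient:
  assumes j: "j < m" and x: "x \<in> verts Q"
  shows "dim_at (S (Suc j)) x = card {i \<in> indices_at x. index_slope i = \<mu> (Suc j)}"
proof -
  let ?A = "{i \<in> indices_at x. \<mu> (Suc j) < index_slope i}"
  let ?B = "{i \<in> indices_at x. index_slope i = \<mu> (Suc j)}"
  have "card (?A \<union> ?B) = card ?A + card ?B"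
    by (rule card_Un_disjoint) (use finite_indices_at[of x] in auto)
  moreover have "?A \<union> ?B = {i \<in> indices_at x. \<mu> (Suc j) \<le> index_slope i}" by auto
  ultimately show ?thesis
    using dim_S[OF j x] dim_F[OF j, of x] dim_F_Suc[OF j, of x] md_id[OF x] by simp
qed

end

section \<open>Endomorphisms of \<open>N[u,v]\<close>\<close>

lemma sum_fun_apply: "(\<Sum>a\<in>A. f a) i = (\<Sum>a\<in>A. f a i)"
  by (induction A rule: infinite_finite_induct) auto

context cyclic
begin

context
  fixes u v :: int and h :: "int \<Rightarrow> (int \<Rightarrow> 'k::field) \<Rightarrow> int \<Rightarrow> 'k"
  assumes uv: "u \<le> v" and h: "rep_hom Q (N u v) (N u v) h"
begin

definition coef :: "int \<Rightarrow> int \<Rightarrow> 'k" where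
  "coef i k = h (md k) (unitvec k) i"

lemma endo_linear: "linear_between scaleN scaleN (rspace (N u v) (md x)) (rspace (N u v) (md x)) (h (md x))"
  using h md_in(1)[of x] unfolding rep_hom_def by simp

lemma endo_edge:
  assumes "f \<in> rspace (N u v) (md (src e))"
  shows "h (md (tgt e)) (rmap (N u v) (md e) f) = rmap (N u v) (md e) (h (md (src e)) f)"
  using h md_in(2)[of e] assms unfolding rep_hom_def by (metis tail_md head_md)

lemma endo_0: "h (md x) 0 = 0"
  by (rule linear_between_0[OF vector_space_scaleN vector_space_scaleN endo_linear subspace_N])

text \<open>
  Translating along an edge: the maps of \<open>N[u,v]\<close> identify neighbouring basis vectors, and the
  endomorphism commutes with them.
\<close>

lemma coef_diagonal:
  assumes "u \<le> k" "k < v" "u \<le> i" "i < v" "md i = md k"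
  shows "coef (i + 1) (k + 1) = coef i k"
proof (cases "fwd (md (k + 1))")
  case True
  have "rmap (N u v) (md (k + 1)) (unitvec k) = (unitvec (k + 1) :: int \<Rightarrow> 'k)"
    using True assms by (auto simp: rmap_N fun_eq_iff unitvec_def)
  moreover have "(unitvec k :: int \<Rightarrow> 'k) \<in> rspace (N u v) (md (src (k + 1)))"
    using True unitvec_in_N[of u k v] assms by (simp add: src_def)
  ultimately have "h (md (k + 1)) (unitvec (k + 1)) = rmap (N u v) (md (k + 1)) (h (md k) (unitvec k))"
    using endo_edge[of "unitvec k" "k + 1"] True by (simp add: src_def tgt_def)
  then show ?thesis unfolding coef_def using True assms by (simp add: rmap_N)
next
  case False
  have "rmap (N u v) (md (k + 1)) (unitvec (k + 1)) = (unitvec k :: int \<Rightarrow> 'k)"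
    using False assms by (auto simp: rmap_N fun_eq_iff unitvec_def)
  moreover have "(unitvec (k + 1) :: int \<Rightarrow> 'k) \<in> rspace (N u v) (md (src (k + 1)))"
    using False unitvec_in_N[of u "k + 1" v] assms by (simp add: src_def)
  ultimately have "h (md k) (unitvec k) = rmap (N u v) (md (k + 1)) (h (md (k + 1)) (unitvec (k + 1)))"
    using endo_edge[of "unitvec (k + 1)" "k + 1"] False by (simp add: src_def tgt_def)
  then show ?thesis unfolding coef_def using False assms by (simp add: rmap_N)
qed

lemma coef_main_diagonal:
  assumes "u \<le> k" "k \<le> v"
  shows "coef k k = coef u u"
  using assms
proof (induction k rule: int_ge_induct)
  case (step k)
  then show ?case using coef_diagonal[of k k] by simp
qed simp

text \<open>
  If the edge at \<open>u\<close> leaves the interval, it kills the basis vector at \<open>u\<close>, but no basis vector of the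
  same residue class further right. So the image of the former has no component at the latter, and
  this vanishing is constant along diagonals.
\<close>

lemma coef_above:
  assumes u: "\<not> fwd (md u)" and k: "u \<le> k" "k < i" "i \<le> v" "md i = md k"
  shows "coef i k = 0"
  using k
proof (induction k arbitrary: i rule: int_ge_induct)
  case base
  have "rmap (N u v) (md u) (unitvec u) = (0 :: int \<Rightarrow> 'k)"
    using u by (auto simp: rmap_N fun_eq_iff unitvec_def)
  moreover have "(unitvec u :: int \<Rightarrow> 'k) \<in> rspace (N u v) (md (src u))"
    using u unitvec_in_N[of u u v] uv by (simp add: src_def)
  ultimately have "0 = rmap (N u v) (md u) (h (md u) (unitvec u))"
    using endo_edge[of "unitvec u" u] u endo_0[of "tgt u"] by (simp add: src_def)
  from fun_cong[OF this, of "i - 1"] show ?case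
    unfolding coef_def using u base by (simp add: rmap_N)
next
  case (step k)
  have "md (i - 1) = md k" using step.prems by (simp add: mod_eq_dvd_iff algebra_simps)
  then show ?case using coef_diagonal[of k "i - 1"] step by simp
qed

text \<open>
  If the edge at \<open>u\<close> enters the interval, it reaches every basis vector further right in the residue
  class of \<open>u\<close>, but nothing in its image has a component at \<open>u\<close>.
\<close>

lemma coef_below:
  assumes u: "fwd (md u)" and k: "u \<le> i" "i < k" "k \<le> v" "md i = md k"
  shows "coef i k = 0"
  using k
proof (induction i arbitrary: k rule: int_ge_induct)
  case base
  have "md (src u) = md (k - 1)"
    using base u by (simp add: src_def mod_eq_dvd_iff)
  then have "(unitvec (k - 1) :: int \<Rightarrow> 'k) \<in> rspace (N u v) (md (src u))"
    using unitvec_in_N[of u "k - 1" v] base by simp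
  moreover have "rmap (N u v) (md u) (unitvec (k - 1)) = (unitvec k :: int \<Rightarrow> 'k)"
    using u base by (auto simp: rmap_N fun_eq_iff unitvec_def)
  ultimately have eq: "h (md u) (unitvec k) = rmap (N u v) (md u) (h (md (src u)) (unitvec (k - 1)))"
    and in_N: "h (md (src u)) (unitvec (k - 1)) \<in> rspace (N u v) (md (src u))"
    using endo_edge[of "unitvec (k - 1)" u] endo_linear[of "src u"] u unfolding linear_between_def
    by (auto simp: tgt_def)
  have "coef u k = h (md (src u)) (unitvec (k - 1)) (u - 1)"
    unfolding coef_def using eq base u uv by (simp add: rmap_N)
  also have "\<dots> = 0" by (rule rspace_N_outside[OF in_N]) simp
  finally show ?case .
next
  case (step i)
  have "md i = md (k - 1)" using step.prems by (simp add: mod_eq_dvd_iff algebra_simps)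
  then show ?case using coef_diagonal[of "k - 1" i] step by simp
qed

lemma endo_expand:
  assumes f: "f \<in> rspace (N u v) (md x)"
  shows "h (md x) f i = (\<Sum>k\<in>{k \<in> {u..v}. md k = md x}. f k * coef i k)"
proof -
  let ?P = "{k \<in> {u..v}. md k = md x}"
  have "h (md x) f = h (md x) (\<Sum>k\<in>?P. scaleN (f k) (unitvec k))"
    using N_expand[OF f] by simp
  also have "\<dots> = (\<Sum>k\<in>?P. scaleN (f k) (h (md x) (unitvec k)))"
  proof (rule linear_between_sum[OF vector_space_scaleN vector_space_scaleN endo_linear subspace_N])
    fix k assume "k \<in> ?P"
    then show "(unitvec k :: int \<Rightarrow> 'k) \<in> rspace (N u v) (md x)" using unitvec_in_N[of u k v] by auto
  qed
  finally have "h (md x) f i = (\<Sum>k\<in>?P. scaleN (f k) (h (md x) (unitvec k))) i" by simp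
  also have "\<dots> = (\<Sum>k\<in>?P. f k * h (md x) (unitvec k) i)"
    by (simp only: sum_fun_apply)
  also have "\<dots> = (\<Sum>k\<in>?P. f k * coef i k)" by (intro sum.cong refl) (simp add: coef_def)
  finally show ?thesis .
qed

text \<open>
  By \<open>coef_above\<close> and \<open>coef_below\<close> the endomorphism is triangular in one of the two orders, and its diagonal
  is constant. The coordinate of the image at the extremal position of the support is therefore a
  nonzero multiple of the one of \<open>f\<close>.
\<close>

lemma endomorphism_injective:
  assumes c: "h (md u) (unitvec u) u \<noteq> 0" and f: "f \<in> rspace (N u v) (md x)" "h (md x) f = 0"
  shows "f = 0"
proof (rule ccontr)
  assume "f \<noteq> 0"
  let ?P = "{k \<in> {u..v}. md k = md x}"
  let ?Z = "{k \<in> ?P. f k \<noteq> 0}"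
  have finP: "finite ?P" by simp
  have "?Z \<noteq> {}"
  proof
    assume "?Z = {}"
    then have "f k = 0" for k using rspace_N_outside[OF f(1), of k] by auto
    then show False using \<open>f \<noteq> 0\<close> by (auto simp: fun_eq_iff)
  qed
  moreover have finZ: "finite ?Z" by (rule finite_subset[OF _ finP]) auto
  ultimately have Mn: "Min ?Z \<in> ?Z" and Mx: "Max ?Z \<in> ?Z" using Min_in Max_in by blast+
  obtain i where i: "i \<in> ?Z" and tri: "\<And>k. k \<in> ?P \<Longrightarrow> k \<noteq> i \<Longrightarrow> f k * coef i k = 0"
  proof (cases "fwd (md u)")
    case True
    show ?thesis
    proof (rule that[OF Mn])
      fix k assume k: "k \<in> ?P" "k \<noteq> Min ?Z"
      show "f k * coef (Min ?Z) k = 0"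
      proof (cases "k < Min ?Z")
        case True
        then have "k \<notin> ?Z" using Min_le[OF finZ, of k] by auto
        then show ?thesis using k by auto
      next
        case False
        then have "coef (Min ?Z) k = 0" using coef_below[OF \<open>fwd (md u)\<close>, of "Min ?Z" k] Mn k by auto
        then show ?thesis by simp
      qed
    qed
  next
    case False
    show ?thesis
    proof (rule that[OF Mx])
      fix k assume k: "k \<in> ?P" "k \<noteq> Max ?Z"
      show "f k * coef (Max ?Z) k = 0"
      proof (cases "Max ?Z < k")
        case True
        then have "k \<notin> ?Z" using Max_ge[OF finZ, of k] by auto
        then show ?thesis using k by auto
      next
        case False
        then have "coef (Max ?Z) k = 0" using coef_above[OF \<open>\<not> fwd (md u)\<close>, of k "Max ?Z"] Mx k by auto
        then show ?thesis by simp
      qed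
    qed
  qed
  have iP: "i \<in> ?P" "f i \<noteq> 0" using i by auto
  have "h (md x) f i = (\<Sum>k\<in>?P. f k * coef i k)" by (rule endo_expand[OF f(1)])
  also have "\<dots> = f i * coef i i + (\<Sum>k\<in>?P - {i}. f k * coef i k)"
    by (rule sum.remove[OF finP iP(1)])
  also have "(\<Sum>k\<in>?P - {i}. f k * coef i k) = 0" by (rule sum.neutral) (use tri in blast)
  finally have "h (md x) f i = f i * coef u u" using coef_main_diagonal[of i] iP by simp
  then show False using f(2) iP c by (simp add: coef_def)
qed

lemma endomorphism_surjective:
  assumes c: "h (md u) (unitvec u) u \<noteq> 0"
  shows "h (md x) ` rspace (N u v) (md x) = rspace (N u v) (md x)"
proof -
  interpret vector_space "scaleN :: 'k \<Rightarrow> (int \<Rightarrow> 'k) \<Rightarrow> int \<Rightarrow> 'k"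
    by (rule vector_space_scaleN)
  let ?N = "rspace (N u v) (md x) :: (int \<Rightarrow> 'k) set"
  have "{f \<in> ?N. h (md x) f = 0} = {0}"
    using endomorphism_injective[OF c] endo_0[of x] subspace_0[OF subspace_N, of u v "md x"] by auto
  moreover have "dim {0 :: int \<Rightarrow> 'k} = 0"
    using dim_span_eq_card_independent[OF independent_empty] by (simp add: span_empty)
  moreover have "dim ?N = dim {f \<in> ?N. h (md x) f = 0} + dim (h (md x) ` ?N)"
    by (rule dim_rank_nullity[OF vector_space_scaleN vector_space_scaleN endo_linear fd_N])
  ultimately have d: "dim (h (md x) ` ?N) = dim ?N" by simp
  show ?thesis
  proof (rule fd_dim_eq[OF fd_N _ _ d])
    show "subspace (h (md x) ` ?N)"
      by (rule linear_between_image_subspace[OF vector_space_scaleN vector_space_scaleN endo_linear subspace_N])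
    show "h (md x) ` ?N \<subseteq> ?N" using endo_linear unfolding linear_between_def by blast
  qed
qed

end

end

section \<open>Summands \<open>N[u,v]\<close> of a decomposition\<close>

lemma rep_hom_compose:
  assumes "wf_digraph Q" "rep_hom Q U V f" "rep_hom Q V W g"
  shows "rep_hom Q U W (\<lambda>x b. g x (f x b))"
proof -
  interpret wf_digraph Q by fact
  show ?thesis unfolding rep_hom_def
  proof (intro conjI ballI)
    fix x assume "x \<in> verts Q"
    then show "linear_between (rscale U) (rscale W) (rspace U x) (rspace W x) (\<lambda>b. g x (f x b))"
      using assms(2,3) unfolding rep_hom_def by (blast intro: linear_between_compose)
  next
    fix e b assume e: "e \<in> arcs Q" and b: "b \<in> rspace U (tail Q e)"
    have "f (tail Q e) b \<in> rspace V (tail Q e)"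
      using assms(2) tail_in_verts[OF e] b unfolding rep_hom_def linear_between_def by blast
    then show "g (head Q e) (f (head Q e) (rmap U e b)) = rmap W e (g (tail Q e) (f (tail Q e) b))"
      using assms(2,3) e b unfolding rep_hom_def by simp
  qed
qed

lemma rep_hom_restrict:
  assumes "wf_digraph Q" "rep_hom Q V W g" "subrep Q V A"
  shows "rep_hom Q (restrict_rep V A) W g"
proof -
  interpret wf_digraph Q by fact
  show ?thesis unfolding rep_hom_def
  proof (intro conjI ballI)
    fix x assume x: "x \<in> verts Q"
    then have l: "linear_between (rscale V) (rscale W) (rspace V x) (rspace W x) (g x)" "A x \<subseteq> rspace V x"
      using assms(2,3) by (auto simp: rep_hom_def subrep_def)
    then have "linear_between (rscale V) (rscale W) (A x) (rspace W x) (g x)"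
      by (intro linear_between_subset[OF l(1)]) (auto simp: linear_between_def)
    then show "linear_between (rscale (restrict_rep V A)) (rscale W) (rspace (restrict_rep V A) x) (rspace W x) (g x)"
      by (simp add: restrict_rep_def)
  next
    fix e b assume e: "e \<in> arcs Q" and b: "b \<in> rspace (restrict_rep V A) (tail Q e)"
    then have "b \<in> rspace V (tail Q e)"
      using assms(3) tail_in_verts[OF e] by (auto simp: restrict_rep_def subrep_def)
    then show "g (head Q e) (rmap (restrict_rep V A) e b) = rmap W e (g (tail Q e) b)"
      using assms(2) e by (simp add: rep_hom_def restrict_rep_def)
  qed
qed

text \<open>
  The projections are homomorphisms by uniqueness of the components.
\<close>

lemma internal_sum_projections:
  assumes wf: "wf_digraph Q" and V: "quiver_rep Q V" and M: "internal_sum Q V r M"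
  shows "\<exists>p. (\<forall>i<r. rep_hom Q V (restrict_rep V (M i)) (p i)) \<and>
    (\<forall>x\<in>verts Q. \<forall>b\<in>rspace V x. (\<Sum>i<r. p i x b) = b)"
proof -
  interpret vector_space "rscale V" using V by (simp add: quiver_rep_def)
  interpret wf_digraph Q by fact
  have sub: "subrep Q V (M i)" if "i < r" for i using M that by (simp add: internal_sum_def)
  have sM: "subspace (M i x)" if "i < r" "x \<in> verts Q" for i x using sub that by (simp add: subrep_def)
  let ?P = "\<lambda>x b w. w \<in> (\<Pi>\<^sub>E i\<in>{..<r}. M i x) \<and> (\<Sum>i<r. w i) = b"
  define p where "p i x b = (THE w. ?P x b w) i" for i x b
  have ex1: "\<exists>!w. ?P x b w" if "x \<in> verts Q" "b \<in> rspace V x" for x b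
    using M that unfolding internal_sum_def by blast
  have P: "?P x b (THE w. ?P x b w)" if "x \<in> verts Q" "b \<in> rspace V x" for x b
    by (rule theI'[OF ex1[OF that]])
  have sum: "(\<Sum>i<r. p i x b) = b" if "x \<in> verts Q" "b \<in> rspace V x" for x b
    using P[OF that] unfolding p_def by blast
  have mem: "p i x b \<in> M i x" if "x \<in> verts Q" "b \<in> rspace V x" "i < r" for i x b
    using P[OF that(1,2)] that(3) unfolding p_def by (auto simp: PiE_iff)
  have uniq: "p i x b = y i"
    if x: "x \<in> verts Q" and b: "b \<in> rspace V x" and i: "i < r"
      and y: "\<And>i. i < r \<Longrightarrow> y i \<in> M i x" "(\<Sum>i<r. y i) = b" for x b i y
  proof -
    have "?P x b (restrict y {..<r})" using y by auto
    then have "(THE w. ?P x b w) = restrict y {..<r}" by (rule the1_equality[OF ex1[OF x b]])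
    then show ?thesis unfolding p_def using i by simp
  qed
  have "rep_hom Q V (restrict_rep V (M i)) (p i)" if i: "i < r" for i
    unfolding rep_hom_def
  proof (intro conjI ballI)
    fix x assume x: "x \<in> verts Q"
    have sV: "subspace (rspace V x)" using V x by (simp add: quiver_rep_def)
    have "linear_between (rscale V) (rscale V) (rspace V x) (M i x) (p i x)"
      unfolding linear_between_def
    proof (intro conjI ballI allI)
      show "p i x \<in> rspace V x \<rightarrow> M i x" using mem[OF x _ i] by blast
      show "p i x (a + b) = p i x a + p i x b" if ab: "a \<in> rspace V x" "b \<in> rspace V x" for a b
      proof (rule uniq[OF x subspace_add[OF sV ab] i])
        show "p i x a + p i x b \<in> M i x" if "i < r" for i
          using subspace_add[OF sM[OF that x]] mem[OF x _ that] ab by blast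
        show "(\<Sum>i<r. p i x a + p i x b) = a + b" using sum[OF x] ab by (simp add: sum.distrib)
      qed
      show "p i x (rscale V k a) = rscale V k (p i x a)" if a: "a \<in> rspace V x" for k a
      proof (rule uniq[OF x subspace_scale[OF sV a] i])
        show "rscale V k (p i x a) \<in> M i x" if "i < r" for i
          using subspace_scale[OF sM[OF that x]] mem[OF x a that] by blast
        show "(\<Sum>i<r. rscale V k (p i x a)) = rscale V k a"
          using sum[OF x a] by (simp add: scale_sum_right[symmetric])
      qed
    qed
    then show "linear_between (rscale V) (rscale (restrict_rep V (M i))) (rspace V x)
        (rspace (restrict_rep V (M i)) x) (p i x)"
      by (simp add: restrict_rep_def)
  next
    fix e b assume e: "e \<in> arcs Q" and b: "b \<in> rspace V (tail Q e)"
    have t: "tail Q e \<in> verts Q" and h: "head Q e \<in> verts Q" using e by auto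
    have lin: "linear_between (rscale V) (rscale V) (rspace V (tail Q e)) (rspace V (head Q e)) (rmap V e)"
      using V e by (simp add: quiver_rep_def)
    have sV: "subspace (rspace V (tail Q e))" using V t by (simp add: quiver_rep_def)
    have Vh: "rmap V e b \<in> rspace V (head Q e)" using lin b by (auto simp: linear_between_def)
    have inV: "p i (tail Q e) b \<in> rspace V (tail Q e)" if "i < r" for i
      using mem[OF t b that] sub[OF that] t by (auto simp: subrep_def)
    have "p i (head Q e) (rmap V e b) = rmap V e (p i (tail Q e) b)"
    proof (rule uniq[OF h Vh i])
      show "rmap V e (p i (tail Q e) b) \<in> M i (head Q e)" if "i < r" for i
        using sub[OF that] e mem[OF t b that] by (simp add: subrep_def image_subset_iff)
      have "rmap V e (\<Sum>i<r. rscale V 1 (p i (tail Q e) b)) = (\<Sum>i<r. rscale V 1 (rmap V e (p i (tail Q e) b)))"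
        by (rule linear_between_sum[OF vector_space_axioms vector_space_axioms lin sV]) (use inV in simp)
      then show "(\<Sum>i<r. rmap V e (p i (tail Q e) b)) = rmap V e b" using sum[OF t b] by simp
    qed
    then show "p i (head Q e) (rmap V e b) = rmap (restrict_rep V (M i)) e (p i (tail Q e) b)"
      by (simp add: restrict_rep_def)
  qed
  then show ?thesis using sum by blast
qed

context cyclic
begin

text \<open>
  The composite endomorphism of \<open>N[u,v]\<close> is bijective, so \<open>X\<close> is the direct sum of the image of
  \<open>f\<close> and the kernel of \<open>g\<close>. The image is nonzero, hence the kernel vanishes and \<open>g\<close> is an
  isomorphism.
\<close>

lemma indecomposable_iso_N:
  fixes X :: "(int, int, 'k::field, 'b::ab_group_add) qrep"
  assumes uv: "u \<le> v" and X: "indecomposable_rep Q X"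
    and f: "rep_hom Q (N u v) X f" and g: "rep_hom Q X (N u v) g"
    and c: "g (md u) (f (md u) (unitvec u)) u \<noteq> 0"
  shows "rep_iso Q X (N u v :: 'k nrep)"
proof -
  let ?N = "N u v :: 'k nrep"
  have repX: "quiver_rep Q X" using X by (simp add: indecomposable_rep_def)
  interpret vector_space "rscale X" using repX by (simp add: quiver_rep_def)
  note vN = vector_space_scaleN
  let ?h = "\<lambda>x b. g x (f x b)"
  have h: "rep_hom Q ?N ?N ?h" by (rule rep_hom_compose[OF wf_Q f g])
  have f_lin: "linear_between scaleN (rscale X) (rspace ?N x) (rspace X x) (f x)" if "x \<in> verts Q" for x
    using f that by (simp add: rep_hom_def)
  have g_lin: "linear_between (rscale X) scaleN (rspace X x) (rspace ?N x) (g x)" if "x \<in> verts Q" for x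
    using g that by (simp add: rep_hom_def)
  have sX: "subspace (rspace X x)" if "x \<in> verts Q" for x using repX that by (simp add: quiver_rep_def)
  have g0: "g x 0 = 0" if "x \<in> verts Q" for x
    by (rule linear_between_0[OF vector_space_axioms vN g_lin[OF that] sX[OF that]])
  have f0: "f x 0 = 0" if "x \<in> verts Q" for x
    by (rule linear_between_0[OF vN vector_space_axioms f_lin[OF that] subspace_N])
  have surj: "?h x ` rspace ?N x = rspace ?N x" if "x \<in> verts Q" for x
    using endomorphism_surjective[OF uv h c, of x] md_id[OF that] by simp
  have inj: "b = 0" if "x \<in> verts Q" "b \<in> rspace ?N x" "?h x b = 0" for x b
    by (rule endomorphism_injective[OF uv h c, where x = x, unfolded md_id[OF that(1)], OF that(2,3)])
  let ?U = "\<lambda>x. f x ` rspace ?N x"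
  let ?K = "\<lambda>x. {b \<in> rspace X x. g x b \<in> {0}}"
  have U: "subrep Q X ?U"
    by (rule subrep_hom_image[OF wf_Q quiver_rep_N repX f subrep_self[OF wf_Q quiver_rep_N]])
  have Z: "subrep Q ?N (\<lambda>x. {0})"
  proof -
    interpret n: vector_space "scaleN :: 'k \<Rightarrow> (int \<Rightarrow> 'k) \<Rightarrow> int \<Rightarrow> 'k" by (rule vN)
    have "rmap ?N e 0 = 0" if e: "e \<in> arcs Q" for e
      using rmap_N[of u v e "0 :: int \<Rightarrow> 'k"] arc_md[OF e] by (auto simp: fun_eq_iff)
    then show ?thesis using n.subspace_0[OF subspace_N] by (auto simp: subrep_def)
  qed
  have K: "subrep Q X ?K"
    by (rule subrep_hom_vimage[OF wf_Q repX quiver_rep_N g Z subrep_self[OF wf_Q repX]])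
  have split: "?U x \<inter> ?K x = {0} \<and> rspace X x = {a + b | a b. a \<in> ?U x \<and> b \<in> ?K x}"
    if x: "x \<in> verts Q" for x
  proof
    have Ux: "?U x \<subseteq> rspace X x" using U x by (simp add: subrep_def)
    show "?U x \<inter> ?K x = {0}"
    proof
      show "?U x \<inter> ?K x \<subseteq> {0}"
      proof
        fix b assume "b \<in> ?U x \<inter> ?K x"
        then obtain a where a: "a \<in> rspace ?N x" "b = f x a" "g x b = 0" by blast
        then have "a = 0" using inj[OF x a(1)] by simp
        then show "b \<in> {0}" using a f0[OF x] by simp
      qed
      have "subspace (?U x)" "subspace (?K x)" using U K x unfolding subrep_def by blast+
      then show "{0} \<subseteq> ?U x \<inter> ?K x" using subspace_0 by blast
    qed
    show "rspace X x = {a + b | a b. a \<in> ?U x \<and> b \<in> ?K x}"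
    proof
      show "{a + b | a b. a \<in> ?U x \<and> b \<in> ?K x} \<subseteq> rspace X x"
        using Ux subspace_add[OF sX[OF x]] by blast
      show "rspace X x \<subseteq> {a + b | a b. a \<in> ?U x \<and> b \<in> ?K x}"
      proof
        fix b assume b: "b \<in> rspace X x"
        then have "g x b \<in> rspace ?N x" using g_lin[OF x] unfolding linear_between_def by blast
        then obtain a where a: "a \<in> rspace ?N x" "g x b = ?h x a" using surj[OF x] by blast
        have fa: "f x a \<in> rspace X x" using a(1) Ux by blast
        have d: "b - f x a \<in> rspace X x" by (rule subspace_diff[OF sX[OF x] b fa])
        have "g x ((b - f x a) + f x a) = g x (b - f x a) + g x (f x a)"
          using g_lin[OF x] d fa unfolding linear_between_def by blast
        then have "g x (b - f x a) = 0" using a(2) by simp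
        then have "b - f x a \<in> ?K x" using d by simp
        moreover have "b = f x a + (b - f x a)" by simp
        moreover have "f x a \<in> ?U x" using a(1) by blast
        ultimately show "b \<in> {a + b | a b. a \<in> ?U x \<and> b \<in> ?K x}" by blast
      qed
    qed
  qed
  have "\<not> nonzero_rep Q (restrict_rep X ?U) \<or> \<not> nonzero_rep Q (restrict_rep X ?K)"
  proof -
    have "\<forall>U W. subrep Q X U \<and> subrep Q X W \<and>
        (\<forall>x\<in>verts Q. U x \<inter> W x = {0} \<and> rspace X x = {u + w | u w. u \<in> U x \<and> w \<in> W x})
        \<longrightarrow> \<not> nonzero_rep Q (restrict_rep X U) \<or> \<not> nonzero_rep Q (restrict_rep X W)"
      using X unfolding indecomposable_rep_def by (elim conjE)
    from this[rule_format, of ?U ?K] show ?thesis using U K split by simp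
  qed
  moreover have "nonzero_rep Q (restrict_rep X ?U)"
  proof -
    have "f (md u) (unitvec u) \<in> ?U (md u)" using unitvec_in_N[of u u v] uv by blast
    moreover have "f (md u) (unitvec u) \<noteq> 0" using c g0[OF md_in(1), of u] by auto
    ultimately show ?thesis unfolding nonzero_rep_def restrict_rep_def
      by (intro bexI[OF _ md_in(1), of _ u]) auto
  qed
  ultimately have K0: "?K x = {0}" if "x \<in> verts Q" for x
    using that unfolding nonzero_rep_def restrict_rep_def by auto
  have "bij_betw (g x) (rspace X x) (rspace ?N x)" if x: "x \<in> verts Q" for x
  proof -
    have "inj_on (g x) (rspace X x)"
    proof (rule inj_onI)
      fix a b assume ab: "a \<in> rspace X x" "b \<in> rspace X x" "g x a = g x b"
      have d: "a - b \<in> rspace X x" by (rule subspace_diff[OF sX[OF x] ab(1,2)])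
      have "g x ((a - b) + b) = g x (a - b) + g x b"
        using g_lin[OF x] d ab(2) unfolding linear_between_def by blast
      then have "a - b \<in> ?K x" using ab d by simp
      then have "a - b \<in> {0}" unfolding K0[OF x] .
      then show "a = b" by simp
    qed
    moreover have "g x ` rspace X x = rspace ?N x"
    proof
      show "g x ` rspace X x \<subseteq> rspace ?N x" using g_lin[OF x] unfolding linear_between_def by blast
      have "?U x \<subseteq> rspace X x" using U x by (simp add: subrep_def)
      then show "rspace ?N x \<subseteq> g x ` rspace X x" using surj[OF x] by blast
    qed
    ultimately show ?thesis by (simp add: bij_betw_def)
  qed
  then show ?thesis unfolding rep_iso_def using g by blast
qed

text \<open>
  Isomorphic representations have the same total dimension, and for \<open>N[u,v]\<close> it is the length of the
  interval; so lengths are bounded by the total dimension of \<open>V\<close>. Infinite index sets would make the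
  sums in the theorem collapse to zero.
\<close>

lemma finite_N_summands:
  fixes V :: "(int, int, 'k::field, 'b::ab_group_add) qrep"
  assumes V: "quiver_rep Q V" and fd: "\<And>x. x \<in> verts Q \<Longrightarrow> fd_subspace (rscale V) (rspace V x)"
    and M: "\<And>i. i < r \<Longrightarrow> subrep Q V (M i)"
  shows "finite (N_summands n fwd V r M)"
proof -
  interpret vector_space "rscale V" using V by (simp add: quiver_rep_def)
  let ?D = "total (dim_at V)"
  have "N_summands n fwd V r M \<subseteq> {0..<int n} \<times> {0..int n + int ?D}"
  proof
    fix p assume p: "p \<in> N_summands n fwd V r M"
    obtain u v where uv: "p = (u, v)" by (cases p)
    then obtain i where i: "i < r" "u \<in> {0..<int n}" "u \<le> v"
      and iso: "rep_iso Q (restrict_rep V (M i)) (N u v :: 'k nrep)"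
      using p unfolding N_summands_def by blast
    let ?N = "N u v :: 'k nrep"
    obtain f where f: "rep_hom Q (restrict_rep V (M i)) ?N f"
      and bij: "\<And>x. x \<in> verts Q \<Longrightarrow> bij_betw (f x) (M i x) (rspace ?N x)"
      using iso unfolding rep_iso_def by (auto simp: restrict_rep_def)
    have "residue_count u v x \<le> dim_at V x" if x: "x \<in> verts Q" for x
    proof -
      have sM: "subspace (M i x)" and MV: "M i x \<subseteq> rspace V x"
        using M[OF i(1)] x by (simp_all add: subrep_def)
      have fdM: "fd_subspace (rscale V) (M i x)" by (rule fd_subset[OF fd[OF x] sM MV])
      have lin: "linear_between (rscale V) scaleN (M i x) (rspace ?N x) (f x)"
        using f x by (simp add: rep_hom_def restrict_rep_def)
      have "dim (M i x) = dim {b \<in> M i x. f x b = 0} + vector_space.dim scaleN (f x ` M i x)"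
        by (rule dim_rank_nullity[OF vector_space_axioms vector_space_scaleN lin fdM])
      moreover have "f x ` M i x = rspace ?N x" using bij[OF x] by (simp add: bij_betw_def)
      moreover have "vector_space.dim scaleN (rspace ?N x) = residue_count u v x"
        using dim_N[of u v x, where 'k = 'k] by (simp add: dim_at_def)
      moreover have "dim (M i x) \<le> dim_at V x"
        unfolding dim_at_def by (rule fd_dim_mono[OF fd[OF x] sM MV])
      ultimately show ?thesis by simp
    qed
    then have "total (residue_count u v) \<le> ?D" unfolding total_def by (rule sum_mono)
    then have "v - u + 1 \<le> int ?D" using i(3) by (simp add: total_residue_count)
    then show "p \<in> {0..<int n} \<times> {0..int n + int ?D}" using uv i by auto
  qed
  then show ?thesis by (rule finite_subset) simp
qed

end

context lift_iso
begin

text \<open>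
  The copy with \<open>c = 0\<close> and \<open>k = 0\<close> of the interval provides \<open>f: N[u,w] \<rightarrow> V\<close> and
  \<open>g: V \<rightarrow> N[u,w]\<close> such that \<open>g f\<close> has coefficient 1 at \<open>u\<close>. This coefficient is additive, so it is
  nonzero for the composite through at least one of the summands of \<open>V\<close>.
\<close>

lemma interval_in_N_summands:
  assumes M: "indecomposable_decomposition Q V r M"
    and u: "u \<in> {0..<int n}" "u \<le> w" "0 < d u (Fin w)"
  shows "(u, w) \<in> N_summands n fwd V r M"
proof -
  interpret vector_space "rscale V" using rep_V by (simp add: quiver_rep_def)
  let ?N = "N u w :: 'k nrep"
  define i0 where "i0 = (Inr (u, Fin w, 0, 0) :: lift_index)"
  have i0: "i0 \<in> index_set" "interval i0 = {u..w}"
    using u by (auto simp: i0_def lift_indices_def interval_def Plus_def)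
  let ?f = "\<lambda>x :: int. chain_hom u w (lifted_basis i0)"
  let ?g = "cochain_hom u w (\<lambda>x b. \<phi> x b i0)"
  have f: "rep_hom Q ?N V ?f" by (rule chain_hom_rep_hom) (use lifted_basis_chain[OF i0(1)] i0(2) in simp)
  have g: "rep_hom Q V ?N ?g" by (rule cochain_hom_rep_hom) (use \<phi>_cochain[OF i0(1)] i0(2) in simp)
  have sum: "internal_sum Q V r M" and ind: "\<And>i. i < r \<Longrightarrow> indecomposable_rep Q (restrict_rep V (M i))"
    using M by (auto simp: indecomposable_decomposition_def)
  obtain p where p: "\<And>i. i < r \<Longrightarrow> rep_hom Q V (restrict_rep V (M i)) (p i)"
    "\<And>x b. x \<in> verts Q \<Longrightarrow> b \<in> rspace V x \<Longrightarrow> (\<Sum>i<r. p i x b) = b"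
    using internal_sum_projections[OF wf_Q rep_V sum] by auto
  let ?c = "lifted_basis i0 u"
  have uI: "u \<in> interval i0" using i0(2) u by simp
  have c: "?c \<in> Vm u" "\<phi> u ?c i0 = 1" using lifted_basis[OF i0(1) uI] by (simp_all add: unit_coordinate_def)
  have fu: "?f x (unitvec u) = ?c" for x using chain_hom_unitvec[of u u w] u by simp
  have pV: "p i (md u) ?c \<in> Vm u" if "i < r" for i
  proof -
    have "p i (md u) ?c \<in> M i (md u)"
      using p(1)[OF that] c(1) md_in(1)[of u] unfolding rep_hom_def linear_between_def
      by (auto simp: restrict_rep_def)
    moreover have "subrep Q V (M i)" using sum that by (simp add: internal_sum_def)
    ultimately show ?thesis using md_in(1)[of u] unfolding subrep_def by blast
  qed
  have lin: "linear_between (rscale V) (*) (Vm u) UNIV (\<lambda>b. \<phi> u b i0)"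
    using \<phi>_cochain[OF i0(1)] uI unfolding cochain_def by blast
  have vs: "vector_space ((*) :: 'k \<Rightarrow> 'k \<Rightarrow> 'k)" by unfold_locales (auto simp: algebra_simps)
  have "\<phi> u (\<Sum>i<r. rscale V 1 (p i (md u) ?c)) i0 = (\<Sum>i<r. 1 * \<phi> u (p i (md u) ?c) i0)"
    by (rule linear_between_sum[OF vector_space_axioms vs lin Vm_subspace]) (use pV in simp)
  then have "(\<Sum>i<r. \<phi> u (p i (md u) ?c) i0) = 1"
    using p(2)[OF md_in(1) c(1)] c(2) by simp
  then have "\<exists>i<r. \<phi> u (p i (md u) ?c) i0 \<noteq> 0"
    by (metis (no_types, lifting) lessThan_iff sum.neutral zero_neq_one)
  then obtain i where i: "i < r" "\<phi> u (p i (md u) ?c) i0 \<noteq> 0" by blast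
  let ?X = "restrict_rep V (M i)"
  have sub: "subrep Q V (M i)" using sum i by (simp add: internal_sum_def)
  have "rep_iso Q ?X ?N"
  proof (rule indecomposable_iso_N[OF u(2) ind[OF i(1)]])
    show "rep_hom Q ?N ?X (\<lambda>x b. p i x (?f x b))" by (rule rep_hom_compose[OF wf_Q f p(1)[OF i(1)]])
    show "rep_hom Q ?X ?N ?g" by (rule rep_hom_restrict[OF wf_Q g sub])
    show "?g (md u) (p i (md u) (?f (md u) (unitvec u))) u \<noteq> 0"
      unfolding fu using i(2) u by (simp add: cochain_hom_def)
  qed
  then show ?thesis unfolding N_summands_def using u i(1) by blast
qed

end

theorem mainTheorem2:
  fixes n m r dinf j :: nat
    and fwd :: "int \<Rightarrow> bool"
    and Q :: "(int, int) pre_digraph"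
    and V :: "(int, int, 'k::alg_closed_field, 'b::ab_group_add) qrep"
    and F :: "nat \<Rightarrow> int \<Rightarrow> 'b set"
    and S :: "nat \<Rightarrow> (int, int, 'k, 'c::ab_group_add) qrep"
    and d :: "int \<Rightarrow> int extended \<Rightarrow> nat"
    and M :: "nat \<Rightarrow> int \<Rightarrow> 'b set"
    and N :: "int \<Rightarrow> int \<Rightarrow> (int, int, 'k, int \<Rightarrow> 'k) qrep"
  assumes "2 \<le> n"
    and "Q = cyclic_quiver n fwd"
    and "acyclic_quiver Q"
    and "finite_dim_rep Q V"
    and "nonzero_rep Q V"
    and "HN_filtration Q (euler_stability Q) V m F S"
    and "lift_decomposition n fwd V dinf d"
    and "indecomposable_decomposition Q V r M"
    and "N = N_rep n fwd"
    and "j \<in> {1..m}"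
  shows "(slope Q (euler_stability Q) (S j) \<noteq> 0 \<longrightarrow>
            (\<forall>x\<in>verts Q. dim_at (S j) x =
              (\<Sum>(u, v) \<in> {(u, v) \<in> N_summands n fwd V r M.
                   slope Q (euler_stability Q) (N u v) = slope Q (euler_stability Q) (S j)}.
                 d u (Fin v) * dim_at (N u v) x))) \<and>
         (slope Q (euler_stability Q) (S j) = 0 \<longrightarrow>
            (\<forall>x\<in>verts Q. dim_at (S j) x = dinf +
              (\<Sum>(u, v) \<in> {(u, v) \<in> N_summands n fwd V r M.
                   slope Q (euler_stability Q) (N u v) = 0}.
                 d u (Fin v) * dim_at (N u v) x)))"
proof -
  interpret cyclic n fwd by unfold_locales (use assms(1) in simp)
  have rep: "quiver_rep (cyclic_quiver n fwd) V"
    and fd: "\<And>x. x \<in> verts (cyclic_quiver n fwd) \<Longrightarrow> fd_subspace (rscale V) (rspace V x)"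
    using assms(2,4) by (auto simp: finite_dim_rep_def fd_subspace_def quiver_rep_def)
  obtain \<phi> where \<phi>: "rep_hom (unwinding n fwd) (lift_rep n V)
      (rep_sum (lift_indices n dinf d) (lift_summand n fwd)) \<phi>"
    "\<And>x. bij_betw (\<phi> x) (rspace (lift_rep n V) x)
      (rspace (rep_sum (lift_indices n dinf d) (lift_summand n fwd)) x)"
    using assms(7) unfolding lift_decomposition_def rep_iso_def lift_indices_def lift_summand_def
    by (auto simp: unwinding_def)
  interpret lift_HN n fwd V dinf d \<phi> m F S
    by unfold_locales (use rep fd \<phi> finite_verts_Q assms(2,6)
        wf_digraph.tail_in_verts[OF wf_Q] wf_digraph.head_in_verts[OF wf_Q] in auto)
  obtain j' where j: "j = Suc j'" "j' < m" using assms(10) by (cases j) auto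
  let ?\<mu> = "slope Q (euler_stability Q) (S j)"
  let ?A = "{(u, v) \<in> N_summands n fwd V r M. slope Q (euler_stability Q) (N u v) = ?\<mu>}"
  have slope: "slope Q (euler_stability Q) (N u v) = N_slope u v" if "u \<le> v" for u v
    using slope_N[OF that, where 'k = 'k] assms(2,9) by simp
  have dims: "dim_at (S j) x = (if ?\<mu> = 0 then dinf else 0) + (\<Sum>(u, v)\<in>?A. d u (Fin v) * dim_at (N u v) x)"
    if x: "x \<in> verts Q" for x
  proof -
    have x': "x \<in> verts (cyclic_quiver n fwd)" using x assms(2) by simp
    have "dim_at (S j) x = card {i \<in> indices_at x. index_slope i = ?\<mu>}"
      using dim_quotient[OF j(2) x'] j(1) assms(2) by simp
    also have "\<dots> = (if ?\<mu> = 0 then dinf else 0) + (\<Sum>(u, v)\<in>?A. d u (Fin v) * residue_count u v x)"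
    proof (rule card_indices_slope[OF x'])
      have "finite (N_summands n fwd V r M)"
        by (rule finite_N_summands[OF rep fd])
          (use assms(2,8) in \<open>auto simp: indecomposable_decomposition_def internal_sum_def\<close>)
      then show "finite ?A" by (rule finite_subset[rotated]) auto
      show "u \<in> {0..<int n} \<and> u \<le> w \<and> N_slope u w = ?\<mu>" if "(u, w) \<in> ?A" for u w
        using that slope by (auto simp: N_summands_def)
      show "(u, w) \<in> ?A" if "u \<in> {0..<int n}" "u \<le> w" "N_slope u w = ?\<mu>" "0 < d u (Fin w)" for u w
        using interval_in_N_summands[of r M u w] assms(2,8) that slope by auto
    qed
    also have "(\<Sum>(u, v)\<in>?A. d u (Fin v) * residue_count u v x) = (\<Sum>(u, v)\<in>?A. d u (Fin v) * dim_at (N u v) x)"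
      using assms(9) by (simp add: dim_N)
    finally show ?thesis .
  qed
  show ?thesis
  proof (intro conjI impI ballI)
    fix x assume "?\<mu> \<noteq> 0" "x \<in> verts Q"
    then show "dim_at (S j) x = (\<Sum>(u, v)\<in>?A. d u (Fin v) * dim_at (N u v) x)" using dims by simp
  next
    fix x assume 0: "?\<mu> = 0" and x: "x \<in> verts Q"
    show "dim_at (S j) x = dinf + (\<Sum>(u, v) \<in> {(u, v) \<in> N_summands n fwd V r M.
        slope Q (euler_stability Q) (N u v) = 0}. d u (Fin v) * dim_at (N u v) x)"
      using dims[OF x] unfolding 0 by simp
  qed
qed

end
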